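(* Thompson's groups $F<T<V$ are uniformly SENS.
   Context: $F$ is the group of (orientation-preserving) piecewise affine homeomorphisms of $[0,1]$ with finitely many breakpoints, all dyadic, and slopes powers of $2$. $T$ is the analogous group of orientation-preserving piecewise affine homeomorphisms of $\mathbb{R}/\mathbb{Z}$ with dyadic breakpoints, slopes powers of $2$, mapping dyadic rationals to dyadic rationals. $V$ is the group of homeomorphisms of $\{0,1\}^{\omega}$ of the form $u_iw\mapsto v_iw$ ($1\le i\le n$) for finite complete prefix codes $\{u_1,\dots,u_n\}$, $\{v_1,\dots,v_n\}$. All three groups are finitely generated. A finite standard generating set of a finitely generated group $G$ is $\Sigma=S\cup S^{-1}\cup\{1\}$, where $S$ is a finite set together with a surjective homomorphism from the free group on $S$ onto $G$; words over $\Sigma$ are evaluated in $G$, the letter $1$ evaluating to the identity. For words, $(a_1\cdots a_n)^{-1}=a_n^{-1}\cdots a_1^{-1}$ and $[h,g]=h^{-1}g^{-1}hg$. $G$ is strongly efficiently non-solvable (SENS) if there is a constant $\mu\in\mathbb{N}$ such that for every $d\in\mathbb{N}$ there are words $g_{d,v}\in\Sigma^*$ for $v\in\{0,1\}^{\le d}$ with (a) $|g_{d,v}|=2^{\mu d}$ for $v\in\{0,1\}^d$; (b) $g_{d,v}=[g_{d,v0},g_{d,v1}]$ (as words) for $v\in\{0,1\}^{<d}$; (c) $g_{d,\varepsilon}\neq1$ in $G$. It is uniformly SENS if moreover (d) given $v\in\{0,1\}^d$, a number $i$ in binary with $\mu d$ bits, and $a\in\Sigma$, one can decide in $\mathsf{DLINTIME}$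 (deterministic linear time, on Turing machines with random access to the input) whether the $i$-th letter of $g_{d,v}$ is $a$. These properties do not depend on the choice of $\Sigma$. *)

theory Defs
  imports
    "HOL-Analysis.Elementary_Topology"
    "HOL-Algebra.Bij"
    "HOL-Algebra.Generated_Groups"
    "HOL-Library.Stream"
    "HOL-Library.Sublist"
begin

section \<open>Thompson's groups\<close>

definition dyadics :: "real set" where
  "dyadics = {x. \<exists>(m::int) (n::nat). x = of_int m / 2 ^ n}"

text \<open>The set \<open>B\<close> contains the breakpoints of \<open>f\<close> in \<open>{p..q}\<close>.\<close>

definition dyadic_piecewise_affine_on :: "real \<Rightarrow> real \<Rightarrow> (real \<Rightarrow> real) \<Rightarrow> bool" where
  "dyadic_piecewise_affine_on p q f \<longleftrightarrow>
    (\<exists>B. finite B \<and> B \<subseteq> dyadics \<and>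
      (\<forall>a b. p \<le> a \<and> a < b \<and> b \<le> q \<and> {a<..<b} \<inter> B = {} \<longrightarrow>
        (\<exists>(k::int) (c::real). \<forall>x\<in>{a..b}. f x = 2 powi k * x + c)))"

definition thompson_F :: "(real \<Rightarrow> real) monoid" where
  "thompson_F = (BijGroup {0..1})
    \<lparr>carrier := {f \<in> Bij {0..1}.
        (\<exists>g. homeomorphism {0..1} {0..1} f g) \<and> strict_mono_on {0..1} f \<and>
        dyadic_piecewise_affine_on 0 1 f}\<rparr>"

text \<open>
  Points of \<open>\<real>/\<int>\<close> are the cosets of \<open>\<int>\<close>. An orientation-preserving homeomorphism of
  \<open>\<real>/\<int>\<close> is a map induced by an increasing homeomorphism \<open>h\<close> of the real line that commutes
  with the translation by 1. By periodicity (and as 0 is dyadic), being piecewise affine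
  need only be required of the lift \<open>h\<close> on \<open>{0..1}\<close>.
\<close>

definition circle_proj :: "real \<Rightarrow> real set" where
  "circle_proj x = {y. y - x \<in> \<int>}"

definition circle :: "real set set" where
  "circle = range circle_proj"

definition thompson_T :: "(real set \<Rightarrow> real set) monoid" where
  "thompson_T = (BijGroup circle)
    \<lparr>carrier := {f \<in> Bij circle. \<exists>h.
        (\<forall>x. f (circle_proj x) = circle_proj (h x)) \<and>
        (\<exists>g. homeomorphism UNIV UNIV h g) \<and> strict_mono h \<and> (\<forall>x. h (x + 1) = h x + 1) \<and>
        dyadic_piecewise_affine_on 0 1 h \<and> h ` dyadics \<subseteq> dyadics}\<rparr>"

text \<open>
  Infinite binary words are streams, and \<open>u @- w\<close> is the finite word \<open>u\<close> followed by the
  infinite word \<open>w\<close>. A map of the form used for \<open>V\<close> and its inverse are locally prefix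
  replacements on finitely many cylinder sets, hence continuous for the product topology.
\<close>

definition complete_prefix_code :: "bool list set \<Rightarrow> bool" where
  "complete_prefix_code C \<longleftrightarrow> finite C \<and>
    (\<forall>u\<in>C. \<forall>v\<in>C. prefix u v \<longrightarrow> u = v) \<and>
    (\<forall>s :: bool stream. \<exists>u\<in>C. \<exists>w. s = u @- w)"

definition thompson_V :: "(bool stream \<Rightarrow> bool stream) monoid" where
  "thompson_V = (BijGroup UNIV)
    \<lparr>carrier := {f \<in> Bij UNIV. \<exists>us vs.
        length us = length vs \<and> distinct us \<and> distinct vs \<and>
        complete_prefix_code (set us) \<and> complete_prefix_code (set vs) \<and>
        (\<forall>i<length us. \<forall>w. f (us ! i @- w) = vs ! i @- w)}\<rparr>"

text \<open>The point of \<open>\<real>/\<int>\<close> with a given binary expansion.\<close>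

definition circle_of_binary :: "bool stream \<Rightarrow> real set" where
  "circle_of_binary s = circle_proj (\<Sum>n. of_bool (s !! n) / 2 ^ Suc n)"

section \<open>Standard generating sets and words\<close>

text \<open>
  The letters of \<open>\<Sigma> = S \<union> S\<inverse> \<union> {1}\<close> are formal symbols. The finite set \<open>S\<close> of names is,
  without loss of generality, a set of natural numbers; \<open>\<phi>\<close> gives the values of the
  generators and need not be injective. The homomorphism from the free group on \<open>S\<close>
  determined by \<open>\<phi>\<close> has image \<open>generate G (\<phi> ` S)\<close>.
\<close>

datatype letter = Gen nat | GenInv nat | Unit

definition standard_alphabet :: "nat set \<Rightarrow> letter set" where
  "standard_alphabet S = Gen ` S \<union> GenInv ` S \<union> {Unit}"

definition standard_generators :: "('g, 'b) monoid_scheme \<Rightarrow> nat set \<Rightarrow> (nat \<Rightarrow> 'g) \<Rightarrow> bool" where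
  "standard_generators G S \<phi> \<longleftrightarrow>
    finite S \<and> \<phi> ` S \<subseteq> carrier G \<and> generate G (\<phi> ` S) = carrier G"

definition finitely_generated_group :: "('g, 'b) monoid_scheme \<Rightarrow> bool" where
  "finitely_generated_group G \<longleftrightarrow> group G \<and> (\<exists>S \<phi>. standard_generators G S \<phi>)"

fun letter_value :: "('g, 'b) monoid_scheme \<Rightarrow> (nat \<Rightarrow> 'g) \<Rightarrow> letter \<Rightarrow> 'g" where
  "letter_value G \<phi> (Gen s) = \<phi> s"
| "letter_value G \<phi> (GenInv s) = inv\<^bsub>G\<^esub> (\<phi> s)"
| "letter_value G \<phi> Unit = \<one>\<^bsub>G\<^esub>"

definition word_value :: "('g, 'b) monoid_scheme \<Rightarrow> (nat \<Rightarrow> 'g) \<Rightarrow> letter list \<Rightarrow> 'g" where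
  "word_value G \<phi> w = foldr (\<lambda>a x. letter_value G \<phi> a \<otimes>\<^bsub>G\<^esub> x) w \<one>\<^bsub>G\<^esub>"

fun letter_inverse :: "letter \<Rightarrow> letter" where
  "letter_inverse (Gen s) = GenInv s"
| "letter_inverse (GenInv s) = Gen s"
| "letter_inverse Unit = Unit"

definition word_inverse :: "letter list \<Rightarrow> letter list" where
  "word_inverse w = rev (map letter_inverse w)"

definition word_commutator :: "letter list \<Rightarrow> letter list \<Rightarrow> letter list" where
  "word_commutator h g = word_inverse h @ word_inverse g @ h @ g"

section \<open>Deterministic linear time with random access to the input\<close>

text \<open>
  The machines have finitely many one-way infinite work tapes and no sequential input head.
  The input is read through tape 0, the address tape: in every step the transition function
  sees the input symbol (if any) at the 0-based position whose binary representation, least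
  significant bit in cell 0, is the maximal block of digits at the beginning of tape 0.
  A machine with explicit query states differs only by a constant factor in its running time.
\<close>

datatype cell = Blank | Digit bool | Mark nat

datatype direction = MoveLeft | MoveRight | Stay

type_synonym tape = "(nat \<Rightarrow> cell) \<times> nat"

record 'a ram_tm =
  num_tapes :: nat
  states :: "nat set"
  start_state :: nat
  accept_state :: nat
  reject_state :: nat
  tape_symbols :: "cell set"
  transition :: "nat \<Rightarrow> 'a option \<Rightarrow> cell list \<Rightarrow> nat \<times> (cell \<times> direction) list"

definition wf_ram_tm :: "'a set \<Rightarrow> 'a ram_tm \<Rightarrow> bool" where
  "wf_ram_tm A M \<longleftrightarrow>
    num_tapes M \<ge> 1 \<and> finite (states M) \<and> finite (tape_symbols M) \<and>
    {start_state M, accept_state M, reject_state M} \<subseteq> states M \<and>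
    accept_state M \<noteq> reject_state M \<and>
    {Blank, Digit False, Digit True} \<subseteq> tape_symbols M \<and>
    (\<forall>q\<in>states M. \<forall>x\<in>insert None (Some ` A). \<forall>cs. length cs = num_tapes M \<and> set cs \<subseteq> tape_symbols M \<longrightarrow>
      (case transition M q x cs of (q', acts) \<Rightarrow>
        q' \<in> states M \<and> length acts = num_tapes M \<and> fst ` set acts \<subseteq> tape_symbols M))"

definition address :: "tape \<Rightarrow> nat" where
  "address t = (\<Sum>k < (LEAST n. fst t n \<notin> range Digit). if fst t k = Digit True then 2 ^ k else 0)"

fun move_head :: "direction \<Rightarrow> nat \<Rightarrow> nat" where
  "move_head MoveLeft p = p - 1"
| "move_head MoveRight p = p + 1"
| "move_head Stay p = p"

definition act_on_tape :: "cell \<times> direction \<Rightarrow> tape \<Rightarrow> tape" where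
  "act_on_tape a t = ((fst t)(snd t := fst a), move_head (snd a) (snd t))"

definition input_symbol :: "'a list \<Rightarrow> tape list \<Rightarrow> 'a option" where
  "input_symbol w ts = (let i = address (ts ! 0) in if i < length w then Some (w ! i) else None)"

definition initial_config :: "'a ram_tm \<Rightarrow> nat \<times> tape list" where
  "initial_config M = (start_state M, replicate (num_tapes M) (\<lambda>_. Blank, 0))"

definition step :: "'a ram_tm \<Rightarrow> 'a list \<Rightarrow> nat \<times> tape list \<Rightarrow> nat \<times> tape list" where
  "step M w = (\<lambda>(q, ts).
    if q = accept_state M \<or> q = reject_state M then (q, ts)
    else case transition M q (input_symbol w ts) (map (\<lambda>t. fst t (snd t)) ts) of
      (q', acts) \<Rightarrow> (q', map2 act_on_tape acts ts))"

definition final_state :: "'a ram_tm \<Rightarrow> 'a list \<Rightarrow> nat \<Rightarrow> nat" where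
  "final_state M w t = fst ((step M w ^^ t) (initial_config M))"

definition DLINTIME :: "'a set \<Rightarrow> 'a list set set" where
  "DLINTIME A = {L. finite A \<and> L \<subseteq> lists A \<and>
    (\<exists>M c. wf_ram_tm A M \<and>
      (\<forall>w\<in>lists A. final_state M w (c * length w + c) =
        (if w \<in> L then accept_state M else reject_state M)))}"

section \<open>Uniformly strongly efficiently non-solvable groups\<close>

definition sens_family ::
    "('g, 'b) monoid_scheme \<Rightarrow> nat set \<Rightarrow> (nat \<Rightarrow> 'g) \<Rightarrow> nat \<Rightarrow> (nat \<Rightarrow> bool list \<Rightarrow> letter list) \<Rightarrow> bool"
  where "sens_family G S \<phi> \<mu> g \<longleftrightarrow> (\<forall>d.
    (\<forall>v. length v \<le> d \<longrightarrow> g d v \<in> lists (standard_alphabet S)) \<and>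
    (\<forall>v. length v = d \<longrightarrow> length (g d v) = 2 ^ (\<mu> * d)) \<and>
    (\<forall>v. length v < d \<longrightarrow> g d v = word_commutator (g d (v @ [False])) (g d (v @ [True]))) \<and>
    word_value G \<phi> (g d []) \<noteq> \<one>\<^bsub>G\<^esub>)"

datatype query_symbol = QBit bool | QSep | QLetter letter

definition query_alphabet :: "nat set \<Rightarrow> query_symbol set" where
  "query_alphabet S = range QBit \<union> {QSep} \<union> QLetter ` standard_alphabet S"

text \<open>
  The triple \<open>(v, i, a)\<close> is presented as the word \<open>v # i # a\<close>, with the number \<open>i\<close> in binary,
  most significant bit first. Positions are counted from 0, so that \<open>\<mu> * d\<close> bits range
  exactly over the positions of a word of length \<open>2 ^ (\<mu> * d)\<close>.
\<close>

definition letter_language ::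
    "nat set \<Rightarrow> nat \<Rightarrow> (nat \<Rightarrow> bool list \<Rightarrow> letter list) \<Rightarrow> query_symbol list set"
  where "letter_language S \<mu> g =
    {map QBit v @ [QSep] @ map QBit b @ [QSep] @ [QLetter a] | v b a.
      length b = \<mu> * length v \<and> a \<in> standard_alphabet S \<and>
      g (length v) v ! horner_sum of_bool 2 (rev b) = a}"

definition uniformly_SENS :: "('g, 'b) monoid_scheme \<Rightarrow> bool" where
  "uniformly_SENS G \<longleftrightarrow> finitely_generated_group G \<and>
    (\<forall>S \<phi>. standard_generators G S \<phi> \<longrightarrow>
      (\<exists>\<mu> g. sens_family G S \<phi> \<mu> g \<and>
        letter_language S \<mu> g \<in> DLINTIME (query_alphabet S)))"

end

theory Submission
  imports Defs "HOL-Combinatorics.Permutations"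
begin

text \<open>
  In any group, \<open>y\<^sub>0 = a\<close> and \<open>y\<^sub>n\<^sub>+\<^sub>1 = [c\<inverse>y\<^sub>nc, y\<^sub>n]\<close> unfold to a complete binary tree of
  commutators whose leaf at \<open>v\<close> is \<open>c\<^sup>-\<^sup>ka c\<^sup>k\<close>, where \<open>k\<close> is the number of zeros of \<open>v\<close>. Padded with
  the letter \<open>1\<close>, this leaf becomes a word in which the block of \<open>\<mu>\<close> bits of a position that
  belongs to a letter of \<open>v\<close> determines how a finite automaton moves on: reading \<open>v\<close> from its end,
  a stack machine finds the letter at a given position in real time.

  In \<open>F\<close> take the standard generators \<open>a = x\<^sub>1\<close> and \<open>c = x\<^sub>0\<inverse>\<close>. As \<open>a\<close> is trivial on \<open>[0, 1/2]\<close> and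
  maps \<open>[0, c\<^sup>2(1/2)]\<close> to \<open>[0, c(1/2)]\<close>, every \<open>y\<^sub>n\<close> agrees with \<open>a\<close> on \<open>[0, c\<^sup>2(1/2)]\<close> and so is
  nontrivial. The embeddings of \<open>F\<close> in \<open>T\<close> and \<open>V\<close> transport this to the other two groups.
\<close>

section \<open>Linear time from real-time machines\<close>

text \<open>A leaf of level \<open>d\<close> must have length exactly
  \<open>2 ^ (\<mu> * d)\<close>, while its conjugator is a power with up to \<open>d\<close>
  factors, and any position must be decoded in one pass. The leaf is therefore grown from its middle
  outwards: what is still missing of the two powers stands at the two ends as one symbol each, so
  every bit of \<open>v\<close> contributes a bounded block and a fixed \<open>\<mu>\<close>
  suffices. The bits of \<open>v\<close> are consumed from the last one because a query shows all of
  \<open>v\<close> before the position, and a stack returns the last bit first. The generating set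
  is arbitrary, so \<open>a\<close> and \<open>c\<close> enter only as words over it, and
  \<open>\<mu>\<close> depends on these words. The level \<open>d = 0\<close> falls out of the
  pattern: there the root is a leaf of length one and has to be a letter that is nontrivial in the
  group. Finite generation is part of the property. For V and F it comes from pairs of binary trees,
  for T from F being the stabiliser of a point. The obstacle in passing from the circle to infinite
  words is that dyadic points have two expansions; whether an expansion ends in ones is invariant
  under replacing a prefix and resolves the ambiguity.\<close>

fun inc :: "bool list \<Rightarrow> bool list" where
  "inc [] = [True]"
| "inc (False # r) = True # r"
| "inc (True # r) = False # inc r"

fun carry_length :: "bool list \<Rightarrow> nat" where
  "carry_length (True # r) = Suc (carry_length r)"
| "carry_length _ = 0"

lemma horner_sum_inc: "horner_sum of_bool 2 (inc ds) = Suc (horner_sum of_bool 2 ds)"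
  by (induction ds rule: inc.induct) auto

text \<open>An increment destroys as many ones as the carry is long and creates a single one. This
  is the identity behind the constant amortised cost of counting.\<close>

lemma carry_length_count: "carry_length ds + count_list (inc ds) True = Suc (count_list ds True)"
  by (induction ds rule: inc.induct) auto

text \<open>The counter on the address tape grows by a digit when it overflows, so the machine does
  not have to know the length of its input; the blank behind the last digit ends the
  address.\<close>

definition digit_cells :: "bool list \<Rightarrow> nat \<Rightarrow> cell" where
  "digit_cells ds k = (if k < length ds then Digit (ds ! k) else Blank)"

lemma address_digit_cells: "address (digit_cells ds, p) = horner_sum of_bool 2 ds"
proof -
  have "(LEAST n. digit_cells ds n \<notin> range Digit) = length ds"
    by (rule Least_equality) (auto simp: digit_cells_def not_less[symmetric])
  then have "address (digit_cells ds, p) =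
      (\<Sum>k<length ds. if digit_cells ds k = Digit True then 2 ^ k else 0)"
    by (simp add: address_def)
  also have "\<dots> = (\<Sum>k<length ds. of_bool (ds ! k) * 2 ^ k)"
    by (rule sum.cong) (auto simp: digit_cells_def)
  finally show ?thesis
    by (simp add: horner_sum_eq_sum lessThan_atLeast0)
qed

text \<open>
  A third tape marks its cell 0. Its head moves together with that of the address tape, where no
  mark is allowed, and so tells when the carry has been propagated and cell 0 is reached again.
\<close>

definition ruler :: "nat \<Rightarrow> cell" where
  "ruler = (\<lambda>_. Blank)(0 := Mark 0)"

text \<open>One step of the simulated machine is a cycle \<open>Read\<close>, \<open>Carry\<close>,
  \<open>Back\<close>: the simulated move is made on leaving \<open>Read\<close>, the rest of the
  cycle advances the address, and the simulated state is carried along.\<close>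

datatype 's control = Init | Read 's | Carry 's | Back 's | Acc | Rej

text \<open>A one-pass machine with a single work tape that consumes one input symbol per step and
  decides by its state at the end of the input. \<open>Mark 0\<close> is among the symbols because
  it marks the bottom of the work tape.\<close>

locale realtime_machine =
  fixes A :: "'a set" and Q :: "'s set" and \<Gamma> :: "cell set" and s0 :: 's
    and \<tau> :: "'s \<Rightarrow> 'a \<Rightarrow> cell \<Rightarrow> 's \<times> cell \<times> direction" and final :: "'s \<Rightarrow> bool"
  assumes finite_sets: "finite A" "finite Q" "finite \<Gamma>"
    and symbols: "{Blank, Digit False, Digit True, Mark 0} \<subseteq> \<Gamma>"
    and start: "s0 \<in> Q"
    and closed: "s \<in> Q \<Longrightarrow> x \<in> A \<Longrightarrow> c \<in> \<Gamma> \<Longrightarrow> fst (\<tau> s x c) \<in> Q \<and> fst (snd (\<tau> s x c)) \<in> \<Gamma>"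
begin

fun run :: "'s \<Rightarrow> tape \<Rightarrow> 'a list \<Rightarrow> bool" where
  "run s t [] = final s"
| "run s t (x # w) = (case \<tau> s x (fst t (snd t)) of (s', a) \<Rightarrow> run s' (act_on_tape a t) w)"

text \<open>The input symbol is consulted only in \<open>Read\<close>: during a carry the address
  tape holds an intermediate number and the symbol seen there is meaningless. The answer
  \<open>None\<close> signals that the address has passed the end of the input.\<close>

fun micro :: "'s control \<Rightarrow> 'a option \<Rightarrow> cell list \<Rightarrow> 's control \<times> (cell \<times> direction) list" where
  "micro Init _ cs = (Read s0, [(cs ! 0, Stay), (Mark 0, MoveRight), (Mark 0, Stay)])"
| "micro (Read s) None cs = (if final s then Acc else Rej, [(cs ! 0, Stay), (cs ! 1, Stay), (cs ! 2, Stay)])"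
| "micro (Read s) (Some x) cs =
    (case \<tau> s x (cs ! 1) of (s', a) \<Rightarrow> (Carry s', [(cs ! 0, Stay), a, (cs ! 2, Stay)]))"
| "micro (Carry s) _ cs =
    (if cs ! 0 = Digit True then (Carry s, [(Digit False, MoveRight), (cs ! 1, Stay), (cs ! 2, MoveRight)])
     else (Back s, [(Digit True, Stay), (cs ! 1, Stay), (cs ! 2, Stay)]))"
| "micro (Back s) _ cs =
    (if cs ! 2 = Mark 0 then (Read s, [(cs ! 0, Stay), (cs ! 1, Stay), (cs ! 2, Stay)])
     else (Back s, [(cs ! 0, MoveLeft), (cs ! 1, Stay), (cs ! 2, MoveLeft)]))"
| "micro q _ cs = (q, [(cs ! 0, Stay), (cs ! 1, Stay), (cs ! 2, Stay)])"

definition controls :: "'s control set" where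
  "controls = {Init, Acc, Rej} \<union> Read ` Q \<union> Carry ` Q \<union> Back ` Q"

text \<open>The states of a \<open>ram_tm\<close> are natural numbers, so the finitely many controls
  are numbered by an arbitrary injection.\<close>

definition enc :: "'s control \<Rightarrow> nat" where
  "enc = (SOME f. inj_on f controls)"

lemma finite_controls: "finite controls"
  using finite_sets by (simp add: controls_def)

lemma inj_enc: "inj_on enc controls"
  unfolding enc_def using finite_imp_inj_to_nat_seg[OF finite_controls] by (metis someI)

definition dec :: "nat \<Rightarrow> 's control" where
  "dec = inv_into controls enc"

lemma dec_enc [simp]: "q \<in> controls \<Longrightarrow> dec (enc q) = q"
  unfolding dec_def using inj_enc by simp

definition machine :: "'a ram_tm" where
  "machine = \<lparr>num_tapes = 3, states = enc ` controls, start_state = enc Init,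
    accept_state = enc Acc, reject_state = enc Rej, tape_symbols = \<Gamma>,
    transition = (\<lambda>q x cs. case micro (dec q) x cs of (q', acts) \<Rightarrow> (enc q', acts))\<rparr>"

lemma micro_closed:
  assumes "q \<in> controls" "x \<in> insert None (Some ` A)" "length cs = 3" "set cs \<subseteq> \<Gamma>"
  shows "case micro q x cs of (q', acts) \<Rightarrow>
    q' \<in> controls \<and> length acts = 3 \<and> fst ` set acts \<subseteq> \<Gamma>"
proof -
  have nth: "cs ! 0 \<in> \<Gamma>" "cs ! Suc 0 \<in> \<Gamma>" "cs ! 2 \<in> \<Gamma>"
    using assms(3,4) by (auto simp: subset_iff)
  show ?thesis
  proof (cases "\<exists>s y. q = Read s \<and> x = Some y")
    case True
    then obtain s y where q: "q = Read s" "x = Some y" by blast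
    then have "s \<in> Q" "y \<in> A" using assms by (auto simp: controls_def)
    from closed[OF this nth(2)] show ?thesis
      using q nth by (auto simp: controls_def split: prod.splits)
  next
    case False
    then show ?thesis
      using assms symbols nth start
      by (cases "(q, x, cs)" rule: micro.cases) (auto simp: controls_def)
  qed
qed

lemma machine_wf: "wf_ram_tm A machine"
proof -
  have "enc Acc \<noteq> enc Rej"
    using inj_enc by (auto simp: inj_on_def controls_def)
  moreover have "case transition machine (enc q) x cs of (q', acts) \<Rightarrow>
      q' \<in> states machine \<and> length acts = num_tapes machine \<and> fst ` set acts \<subseteq> tape_symbols machine"
    if "q \<in> controls" "x \<in> insert None (Some ` A)" "length cs = 3" "set cs \<subseteq> \<Gamma>" for q x cs
    using micro_closed[OF that] that(1) by (auto simp: machine_def split: prod.splits)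
  moreover have "{Init, Acc, Rej} \<subseteq> controls" by (simp add: controls_def)
  ultimately show ?thesis
    using finite_sets symbols finite_controls
    unfolding wf_ram_tm_def by (auto simp: machine_def)
qed

text \<open>The step function before the states are numbered. It can be evaluated by pattern
  matching on controls, and the numbering is dealt with once, in \<open>mstep_steps\<close>.\<close>

definition mstep :: "'a list \<Rightarrow> 's control \<times> tape list \<Rightarrow> 's control \<times> tape list" where
  "mstep w = (\<lambda>(q, ts). if q = Acc \<or> q = Rej then (q, ts)
    else case micro q (input_symbol w ts) (map (\<lambda>t. fst t (snd t)) ts) of
      (q', acts) \<Rightarrow> (q', map2 act_on_tape acts ts))"

text \<open>The invariant under which numbering the states is harmless: \<open>enc\<close> is
  injective on \<open>controls\<close> only, and \<open>micro\<close> is known to stay inside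
  \<open>controls\<close> only for symbols of \<open>\<Gamma>\<close>.\<close>

definition valid :: "'s control \<times> tape list \<Rightarrow> bool" where
  "valid = (\<lambda>(q, ts). q \<in> controls \<and> length ts = 3 \<and> (\<forall>t\<in>set ts. range (fst t) \<subseteq> \<Gamma>))"

lemma act_on_tape_range:
  "range (fst t) \<subseteq> \<Gamma> \<Longrightarrow> fst a \<in> \<Gamma> \<Longrightarrow> range (fst (act_on_tape a t)) \<subseteq> \<Gamma>"
  by (auto simp: act_on_tape_def)

lemma mstep_step:
  assumes w: "w \<in> lists A" and v: "valid (q, ts)"
  shows "valid (mstep w (q, ts)) \<and>
    step machine w (enc q, ts) = (enc (fst (mstep w (q, ts))), snd (mstep w (q, ts)))"
proof -
  have q: "q \<in> controls" using v by (simp add: valid_def)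
  have eq: "enc q = enc q' \<longleftrightarrow> q = q'" if "q' \<in> controls" for q'
    using inj_enc q that by (auto simp: inj_on_def)
  have AR: "Acc \<in> controls" "Rej \<in> controls" by (auto simp: controls_def)
  let ?x = "input_symbol w ts" and ?cs = "map (\<lambda>t. fst t (snd t)) ts"
  obtain q' acts where m: "micro q ?x ?cs = (q', acts)" by (metis surj_pair)
  have x: "?x \<in> insert None (Some ` A)"
    using w by (auto simp: input_symbol_def Let_def in_lists_conv_set)
  have l: "length ?cs = 3" and s: "set ?cs \<subseteq> \<Gamma>" using v by (auto simp: valid_def)
  from micro_closed[OF q x l s] m
  have c: "q' \<in> controls" "length acts = 3" "fst ` set acts \<subseteq> \<Gamma>" by auto
  have "range (fst t) \<subseteq> \<Gamma>" if t: "t \<in> set (map2 act_on_tape acts ts)" for t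
  proof -
    from t obtain a t' where "(a, t') \<in> set (zip acts ts)" "t = act_on_tape a t'" by auto
    then show ?thesis
      using act_on_tape_range[of t' a] c(3) v set_zip_leftD[of a t'] set_zip_rightD[of a t']
      unfolding valid_def by (metis (no_types, lifting) case_prod_conv image_subset_iff)
  qed
  then have "valid (q', map2 act_on_tape acts ts)"
    using c l v unfolding valid_def by simp
  then show ?thesis
    using m v q eq[OF AR(1)] eq[OF AR(2)]
    by (cases "q = Acc \<or> q = Rej") (auto simp: mstep_def step_def machine_def)
qed

lemma mstep_steps:
  assumes w: "w \<in> lists A" and v: "valid c"
  shows "valid ((mstep w ^^ n) c) \<and>
    (step machine w ^^ n) (enc (fst c), snd c) = (enc (fst ((mstep w ^^ n) c)), snd ((mstep w ^^ n) c))"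
proof (induction n)
  case (Suc n)
  then show ?case
    using mstep_step[OF w, of "fst ((mstep w ^^ n) c)" "snd ((mstep w ^^ n) c)"] by simp
qed (use v in simp)

lemma act_on_tape_stay [simp]: "act_on_tape (fst t (snd t), Stay) t = t"
  "act_on_tape (f p, Stay) (f, p) = (f, p)"
  by (simp_all add: act_on_tape_def)

text \<open>The word \<open>u\<close> stands for the digits already passed, so that the induction
  can follow the heads. Each one that is cleared costs a step, and one more step writes the final
  one.\<close>

lemma carry_steps:
  "(mstep w ^^ Suc (carry_length r)) (Carry s, [(digit_cells (u @ r), length u), t, (ruler, length u)]) =
    (Back s, [(digit_cells (u @ inc r), length u + carry_length r), t, (ruler, length u + carry_length r)])"
proof (induction r arbitrary: u rule: inc.induct)
  case 1
  \<comment> \<open>The carry has run off the counter: the head is on the blank behind the last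
    digit, and writing there lengthens the counter.\<close>
  have "(digit_cells (u @ []))(length u := Digit True) = digit_cells (u @ [True])"
    by (auto simp: digit_cells_def nth_append fun_eq_iff)
  moreover have "digit_cells u (length u) = Blank"
    by (simp add: digit_cells_def)
  ultimately show ?case
    by (simp add: mstep_def act_on_tape_def)
next
  case (2 r)
  have "(digit_cells (u @ False # r))(length u := Digit True) = digit_cells (u @ True # r)"
    by (auto simp: digit_cells_def nth_append fun_eq_iff nth_Cons')
  then show ?case
    by (simp add: mstep_def act_on_tape_def) (simp add: digit_cells_def)
next
  case (3 r)
  have *: "(digit_cells (u @ True # r))(length u := Digit False) = digit_cells (u @ False # r)"
    by (auto simp: digit_cells_def nth_append fun_eq_iff nth_Cons')
  have "mstep w (Carry s, [(digit_cells (u @ True # r), length u), t, (ruler, length u)]) =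
     (Carry s, [(digit_cells ((u @ [False]) @ r), length (u @ [False])), t, (ruler, length (u @ [False]))])"
    using * by (simp add: mstep_def act_on_tape_def) (simp add: digit_cells_def)
  then show ?case
    using 3[of "u @ [False]"] by (simp add: funpow_Suc_right del: funpow.simps)
qed

lemma back_steps:
  "(mstep w ^^ Suc p) (Back s, [(f, p), t, (ruler, p)]) = (Read s, [(f, 0), t, (ruler, 0)])"
proof (induction p)
  case 0
  show ?case by (simp add: mstep_def act_on_tape_def) (auto simp: ruler_def fun_eq_iff)
next
  case (Suc p)
  have "mstep w (Back s, [(f, Suc p), t, (ruler, Suc p)]) = (Back s, [(f, p), t, (ruler, p)])"
    by (simp add: mstep_def act_on_tape_def) (auto simp: ruler_def fun_eq_iff)
  then show ?case
    using Suc by (simp add: funpow_Suc_right del: funpow.simps)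
qed

text \<open>One step reads, \<open>carry_length ds + 1\<close> steps increment, and as many return
  the heads: every move to the left is repaid, and one further step recognises the mark.\<close>

lemma read_steps:
  assumes "horner_sum of_bool 2 ds < length w"
    and \<tau>: "\<tau> s (w ! horner_sum of_bool 2 ds) (fst t (snd t)) = (s', a)"
  shows "(mstep w ^^ (2 * carry_length ds + 3)) (Read s, [(digit_cells ds, 0), t, (ruler, 0)]) =
    (Read s', [(digit_cells (inc ds), 0), act_on_tape a t, (ruler, 0)])"
proof -
  have 1: "mstep w (Read s, [(digit_cells ds, 0), t, (ruler, 0)]) =
      (Carry s', [(digit_cells ([] @ ds), length []), act_on_tape a t, (ruler, length [])])"
    using assms by (simp add: mstep_def input_symbol_def address_digit_cells)
  have n: "2 * carry_length ds + 3 = Suc (carry_length ds) + (Suc (carry_length ds) + 1)" by simp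
  show ?thesis
    using carry_steps[where u = "[]" and r = ds and w = w and s = s' and t = "act_on_tape a t"]
      back_steps[of "carry_length ds" w s' "digit_cells (inc ds)" "act_on_tape a t"] 1
    unfolding n funpow_add comp_apply
    by (simp only: append_Nil list.size(3) add_0 funpow_0 One_nat_def funpow.simps comp_apply id_apply)
qed

text \<open>The number of ones in the counter serves as a potential for the cost of the carries.\<close>

lemma run_steps:
  assumes "horner_sum of_bool 2 ds + k = length w"
  shows "\<exists>n \<le> 5 * k + 1 + 2 * count_list ds True.
    fst ((mstep w ^^ n) (Read s, [(digit_cells ds, 0), t, (ruler, 0)])) =
      (if run s t (drop (length w - k) w) then Acc else Rej)"
  using assms
proof (induction k arbitrary: ds s t)
  case 0
  then have "fst (mstep w (Read s, [(digit_cells ds, 0), t, (ruler, 0)])) = (if final s then Acc else Rej)"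
    by (simp add: mstep_def input_symbol_def address_digit_cells)
  then show ?case by (intro exI[of _ 1]) simp
next
  case (Suc k)
  let ?i = "horner_sum of_bool 2 ds :: nat"
  obtain s' a where \<tau>: "\<tau> s (w ! ?i) (fst t (snd t)) = (s', a)" by (metis surj_pair)
  have i: "?i < length w" "length w - Suc k = ?i" "length w - k = Suc ?i" using Suc.prems by auto
  have "horner_sum of_bool 2 (inc ds) + k = length w"
    using Suc.prems by (simp add: horner_sum_inc)
  from Suc.IH[OF this, of s' "act_on_tape a t"] obtain n where
    n: "n \<le> 5 * k + 1 + 2 * count_list (inc ds) True"
      "fst ((mstep w ^^ n) (Read s', [(digit_cells (inc ds), 0), act_on_tape a t, (ruler, 0)])) =
      (if run s' (act_on_tape a t) (drop (length w - k) w) then Acc else Rej)" by blast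
  have "drop ?i w = w ! ?i # drop (Suc ?i) w"
    using i(1) by (simp add: Cons_nth_drop_Suc)
  then have "run s t (drop (length w - Suc k) w) = run s' (act_on_tape a t) (drop (length w - k) w)"
    using \<tau> i by simp
  with n(2) read_steps[OF i(1) \<tau>]
  have "fst ((mstep w ^^ (n + (2 * carry_length ds + 3))) (Read s, [(digit_cells ds, 0), t, (ruler, 0)])) =
      (if run s t (drop (length w - Suc k) w) then Acc else Rej)"
    unfolding funpow_add comp_apply by simp
  \<comment> \<open>Twice the carry plus twice the new number of ones is twice the old number plus
    2, by \<open>carry_length_count\<close>. With the 3 steps that do not depend on the carry this
    gives 5 per input symbol.\<close>
  moreover have "n + (2 * carry_length ds + 3) \<le> 5 * Suc k + 1 + 2 * count_list ds True"
    using n(1) carry_length_count[of ds] by simp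
  ultimately show ?case by blast
qed

lemma mstep_halted: "fst c = Acc \<or> fst c = Rej \<Longrightarrow> (mstep w ^^ n) c = c"
  by (induction n) (auto simp: mstep_def split: prod.splits)

definition initial_tape :: tape where
  "initial_tape = (ruler, 1)"

theorem DLINTIME_run:
  assumes L: "L \<subseteq> lists A" and run: "\<And>w. w \<in> lists A \<Longrightarrow> run s0 initial_tape w \<longleftrightarrow> w \<in> L"
  shows "L \<in> DLINTIME A"
proof -
  \<comment> \<open>\<open>DLINTIME\<close> uses one constant as factor and as summand. One step for
    \<open>Init\<close> and at most \<open>5 * length w + 1\<close> for the run fit into this bound,
    and the remaining time is spent in the halting state.\<close>
  have "final_state machine w (5 * length w + 5) =
      (if w \<in> L then accept_state machine else reject_state machine)" if w: "w \<in> lists A" for w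
  proof -
    let ?c = "(Init, replicate 3 (\<lambda>_. Blank, 0))"
    have "mstep w ?c = (Read s0, [(digit_cells [], 0), initial_tape, (ruler, 0)])"
      by (simp add: mstep_def act_on_tape_def numeral_3_eq_3 digit_cells_def[abs_def] ruler_def initial_tape_def fun_eq_iff)
    moreover obtain n where n: "n \<le> 5 * length w + 1"
      "fst ((mstep w ^^ n) (Read s0, [(digit_cells [], 0), initial_tape, (ruler, 0)])) =
      (if run s0 initial_tape w then Acc else Rej)"
      using run_steps[of "[]" "length w" w s0 initial_tape] by auto
    ultimately have f: "fst ((mstep w ^^ Suc n) ?c) = (if run s0 initial_tape w then Acc else Rej)"
      by (simp add: funpow_Suc_right del: funpow.simps)
    have "(mstep w ^^ (5 * length w + 5)) ?c = (mstep w ^^ (5 * length w + 5 - Suc n)) ((mstep w ^^ Suc n) ?c)"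
    proof -
      have "5 * length w + 5 = (5 * length w + 5 - Suc n) + Suc n" using n(1) by simp
      then show ?thesis by (metis comp_apply funpow_add)
    qed
    also have "\<dots> = (mstep w ^^ Suc n) ?c"
      using f by (intro mstep_halted) auto
    finally have f': "fst ((mstep w ^^ (5 * length w + 5)) ?c) = (if w \<in> L then Acc else Rej)"
      using f run[OF w] by simp
    have "valid ?c" using symbols by (auto simp: valid_def controls_def)
    from mstep_steps[OF w this, of "5 * length w + 5"] f' show ?thesis
      by (simp add: final_state_def initial_config_def machine_def)
  qed
  then show ?thesis
    unfolding DLINTIME_def using L finite_sets machine_wf by blast
qed

end

section \<open>Words computed by automata\<close>

text \<open>The lexicographic order makes the word at index \<open>i\<close> the binary
  representation of \<open>i\<close> with its most significant bit first, as in a query. The same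
  list also gives the leaves of the full binary tree.\<close>

fun bits :: "nat \<Rightarrow> bool list list" where
  "bits 0 = [[]]"
| "bits (Suc n) = map ((#) False) (bits n) @ map ((#) True) (bits n)"

lemma length_bits [simp]: "length (bits n) = 2 ^ n"
  by (induction n) auto

lemma length_in_bits: "p \<in> set (bits n) \<Longrightarrow> length p = n"
  by (induction n arbitrary: p) auto

abbreviation bits_value :: "bool list \<Rightarrow> nat" where
  "bits_value u \<equiv> horner_sum of_bool 2 (rev u)"

lemma horner_sum_bits_less: "bits_value b < 2 ^ length b"
  by (induction b) (auto simp: horner_sum_append)

lemma bits_nth: "length b = n \<Longrightarrow> bits n ! bits_value b = b"
proof (induction n arbitrary: b)
  case (Suc n)
  then obtain x b' where b: "b = x # b'" "length b' = n" by (cases b) auto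
  then show ?case
    using Suc.IH[of b'] horner_sum_bits_less[of b']
    by (cases x) (auto simp: horner_sum_append nth_append)
qed simp

lemma map_horner_sum_bits: "map bits_value (bits n) = [0..<2 ^ n]"
proof (induction n)
  case (Suc n)
  have "map (\<lambda>p. bits_value (True # p)) (bits n) =
      map (\<lambda>i. i + 2 ^ n) (map bits_value (bits n))"
    by (auto simp: horner_sum_append dest!: length_in_bits)
  also have "\<dots> = [2 ^ n..<2 ^ Suc n]"
    unfolding Suc by (simp add: map_add_upt mult_2)
  finally have T: "map (\<lambda>p. bits_value (True # p)) (bits n) = [2 ^ n..<2 ^ Suc n]" .
  have F: "map (\<lambda>p. bits_value (False # p)) (bits n) = [0..<2 ^ n]"
    unfolding Suc[symmetric] by (simp add: horner_sum_append)
  have "[0..<2 ^ n] @ [2 ^ n..<2 ^ Suc n] = [0..<2 ^ Suc n]"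
    by (metis le_add1 le_add_same_cancel1 mult_2 power_Suc upt_add_eq_append zero_le)
  then show ?case
    using T F by (simp add: comp_def)
qed simp

lemma map_nth_bits: "length l = 2 ^ n \<Longrightarrow> map (\<lambda>p. l ! bits_value p) (bits n) = l"
  using map_horner_sum_bits[of n] map_nth[of l]
  by (metis (no_types, lifting) comp_apply list.map_comp map_eq_conv)

text \<open>Splits a position into its leading block of bits and the remaining ones; on the level of
  words this becomes a concatenation of subwords.\<close>

lemma bits_add: "bits (m + n) = concat (map (\<lambda>p. map ((@) p) (bits n)) (bits m))"
proof (induction m)
  case 0
  then show ?case by (simp add: map_idI)
next
  case (Suc m)
  have "(@) (x # p) = (\<lambda>q. x # p @ q)" for x :: bool and p by auto
  then show ?case by (simp add: Suc map_concat comp_def)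
qed

text \<open>In \<open>Pop q p\<close> the list \<open>p\<close> holds the bits read so far of the
  current block. \<open>Want q\<close> expects the letter to be tested, and \<open>Done\<close>
  accepts only if the input ends there.\<close>

datatype 'q query_state = Push | Pop 'q "bool list" | Want 'q | Done | Dead

text \<open>Two substitutions of uniform length \<open>2 ^ \<mu>\<close> on states, one for each
  bit, followed by the coding \<open>out\<close>. As for automatic sequences, the uniform length
  makes the state at a position computable from the binary digits of the position.\<close>

locale block_automaton =
  fixes \<mu> :: nat and block :: "'q \<Rightarrow> bool \<Rightarrow> 'q list" and out :: "'q \<Rightarrow> letter"
    and q0 :: 'q and Q :: "'q set" and S :: "nat set"
  assumes \<mu>: "\<mu> > 0"
    and finite_Q: "finite Q" and finite_S: "finite S"
    and q0: "q0 \<in> Q"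
    and length_block: "length (block q y) = 2 ^ \<mu>"
    and block_closed: "q \<in> Q \<Longrightarrow> set (block q y) \<subseteq> Q"
    and out_closed: "q \<in> Q \<Longrightarrow> out q \<in> standard_alphabet S"
begin

definition next_state :: "'q \<Rightarrow> bool \<Rightarrow> bool list \<Rightarrow> 'q" where
  "next_state q y p = block q y ! bits_value p"

fun state_after :: "'q \<Rightarrow> bool list \<Rightarrow> bool list \<Rightarrow> 'q" where
  "state_after q [] b = q"
| "state_after q (y # ys) b = state_after (next_state q y (take \<mu> b)) ys (drop \<mu> b)"

definition word :: "'q \<Rightarrow> bool list \<Rightarrow> letter list" where
  "word q ys = map (\<lambda>b. out (state_after q ys b)) (bits (\<mu> * length ys))"

lemma word_Nil [simp]: "word q [] = [out q]"
  by (simp add: word_def)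

text \<open>The definition of \<open>word\<close> by positions is suited to queries; this recursion
  by substitution is the form in which words are evaluated in the group.\<close>

lemma word_Cons: "word q (y # ys) = concat (map (\<lambda>r. word r ys) (block q y))"
proof -
  have "word q (y # ys) =
      concat (map (\<lambda>p. map (\<lambda>b. out (state_after q (y # ys) (p @ b))) (bits (\<mu> * length ys))) (bits \<mu>))"
    by (simp add: word_def bits_add map_concat comp_def del: state_after.simps)
  also have "\<dots> = concat (map (\<lambda>p. word (next_state q y p) ys) (bits \<mu>))"
    by (rule arg_cong[where f = concat]) (auto simp: word_def length_in_bits)
  also have "\<dots> = concat (map (\<lambda>r. word r ys) (map (next_state q y) (bits \<mu>)))"
    by (simp add: comp_def)
  also have "map (next_state q y) (bits \<mu>) = block q y"
    unfolding next_state_def[abs_def] by (rule map_nth_bits[OF length_block])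
  finally show ?thesis .
qed

lemma length_word: "length (word q ys) = 2 ^ (\<mu> * length ys)"
  by (simp add: word_def)

lemma word_nth:
  "length b = \<mu> * length ys \<Longrightarrow> word q ys ! bits_value b = out (state_after q ys b)"
  using horner_sum_bits_less[of b] by (simp add: word_def bits_nth)

lemma next_state_closed: "q \<in> Q \<Longrightarrow> length p = \<mu> \<Longrightarrow> next_state q y p \<in> Q"
  using block_closed[of q y] horner_sum_bits_less[of p] length_block[of q y]
  by (auto simp: next_state_def subset_iff)

lemma state_after_closed: "q \<in> Q \<Longrightarrow> length b = \<mu> * length ys \<Longrightarrow> state_after q ys b \<in> Q"
  by (induction ys arbitrary: q b) (auto simp: next_state_closed)

lemma word_closed: "q \<in> Q \<Longrightarrow> set (word q ys) \<subseteq> standard_alphabet S"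
  using state_after_closed out_closed length_in_bits by (fastforce simp: word_def)

text \<open>While \<open>v\<close> is pushed the head is on the first free cell, hence the move to
  the left at the separator. The bit on top of the stack stays under the head until the last bit of
  its block arrives, and then the head moves on to the next bit.\<close>

definition query_step :: "'q query_state \<Rightarrow> query_symbol \<Rightarrow> cell \<Rightarrow> 'q query_state \<times> cell \<times> direction" where
  "query_step s x c = (case s of
      Push \<Rightarrow> (case x of QBit b \<Rightarrow> (Push, Digit b, MoveRight) | QSep \<Rightarrow> (Pop q0 [], c, MoveLeft)
        | _ \<Rightarrow> (Dead, c, Stay))
    | Pop q p \<Rightarrow> (case (x, c) of
        (QBit b, Digit y) \<Rightarrow>
          (if Suc (length p) = \<mu> then (Pop (next_state q y (p @ [b])) [], c, MoveLeft)
           else (Pop q (p @ [b]), c, Stay))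
      | (QSep, Mark _) \<Rightarrow> (if p = [] then (Want q, c, Stay) else (Dead, c, Stay))
      | _ \<Rightarrow> (Dead, c, Stay))
    | Want q \<Rightarrow> (if x = QLetter (out q) then Done else Dead, c, Stay)
    | _ \<Rightarrow> (Dead, c, Stay))"

definition query_states :: "'q query_state set" where
  "query_states = {Push, Done, Dead} \<union> Want ` Q \<union> case_prod Pop ` (Q \<times> {p. length p < \<mu>})"

lemma query_states_iff:
  "Push \<in> query_states" "Done \<in> query_states" "Dead \<in> query_states"
  "Want q \<in> query_states \<longleftrightarrow> q \<in> Q" "Pop q p \<in> query_states \<longleftrightarrow> q \<in> Q \<and> length p < \<mu>"
  by (auto simp: query_states_def)

lemma finite_query_states: "finite query_states"
proof -
  have "{p :: bool list. length p < \<mu>} \<subseteq> {p. set p \<subseteq> UNIV \<and> length p \<le> \<mu>}" by auto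
  then have "finite {p :: bool list. length p < \<mu>}"
    by (rule finite_subset) (rule finite_lists_length_le, simp)
  then show ?thesis
    using finite_Q by (simp add: query_states_def)
qed

lemma finite_alphabet: "finite (standard_alphabet S)"
  using finite_S by (simp add: standard_alphabet_def)

sublocale M: realtime_machine "query_alphabet S" query_states "{Blank, Digit False, Digit True, Mark 0}"
  Push query_step "\<lambda>s. s = Done"
proof unfold_locales
  show "finite (query_alphabet S)"
    using finite_alphabet by (simp add: query_alphabet_def)
  fix s x c
  assume s: "s \<in> query_states" and "x \<in> query_alphabet S"
    and c: "c \<in> {Blank, Digit False, Digit True, Mark 0}"
  show "fst (query_step s x c) \<in> query_states \<and>
      fst (snd (query_step s x c)) \<in> {Blank, Digit False, Digit True, Mark 0}"
    using s c next_state_closed q0 \<mu>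
    by (cases s; cases x; cases c) (simp_all add: query_step_def query_states_iff)
qed (simp_all add: finite_query_states query_states_iff)

lemma run_Dead [simp]: "\<not> M.run Dead t w"
  by (induction w arbitrary: t) (auto simp: query_step_def)

lemma run_Done [simp]: "M.run Done t w \<longleftrightarrow> w = []"
  by (cases w) (auto simp: query_step_def)

lemma run_Want: "M.run (Want q) t w \<longleftrightarrow> w = [QLetter (out q)]"
  by (cases w) (auto simp: query_step_def)

lemma run_stuck: "fst (query_step s x (fst t (snd t))) = Dead \<Longrightarrow> \<not> M.run s t (x # w)"
  by (cases "query_step s x (fst t (snd t))") simp

lemma act_on_tape_stay' [simp]: "act_on_tape (f p, d) (f, p) = (f, move_head d p)"
  by (simp add: act_on_tape_def)

text \<open>Nothing is assumed about the cells above the head, so popped bits can stay on the tape.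
  As \<open>v\<close> shrinks from its end, the automaton sees \<open>rev v\<close>. At the bottom
  of the stack no block can be open, hence the condition on \<open>p\<close>.\<close>

lemma run_Pop:
  assumes "f 0 = Mark 0" "\<And>k. k < length v \<Longrightarrow> f (Suc k) = Digit (v ! k)"
    and "length p < \<mu>" "v = [] \<Longrightarrow> p = []"
  shows "M.run (Pop q p) (f, length v) w \<longleftrightarrow>
    (\<exists>b. w = map QBit b @ [QSep, QLetter (out (state_after q (rev v) (p @ b)))] \<and>
      length p + length b = \<mu> * length v)"
  using assms(2-)
proof (induction w arbitrary: q p v)
  case Nil
  then show ?case by simp
next
  case (Cons x w)
  show ?case
  proof (cases x)
    case (QLetter a)
    then have "fst (query_step (Pop q p) x c) = Dead" for c
      by (simp add: query_step_def)
    then have "\<not> M.run (Pop q p) (f, length v) (x # w)"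
      by (intro run_stuck) simp
    moreover have "x # w \<noteq> map QBit b @ QSep # l" for b l
      using QLetter by (cases b) auto
    ultimately show ?thesis by (auto simp del: M.run.simps)
  next
    case QSep
    then have eq: "x # w = map QBit b @ QSep # l \<longleftrightarrow> b = [] \<and> w = l" for b l
      by (cases b) auto
    show ?thesis
    proof (cases v rule: rev_cases)
      case Nil
      have "query_step (Pop q []) QSep (Mark 0) = (Want q, Mark 0, Stay)"
        by (simp add: query_step_def)
      with Nil Cons.prems(3) assms(1) QSep show ?thesis by (auto simp: eq run_Want)
    next
      case (snoc v' y)
      then have "f (length v) = Digit y" using Cons.prems(1)[of "length v'"] by simp
      then have "fst (query_step (Pop q p) x (f (length v))) = Dead"
        using QSep by (simp add: query_step_def)
      then have "\<not> M.run (Pop q p) (f, length v) (x # w)"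
        by (intro run_stuck) simp
      \<comment> \<open>The separator has come too early: the block in progress is incomplete, so
        the position has too few bits.\<close>
      moreover have "\<mu> * length v > length p" using snoc Cons.prems(2) by simp
      ultimately show ?thesis by (auto simp: eq simp del: M.run.simps)
    qed
  next
    case (QBit c)
    then have eq: "x # w = map QBit b @ QSep # l \<longleftrightarrow> (\<exists>b'. b = c # b' \<and> w = map QBit b' @ QSep # l)" for b l
      by (cases b) auto
    show ?thesis
    proof (cases v rule: rev_cases)
      case Nil
      then have "fst (query_step (Pop q p) x (f (length v))) = Dead"
        using QBit assms(1) by (simp add: query_step_def)
      then have "\<not> M.run (Pop q p) (f, length v) (x # w)"
        by (intro run_stuck) simp
      then show ?thesis using Nil by (auto simp: eq simp del: M.run.simps)
    next
      case (snoc v' y)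
      then have y: "f (length v) = Digit y" using Cons.prems(1)[of "length v'"] by simp
      have v': "f (Suc k) = Digit (v' ! k)" if "k < length v'" for k
        using Cons.prems(1)[of k] snoc that by (simp add: nth_append)
      show ?thesis
      proof (cases "Suc (length p) = \<mu>")
        case True
        have "M.run (Pop q p) (f, length v) (x # w) =
            M.run (Pop (next_state q y (p @ [c])) []) (f, length v') w"
          using True QBit y snoc act_on_tape_stay'[of f "length v"] by (simp add: query_step_def)
        also have "\<dots> \<longleftrightarrow> (\<exists>b. w = map QBit b @ [QSep, QLetter (out (state_after (next_state q y (p @ [c])) (rev v') b))] \<and>
            length b = \<mu> * length v')"
          using Cons.IH[OF v', of "[]"] \<mu> by simp
        also have "\<dots> \<longleftrightarrow> (\<exists>b. x # w = map QBit b @ [QSep, QLetter (out (state_after q (rev v) (p @ b)))] \<and>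
            length p + length b = \<mu> * length v)" (is "?L \<longleftrightarrow> ?R")
        proof
          assume ?L
          then obtain b where
            "w = map QBit b @ [QSep, QLetter (out (state_after (next_state q y (p @ [c])) (rev v') b))]"
            "length b = \<mu> * length v'" by blast
          moreover have "\<mu> - length p = Suc 0" using True by simp
          ultimately show ?R using QBit True snoc by (intro exI[of _ "c # b"]) simp
        next
          assume ?R
          then show ?L using True snoc by (auto simp: eq)
        qed
        finally show ?thesis .
      next
        case False
        have "M.run (Pop q p) (f, length v) (x # w) = M.run (Pop q (p @ [c])) (f, length v) w"
          using False QBit y act_on_tape_stay'[of f "length v"] by (simp add: query_step_def)
        also have "\<dots> \<longleftrightarrow> (\<exists>b. w = map QBit b @ [QSep, QLetter (out (state_after q (rev v) ((p @ [c]) @ b)))] \<and>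
            length (p @ [c]) + length b = \<mu> * length v)"
          using False Cons.prems snoc by (intro Cons.IH) auto
        also have "\<dots> \<longleftrightarrow> (\<exists>b. x # w = map QBit b @ [QSep, QLetter (out (state_after q (rev v) (p @ b)))] \<and>
            length p + length b = \<mu> * length v)"
          by (auto simp: eq)
        finally show ?thesis .
      qed
    qed
  qed
qed

lemma run_Push:
  assumes "f 0 = Mark 0" "\<And>k. k < length v \<Longrightarrow> f (Suc k) = Digit (v ! k)"
  shows "M.run Push (f, Suc (length v)) w \<longleftrightarrow>
    (\<exists>v' b. w = map QBit v' @ [QSep] @ map QBit b @
        [QSep, QLetter (out (state_after q0 (rev (v @ v')) b))] \<and>
      length b = \<mu> * length (v @ v'))"
  using assms
proof (induction w arbitrary: v f)
  case Nil
  then show ?case by simp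
next
  case (Cons x w)
  show ?case
  proof (cases x)
    case (QLetter a)
    then have "\<not> M.run Push (f, Suc (length v)) (x # w)"
      by (simp add: query_step_def)
    moreover have "x # w \<noteq> map QBit v' @ QSep # l" for v' l
      using QLetter by (cases v') auto
    ultimately show ?thesis by (auto simp del: M.run.simps)
  next
    case QSep
    then have eq: "x # w = map QBit v' @ QSep # l \<longleftrightarrow> v' = [] \<and> w = l" for v' l
      by (cases v') auto
    have "M.run Push (f, Suc (length v)) (x # w) = M.run (Pop q0 []) (f, length v) w"
      using QSep act_on_tape_stay'[of f "Suc (length v)"] by (simp add: query_step_def)
    also have "\<dots> \<longleftrightarrow> (\<exists>b. w = map QBit b @ [QSep, QLetter (out (state_after q0 (rev v) ([] @ b)))] \<and>
        length ([] :: bool list) + length b = \<mu> * length v)"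
      using Cons.prems \<mu> by (intro run_Pop) auto
    finally show ?thesis by (auto simp: eq)
  next
    case (QBit c)
    then have eq: "x # w = map QBit v' @ QSep # l \<longleftrightarrow> (\<exists>v''. v' = c # v'' \<and> w = map QBit v'' @ QSep # l)" for v' l
      by (cases v') auto
    let ?f = "f(Suc (length v) := Digit c)"
    have "M.run Push (f, Suc (length v)) (x # w) = M.run Push (?f, Suc (length (v @ [c]))) w"
      using QBit by (simp add: query_step_def act_on_tape_def)
    also have "\<dots> \<longleftrightarrow> (\<exists>v' b. w = map QBit v' @ [QSep] @ map QBit b @
        [QSep, QLetter (out (state_after q0 (rev ((v @ [c]) @ v')) b))] \<and>
      length b = \<mu> * length ((v @ [c]) @ v'))"
      using Cons.prems by (intro Cons.IH) (auto simp: nth_append less_Suc_eq)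
    also have "\<dots> \<longleftrightarrow> (\<exists>v' b. x # w = map QBit v' @ [QSep] @ map QBit b @
        [QSep, QLetter (out (state_after q0 (rev (v @ v')) b))] \<and>
      length b = \<mu> * length (v @ v'))" (is "?L \<longleftrightarrow> ?R")
    proof
      assume ?L
      then obtain v' b where "w = map QBit v' @ [QSep] @ map QBit b @
          [QSep, QLetter (out (state_after q0 (rev ((v @ [c]) @ v')) b))]"
        "length b = \<mu> * length ((v @ [c]) @ v')" by blast
      then show ?R using QBit by (intro exI[of _ "c # v'"] exI[of _ b]) simp
    next
      assume ?R
      then obtain v' b where *: "x # w = map QBit v' @ QSep # map QBit b @
          [QSep, QLetter (out (state_after q0 (rev (v @ v')) b))]"
        "length b = \<mu> * length (v @ v')" by auto
      then obtain v'' where "v' = c # v''" by (auto simp: eq)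
      with * show ?L by (intro exI[of _ v''] exI[of _ b]) simp
    qed
    finally show ?thesis .
  qed
qed

text \<open>Queries concern the leaves only, so \<open>g\<close> is constrained only where its level
  equals the length of \<open>v\<close>.\<close>

theorem letter_language_DLINTIME:
  assumes g: "\<And>v. g (length v) v = word q0 (rev v)"
  shows "letter_language S \<mu> g \<in> DLINTIME (query_alphabet S)"
proof (rule M.DLINTIME_run)
  show "letter_language S \<mu> g \<subseteq> lists (query_alphabet S)"
    by (auto simp: letter_language_def query_alphabet_def)
  show "M.run Push M.initial_tape w \<longleftrightarrow> w \<in> letter_language S \<mu> g" for w
  proof -
    have "M.run Push M.initial_tape w \<longleftrightarrow>
        (\<exists>v b. w = map QBit v @ [QSep] @ map QBit b @ [QSep, QLetter (out (state_after q0 (rev v) b))] \<and>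
          length b = \<mu> * length v)"
      using run_Push[of ruler "[]" w] by (simp add: ruler_def M.initial_tape_def)
    also have "\<dots> \<longleftrightarrow> w \<in> letter_language S \<mu> g"
      unfolding letter_language_def
      using g word_nth state_after_closed[OF q0] out_closed by (auto 4 4)
    finally show ?thesis .
  qed
qed

end

section \<open>Iterated commutators\<close>

context group
begin

definition conj :: "'a \<Rightarrow> 'a \<Rightarrow> 'a" where
  "conj p x = inv p \<otimes> x \<otimes> p"

definition comm :: "'a \<Rightarrow> 'a \<Rightarrow> 'a" where
  "comm h g = inv h \<otimes> inv g \<otimes> h \<otimes> g"

fun comm_seq :: "'a \<Rightarrow> 'a \<Rightarrow> nat \<Rightarrow> 'a" where
  "comm_seq a c 0 = a"
| "comm_seq a c (Suc n) = comm (conj c (comm_seq a c n)) (comm_seq a c n)"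

lemma conj_closed [simp]: "p \<in> carrier G \<Longrightarrow> x \<in> carrier G \<Longrightarrow> conj p x \<in> carrier G"
  by (simp add: conj_def)

lemma comm_closed [simp]: "p \<in> carrier G \<Longrightarrow> x \<in> carrier G \<Longrightarrow> comm p x \<in> carrier G"
  by (simp add: comm_def)

lemma comm_seq_closed [simp]: "a \<in> carrier G \<Longrightarrow> c \<in> carrier G \<Longrightarrow> comm_seq a c n \<in> carrier G"
  by (induction n) auto

lemma conj_mult:
  "p \<in> carrier G \<Longrightarrow> x \<in> carrier G \<Longrightarrow> y \<in> carrier G \<Longrightarrow> conj p (x \<otimes> y) = conj p x \<otimes> conj p y"
  by (simp add: conj_def m_assoc) (simp add: m_assoc[symmetric])

lemma conj_inv: "p \<in> carrier G \<Longrightarrow> x \<in> carrier G \<Longrightarrow> conj p (inv x) = inv (conj p x)"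
  by (simp add: conj_def inv_mult_group m_assoc)

lemma conj_conj:
  "p \<in> carrier G \<Longrightarrow> q \<in> carrier G \<Longrightarrow> x \<in> carrier G \<Longrightarrow> conj q (conj p x) = conj (p \<otimes> q) x"
  by (simp add: conj_def inv_mult_group m_assoc)

lemma conj_comm:
  "p \<in> carrier G \<Longrightarrow> x \<in> carrier G \<Longrightarrow> y \<in> carrier G \<Longrightarrow> conj p (comm x y) = comm (conj p x) (conj p y)"
  by (simp add: comm_def conj_mult conj_inv)

lemma conj_eq_one_iff: "p \<in> carrier G \<Longrightarrow> x \<in> carrier G \<Longrightarrow> conj p x = \<one> \<longleftrightarrow> x = \<one>"
  by (metis conj_def inv_closed inv_solve_right' l_one r_inv r_inv_ex one_closed l_cancel_one' m_closed inv_inv m_assoc l_inv r_one)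

lemma letter_value_closed [simp]:
  "\<phi> ` S \<subseteq> carrier G \<Longrightarrow> l \<in> standard_alphabet S \<Longrightarrow> letter_value G \<phi> l \<in> carrier G"
  by (auto simp: standard_alphabet_def)

lemma word_value_Nil [simp]: "word_value G \<phi> [] = \<one>"
  by (simp add: word_value_def)

lemma word_value_Cons [simp]: "word_value G \<phi> (l # w) = letter_value G \<phi> l \<otimes> word_value G \<phi> w"
  by (simp add: word_value_def)

lemma word_value_closed [simp]:
  "\<phi> ` S \<subseteq> carrier G \<Longrightarrow> set w \<subseteq> standard_alphabet S \<Longrightarrow> word_value G \<phi> w \<in> carrier G"
  by (induction w) auto

lemma word_value_append:
  "\<phi> ` S \<subseteq> carrier G \<Longrightarrow> set w \<subseteq> standard_alphabet S \<Longrightarrow> set w' \<subseteq> standard_alphabet S \<Longrightarrow>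
    word_value G \<phi> (w @ w') = word_value G \<phi> w \<otimes> word_value G \<phi> w'"
  by (induction w) (auto simp: m_assoc)

lemma letter_inverse_closed: "l \<in> standard_alphabet S \<Longrightarrow> letter_inverse l \<in> standard_alphabet S"
  by (auto simp: standard_alphabet_def)

lemma word_inverse_closed: "set w \<subseteq> standard_alphabet S \<Longrightarrow> set (word_inverse w) \<subseteq> standard_alphabet S"
  using letter_inverse_closed by (auto simp: word_inverse_def)

lemma letter_value_inverse:
  "\<phi> ` S \<subseteq> carrier G \<Longrightarrow> l \<in> standard_alphabet S \<Longrightarrow>
    letter_value G \<phi> (letter_inverse l) = inv (letter_value G \<phi> l)"
  by (auto simp: standard_alphabet_def)

lemma word_value_inverse:
  assumes "\<phi> ` S \<subseteq> carrier G" "set w \<subseteq> standard_alphabet S"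
  shows "word_value G \<phi> (word_inverse w) = inv (word_value G \<phi> w)"
  using assms(2)
proof (induction w)
  case Nil
  then show ?case by (simp add: word_inverse_def)
next
  case (Cons l w)
  have "word_value G \<phi> (word_inverse w @ [letter_inverse l]) =
      word_value G \<phi> (word_inverse w) \<otimes> word_value G \<phi> [letter_inverse l]"
    using assms(1) Cons.prems word_inverse_closed[of w S] letter_inverse_closed[of l S]
    by (intro word_value_append) auto
  moreover have "word_inverse (l # w) = word_inverse w @ [letter_inverse l]"
    by (simp add: word_inverse_def)
  ultimately show ?case
    using assms(1) Cons letter_inverse_closed[of l S]
    by (simp add: letter_value_inverse inv_mult_group)
qed

lemma word_value_commutator:
  assumes "\<phi> ` S \<subseteq> carrier G" "set h \<subseteq> standard_alphabet S" "set g \<subseteq> standard_alphabet S"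
  shows "word_value G \<phi> (word_commutator h g) = comm (word_value G \<phi> h) (word_value G \<phi> g)"
  using assms word_inverse_closed[of h S] word_inverse_closed[of g S]
  by (simp add: word_commutator_def comm_def word_value_append word_value_inverse m_assoc)

lemma word_commutator_closed:
  "set h \<subseteq> standard_alphabet S \<Longrightarrow> set g \<subseteq> standard_alphabet S \<Longrightarrow>
    set (word_commutator h g) \<subseteq> standard_alphabet S"
  using word_inverse_closed[of h S] word_inverse_closed[of g S] by (auto simp: word_commutator_def)

text \<open>The generating set is arbitrary, so the two elements that drive the construction must be
  expressible as words in whatever generators are given.\<close>

lemma word_value_exists:
  assumes "\<phi> ` S \<subseteq> carrier G" "x \<in> generate G (\<phi> ` S)"
  obtains w where "set w \<subseteq> standard_alphabet S" "word_value G \<phi> w = x"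
proof -
  have "\<exists>w. set w \<subseteq> standard_alphabet S \<and> word_value G \<phi> w = x"
    using assms(2)
  proof (induction rule: generate.induct)
    case one
    show ?case by (intro exI[of _ "[]"]) simp
  next
    case (incl h)
    then obtain s where "s \<in> S" "h = \<phi> s" by blast
    then show ?case
      using assms(1) by (intro exI[of _ "[Gen s]"]) (auto simp: standard_alphabet_def)
  next
    case (inv h)
    then obtain s where "s \<in> S" "h = \<phi> s" by blast
    then show ?case
      using assms(1) by (intro exI[of _ "[GenInv s]"]) (auto simp: standard_alphabet_def)
  next
    case (eng h1 h2)
    then obtain w1 w2 where w: "set w1 \<subseteq> standard_alphabet S" "word_value G \<phi> w1 = h1"
      "set w2 \<subseteq> standard_alphabet S" "word_value G \<phi> w2 = h2" by blast
    then show ?case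
      using assms(1) by (intro exI[of _ "w1 @ w2"]) (simp add: word_value_append)
  qed
  then show thesis using that by blast
qed

end

text \<open>The number is the height of \<open>v\<close> above the leaves, not its depth; at level
  \<open>d\<close> it is \<open>d - length v\<close>.\<close>

fun commutator_tree :: "nat \<Rightarrow> (bool list \<Rightarrow> letter list) \<Rightarrow> bool list \<Rightarrow> letter list" where
  "commutator_tree 0 leaf v = leaf v"
| "commutator_tree (Suc n) leaf v =
    word_commutator (commutator_tree n leaf (v @ [False])) (commutator_tree n leaf (v @ [True]))"

datatype leaf_state = Conjugate | Power | InversePower | Letter letter

locale conjugate_words = group G for G (structure) +
  fixes S :: "nat set" and \<phi> :: "nat \<Rightarrow> 'a" and u c :: "letter list" and l0 :: letter
  assumes finite_S: "finite S" and \<phi>: "\<phi> ` S \<subseteq> carrier G"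
    and u: "set u \<subseteq> standard_alphabet S" and c: "set c \<subseteq> standard_alphabet S"
    and l0: "l0 \<in> standard_alphabet S"
begin

abbreviation \<Sigma> :: "letter set" where
  "\<Sigma> \<equiv> standard_alphabet S"

text \<open>This is the length of the longest block, that of \<open>Conjugate\<close> at a zero.
  Since \<open>n < 2 ^ n\<close>, a block of this length also fits when the same number is taken as
  the number of bits of a position in it.\<close>

definition block_bits :: nat where
  "block_bits = length u + 2 * length c + 2"

definition pad :: "leaf_state list \<Rightarrow> leaf_state list" where
  "pad qs = qs @ replicate (2 ^ block_bits - length qs) (Letter Unit)"

text \<open>\<open>Conjugate\<close> acts only on the first bit consumed: it puts \<open>u\<close>
  in the middle and leaves a recursive state at either end. There each further zero adds one
  \<open>c\<close> or its inverse on the side facing \<open>u\<close>. Letters already produced are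
  carried through the remaining bits, accompanied by padding only.\<close>

fun block :: "leaf_state \<Rightarrow> bool \<Rightarrow> leaf_state list" where
  "block Power y = pad ((if y then [] else map Letter c) @ [Power])"
| "block InversePower y = pad (InversePower # (if y then [] else map Letter (word_inverse c)))"
| "block Conjugate y = pad (InversePower # (if y then [] else map Letter (word_inverse c)) @
     map Letter u @ (if y then [] else map Letter c) @ [Power])"
| "block (Letter l) y = pad [Letter l]"

text \<open>
  The output of \<open>Conjugate\<close> matters only for the empty \<open>v\<close>, where the whole word is one letter.
\<close>

fun out :: "leaf_state \<Rightarrow> letter" where
  "out Conjugate = l0"
| "out (Letter l) = l"
| "out _ = Unit"

definition Q :: "leaf_state set" where
  "Q = {Conjugate, Power, InversePower} \<union> Letter ` \<Sigma>"

lemma Unit_in_alphabet [simp]: "Unit \<in> \<Sigma>"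
  by (simp add: standard_alphabet_def)

lemma length_pad: "length qs \<le> block_bits \<Longrightarrow> length (pad qs) = 2 ^ block_bits"
  unfolding pad_def length_append length_replicate using less_exp[of block_bits] by linarith

sublocale block_automaton block_bits block out Conjugate Q S
proof
  show "length (block q y) = 2 ^ block_bits" for q y
  proof -
    have "\<exists>qs. block q y = pad qs \<and> length qs \<le> block_bits"
      by (cases q) (auto simp: block_bits_def word_inverse_def)
    then show ?thesis using length_pad by metis
  qed
  show "set (block q y) \<subseteq> Q" if "q \<in> Q" for q y
    using that u c word_inverse_closed[OF c] by (cases q) (auto simp: pad_def Q_def)
  show "out q \<in> \<Sigma>" if "q \<in> Q" for q
    using that l0 by (auto simp: Q_def)
qed (auto simp: block_bits_def Q_def finite_S standard_alphabet_def)

definition val :: "letter list \<Rightarrow> 'a" where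
  "val = word_value G \<phi>"

lemma val_closed [simp]: "set w \<subseteq> \<Sigma> \<Longrightarrow> val w \<in> carrier G"
  using \<phi> by (simp add: val_def)

lemma val_word_closed [simp]: "q \<in> Q \<Longrightarrow> val (word q ys) \<in> carrier G"
  using word_closed by simp

lemma val_append [simp]:
  "set w \<subseteq> \<Sigma> \<Longrightarrow> set w' \<subseteq> \<Sigma> \<Longrightarrow> val (w @ w') = val w \<otimes> val w'"
  using \<phi> by (simp add: val_def word_value_append)

lemma val_Nil [simp]: "val [] = \<one>"
  by (simp add: val_def)

lemma in_wordD: "l \<in> set (word q ys) \<Longrightarrow> q \<in> Q \<Longrightarrow> l \<in> \<Sigma>"
  using word_closed by blast

definition states_val :: "leaf_state list \<Rightarrow> bool list \<Rightarrow> 'a" where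
  "states_val qs ys = val (concat (map (\<lambda>q. word q ys) qs))"

lemma states_val_append:
  "set qs \<subseteq> Q \<Longrightarrow> set qs' \<subseteq> Q \<Longrightarrow> states_val (qs @ qs') ys = states_val qs ys \<otimes> states_val qs' ys"
  unfolding states_val_def map_append concat_append
  by (rule val_append) (auto dest: in_wordD)

lemma states_val_Cons:
  "q \<in> Q \<Longrightarrow> set qs' \<subseteq> Q \<Longrightarrow> states_val (q # qs') ys = val (word q ys) \<otimes> states_val qs' ys"
  using states_val_append[of "[q]" qs'] by (simp add: states_val_def)

lemma states_val_Nil [simp]: "states_val [] ys = \<one>"
  by (simp add: states_val_def)

lemma states_val_closed: "set qs \<subseteq> Q \<Longrightarrow> states_val qs ys \<in> carrier G"
  unfolding states_val_def by (rule val_closed) (auto dest: in_wordD)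

lemma Letter_in_Q [simp]: "Letter l \<in> Q \<longleftrightarrow> l \<in> \<Sigma>"
  by (auto simp: Q_def)

lemma states_in_Q [simp]: "Conjugate \<in> Q" "Power \<in> Q" "InversePower \<in> Q"
  by (auto simp: Q_def)

text \<open>That padding is trivial is a hypothesis here because \<open>val_word_Letter\<close> is
  proved with this lemma and supplies it by induction; \<open>states_val_pad'\<close> then
  discharges it.\<close>

lemma states_val_pad:
  assumes "val (word (Letter Unit) ys) = \<one>" "set qs \<subseteq> Q"
  shows "states_val (pad qs) ys = states_val qs ys"
proof -
  have "states_val (replicate n (Letter Unit)) ys = \<one>" for n
  proof (induction n)
    case (Suc n)
    have "set (replicate n (Letter Unit)) \<subseteq> Q" by auto
    then show ?case using Suc assms(1) by (simp add: states_val_Cons)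
  qed simp
  then show ?thesis
    unfolding pad_def using assms(2) states_val_closed[OF assms(2)]
    by (subst states_val_append) auto
qed

lemma val_word_Letter:
  assumes "l \<in> \<Sigma>"
  shows "val (word (Letter l) ys) = letter_value G \<phi> l"
  using assms
proof (induction ys arbitrary: l)
  case Nil
  then show ?case using \<phi> by (simp add: val_def)
next
  case (Cons y ys)
  have "val (word (Letter l) (y # ys)) = states_val (pad [Letter l]) ys"
    by (simp add: word_Cons states_val_def)
  also have "\<dots> = states_val [Letter l] ys"
    using Cons.IH[of Unit] Cons.prems by (intro states_val_pad) auto
  finally show ?case
    using Cons \<phi> by (simp add: states_val_Cons)
qed

lemma states_val_pad' [simp]: "set qs \<subseteq> Q \<Longrightarrow> states_val (pad qs) ys = states_val qs ys"
  by (rule states_val_pad) (simp_all add: val_word_Letter)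

lemma Letters_subset_Q: "set w \<subseteq> \<Sigma> \<Longrightarrow> Letter ` set w \<subseteq> Q"
  by auto

lemma states_val_Letters: "set w \<subseteq> \<Sigma> \<Longrightarrow> states_val (map Letter w) ys = val w"
proof (induction w)
  case (Cons l w)
  then show ?case
    using states_val_Cons[of "Letter l" "map Letter w" ys] Letters_subset_Q[of w]
      val_word_Letter[of l ys]
    by (simp add: val_def)
qed simp

lemma val_word_inverse: "set w \<subseteq> \<Sigma> \<Longrightarrow> val (word_inverse w) = inv (val w)"
  using \<phi> by (simp add: val_def word_value_inverse)

lemma val_Power: "val (word Power ys) = val c [^] count_list ys False"
proof (induction ys)
  case Nil
  show ?case by (simp add: val_def)
next
  case (Cons y ys)
  have "val (word Power (y # ys)) = states_val ((if y then [] else map Letter c) @ [Power]) ys"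
    using c by (simp add: word_Cons states_val_def[symmetric] Letters_subset_Q)
  then show ?case
    using Cons c nat_pow_Suc2[of "val c"]
    by (cases y) (simp_all add: states_val_append states_val_Cons states_val_Letters Letters_subset_Q)
qed

lemma val_InversePower: "val (word InversePower ys) = inv (val c [^] count_list ys False)"
proof (induction ys)
  case Nil
  show ?case by (simp add: val_def)
next
  case (Cons y ys)
  have c': "set (word_inverse c) \<subseteq> \<Sigma>" using word_inverse_closed[OF c] .
  have "val (word InversePower (y # ys)) =
      states_val (InversePower # (if y then [] else map Letter (word_inverse c))) ys"
    using c' by (simp add: word_Cons states_val_def[symmetric] Letters_subset_Q)
  then show ?case
    using Cons c c' nat_pow_Suc2[of "val c"]
    by (cases y) (simp_all add: states_val_append states_val_Cons states_val_Letters Letters_subset_Q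
        val_word_inverse inv_mult_group)
qed

text \<open>If the first bit is a zero, one factor \<open>c\<close> on each side comes from this
  block and the others from \<open>Power\<close> and \<open>InversePower\<close>. For the empty list
  the word would be the letter \<open>l0\<close>.\<close>

lemma val_Conjugate:
  assumes "ys \<noteq> []"
  shows "val (word Conjugate ys) = conj (val c [^] count_list ys False) (val u)"
proof -
  obtain y ys' where ys: "ys = y # ys'" using assms by (cases ys) auto
  have c': "set (word_inverse c) \<subseteq> \<Sigma>" using word_inverse_closed[OF c] .
  have "val (word Conjugate ys) = states_val (InversePower # (if y then [] else map Letter (word_inverse c)) @
     map Letter u @ (if y then [] else map Letter c) @ [Power]) ys'"
    using c c' u unfolding ys by (simp add: word_Cons states_val_def[symmetric] Letters_subset_Q)
  then show ?thesis
    using c c' u nat_pow_Suc2[of "val c"] unfolding ys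
    by (cases y) (simp_all add: states_val_append states_val_Cons states_val_Letters Letters_subset_Q
        val_word_inverse val_Power val_InversePower inv_mult_group conj_def m_assoc)
qed

definition leaf :: "bool list \<Rightarrow> letter list" where
  "leaf v = word Conjugate (rev v)"

lemma set_commutator_tree: "set (commutator_tree n leaf v) \<subseteq> \<Sigma>"
proof (induction n arbitrary: v)
  case 0
  then show ?case using word_closed by (simp add: leaf_def)
next
  case (Suc n)
  then show ?case by (simp add: word_commutator_closed)
qed

text \<open>Conjugation is an endomorphism, so the conjugator \<open>c^k\<close> of \<open>v\<close>
  can be pulled out of the commutator of the two children. The additional zero of the left child
  leaves the inner conjugation by \<open>c\<close> that occurs in \<open>comm_seq\<close>. The
  hypothesis excludes a root that is itself a leaf.\<close>

lemma val_commutator_tree: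
  "length v + n > 0 \<Longrightarrow> val (commutator_tree n leaf v) =
    conj (val c [^] count_list v False) (comm_seq (val u) (val c) n)"
proof (induction n arbitrary: v)
  case 0
  then show ?case by (simp add: leaf_def val_Conjugate)
next
  case (Suc n)
  have "val (commutator_tree (Suc n) leaf v) =
      comm (val (commutator_tree n leaf (v @ [False]))) (val (commutator_tree n leaf (v @ [True])))"
    using set_commutator_tree \<phi> by (simp add: val_def word_value_commutator)
  then show ?case
    using Suc.IH[of "v @ [False]"] Suc.IH[of "v @ [True]"] u c nat_pow_Suc2[of "val c"]
    by (simp add: conj_comm conj_conj)
qed

end

theorem (in group) uniformly_SENS_of_comm_seq:
  assumes fg: "finitely_generated_group G" and a: "a \<in> carrier G" and c: "c \<in> carrier G"
    and nontrivial: "\<And>n. comm_seq a c n \<noteq> \<one>"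
  shows "uniformly_SENS G"
  unfolding uniformly_SENS_def
proof (intro conjI allI impI)
  show "finitely_generated_group G" by fact
  fix S \<phi>
  assume "standard_generators G S \<phi>"
  then have S: "finite S" "\<phi> ` S \<subseteq> carrier G" "generate G (\<phi> ` S) = carrier G"
    by (auto simp: standard_generators_def)
  obtain wa wc where wa: "set wa \<subseteq> standard_alphabet S" "word_value G \<phi> wa = a"
    and wc: "set wc \<subseteq> standard_alphabet S" "word_value G \<phi> wc = c"
    using word_value_exists[OF S(2)] a c S(3) by metis
  \<comment> \<open>For \<open>d = 0\<close> the root is a single letter and must be nontrivial. If
    all letters were trivial, so would be the element \<open>a\<close>, which is the first
    commutator of the sequence.\<close>
  have "\<exists>l \<in> standard_alphabet S. letter_value G \<phi> l \<noteq> \<one>"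
  proof (rule ccontr)
    assume "\<not> ?thesis"
    then have "word_value G \<phi> w = \<one>" if "set w \<subseteq> standard_alphabet S" for w
      using that by (induction w) auto
    then show False using wa nontrivial[of 0] by simp
  qed
  then obtain l0 where l0: "l0 \<in> standard_alphabet S" "letter_value G \<phi> l0 \<noteq> \<one>" by blast
  interpret W: conjugate_words G S \<phi> wa wc l0
    using S wa wc l0 by unfold_locales
  let ?g = "\<lambda>d v. commutator_tree (d - length v) W.leaf v"
  have root: "word_value G \<phi> (?g d []) \<noteq> \<one>" for d
  proof (cases "d = 0")
    case True
    then show ?thesis using l0 S(2) by (simp add: W.leaf_def)
  next
    case False
    then show ?thesis
      using W.val_commutator_tree[of "[]" d] nontrivial[of d] wa wc a c
      by (simp add: W.val_def conj_eq_one_iff)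
  qed
  have "sens_family G S \<phi> W.block_bits ?g"
    unfolding sens_family_def
  proof (intro allI conjI impI)
    fix d v
    show "?g d v \<in> lists (standard_alphabet S)"
      using W.set_commutator_tree by auto
    show "length (?g d v) = 2 ^ (W.block_bits * d)" if "length v = d"
      using that by (simp add: W.leaf_def W.length_word)
    show "?g d v = word_commutator (?g d (v @ [False])) (?g d (v @ [True]))" if "length v < d"
    proof -
      have "d - length v = Suc (d - Suc (length v))" using that by simp
      then show ?thesis by simp
    qed
  qed (use root in auto)
  moreover have "letter_language S W.block_bits ?g \<in> DLINTIME (query_alphabet S)"
    by (rule W.letter_language_DLINTIME) (simp add: W.leaf_def)
  ultimately show "\<exists>\<mu> g. sens_family G S \<phi> \<mu> g \<and> letter_language S \<mu> g \<in> DLINTIME (query_alphabet S)"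
    by blast
qed

section \<open>The group V\<close>

abbreviation finv :: "('a \<Rightarrow> 'a) \<Rightarrow> 'a \<Rightarrow> 'a" where
  "finv \<equiv> inv_into UNIV"

definition cylinder_map :: "(bool stream \<Rightarrow> bool stream) \<Rightarrow> bool list \<Rightarrow> bool list \<Rightarrow> bool" where
  "cylinder_map f u v \<longleftrightarrow> (\<forall>w. f (u @- w) = v @- w)"

lemma cylinder_map_append: "cylinder_map f u v \<Longrightarrow> cylinder_map f (u @ x) (v @ x)"
  by (simp add: cylinder_map_def)

lemma cylinder_map_comp: "cylinder_map g u v \<Longrightarrow> cylinder_map f v w \<Longrightarrow> cylinder_map (f \<circ> g) u w"
  by (simp add: cylinder_map_def)

lemma cylinder_map_id: "cylinder_map id u u"
  by (simp add: cylinder_map_def)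

lemma cylinder_map_inv: "bij f \<Longrightarrow> cylinder_map f u v \<Longrightarrow> cylinder_map (finv f) v u"
  unfolding cylinder_map_def by (metis bij_inv_eq_iff)

text \<open>Describing elements of V by a common depth at which they replace prefixes is easier to
  compose than a pair of codes. The replaced prefixes have length \<open>N\<close>, the new ones may
  have any length.\<close>

definition prefix_replacing :: "nat \<Rightarrow> (bool stream \<Rightarrow> bool stream) \<Rightarrow> bool" where
  "prefix_replacing N f \<longleftrightarrow> (\<forall>u. length u = N \<longrightarrow> (\<exists>v. cylinder_map f u v))"

lemma prefix_replacing_ge:
  assumes "prefix_replacing N f" "N \<le> length u"
  obtains v where "cylinder_map f (take N u) v" "cylinder_map f u (v @ drop N u)"
proof -
  obtain v where "cylinder_map f (take N u) v"
    using assms unfolding prefix_replacing_def by (metis length_take min.absorb2)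
  then show thesis using that cylinder_map_append[of f "take N u" v "drop N u"] by simp
qed

text \<open>The first map may shorten a prefix arbitrarily, but the \<open>M\<close> letters behind
  the first \<open>N\<close> survive, so its image is long enough for the second map.\<close>

lemma prefix_replacing_comp:
  assumes "prefix_replacing M f" "prefix_replacing N g"
  shows "prefix_replacing (N + M) (f \<circ> g)"
  unfolding prefix_replacing_def
proof (intro allI impI)
  fix u :: "bool list" assume u: "length u = N + M"
  from prefix_replacing_ge[OF assms(2), of u] u obtain v where v: "cylinder_map g u (v @ drop N u)" by auto
  from prefix_replacing_ge[OF assms(1), of "v @ drop N u"] u obtain w
    where "cylinder_map f (v @ drop N u) (w @ drop M (v @ drop N u))" by auto
  with v show "\<exists>v. cylinder_map (f \<circ> g) u v" using cylinder_map_comp by blast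
qed

lemma set_bits: "set (bits n) = {u. length u = n}"
proof (induction n)
  case (Suc n)
  have "{u :: bool list. length u = Suc n} = (#) False ` {u. length u = n} \<union> (#) True ` {u. length u = n}"
    by (auto simp: length_Suc_conv image_iff)
  with Suc show ?case by simp
qed auto

lemma distinct_bits: "distinct (bits n)"
  by (induction n) (auto simp: distinct_map)

lemma complete_prefix_code_bits: "complete_prefix_code (set (bits n))"
  unfolding complete_prefix_code_def set_bits
proof (intro conjI ballI allI impI)
  show "finite {u :: bool list. length u = n}"
    using set_bits[of n] by (metis List.finite_set)
  show "\<exists>u\<in>{u. length u = n}. \<exists>w. s = u @- w" for s :: "bool stream"
    by (metis (mono_tags) length_stake mem_Collect_eq stake_sdrop)
qed (auto simp: prefix_def)

text \<open>Injectivity of \<open>f\<close> rules out that one image cylinder contains another, and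
  surjectivity makes the image cylinders cover all streams.\<close>

lemma prefix_replacing_code:
  assumes f: "bij f" and v: "\<And>u. length u = N \<Longrightarrow> cylinder_map f u (v u)"
  shows "distinct (map v (bits N))" "complete_prefix_code (set (map v (bits N)))"
proof -
  have prefix: "u = u'" if u: "length u = N" "length u' = N" and pre: "prefix (v u) (v u')" for u u'
  proof -
    obtain x where "v u' = v u @ x" using pre by (auto simp: prefix_def)
    then have "f (u' @- sconst True) = f (u @- x @- sconst True)"
      using v[OF u(1)] v[OF u(2)] by (simp add: cylinder_map_def)
    then have "u' @- sconst True = u @- x @- sconst True"
      using f by (meson bij_def injD)
    from arg_cong[OF this, of "stake N"] show ?thesis using u by (simp add: stake_shift)
  qed
  have "inj_on v (set (bits N))"
    using prefix by (auto simp: inj_on_def set_bits)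
  then show "distinct (map v (bits N))"
    using distinct_bits by (simp add: distinct_map)
  show "complete_prefix_code (set (map v (bits N)))"
    unfolding complete_prefix_code_def
  proof (intro conjI ballI allI impI)
    show "finite (set (map v (bits N)))" by simp
  next
    fix s
    obtain t where s: "s = f t" using f by (metis bij_pointE)
    have "f (stake N t @- sdrop N t) = v (stake N t) @- sdrop N t"
      using v[of "stake N t"] by (simp add: cylinder_map_def)
    then show "\<exists>u\<in>set (map v (bits N)). \<exists>w. s = u @- w"
      using s by (intro bexI[of _ "v (stake N t)"] exI[of _ "sdrop N t"]) (auto simp: set_bits stake_sdrop)
  qed (use prefix in \<open>auto simp: set_bits\<close>)
qed

lemma carrier_V_iff: "f \<in> carrier thompson_V \<longleftrightarrow> bij f \<and> (\<exists>N. prefix_replacing N f)"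
proof (intro iffI conjI)
  assume "f \<in> carrier thompson_V"
  then obtain us vs where f: "bij f" and us: "length us = length vs" "complete_prefix_code (set us)"
    and uv: "\<And>i. i < length us \<Longrightarrow> cylinder_map f (us ! i) (vs ! i)"
    by (auto simp: thompson_V_def Bij_def cylinder_map_def)
  show "bij f" by fact
  \<comment> \<open>A word as long as the longest code word has a code word as prefix, because the
    code covers every stream that extends it.\<close>
  have "prefix_replacing (Max (length ` set us)) f"
    unfolding prefix_replacing_def
  proof (intro allI impI)
    fix u :: "bool list" assume u: "length u = Max (length ` set us)"
    obtain u' w where u': "u' \<in> set us" "u @- sconst True = u' @- w"
      using us(2) unfolding complete_prefix_code_def by meson
    then have "length u' \<le> length u" unfolding u by simp
    then have "u = u' @ drop (length u') u"
      using arg_cong[OF u'(2), of "stake (length u')"] by (simp add: stake_shift) (metis append_take_drop_id)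
    moreover obtain i where "i < length us" "u' = us ! i" using u'(1) by (metis in_set_conv_nth)
    ultimately show "\<exists>v. cylinder_map f u v"
      using cylinder_map_append[OF uv[of i]] by metis
  qed
  then show "\<exists>N. prefix_replacing N f" by blast
next
  assume "bij f \<and> (\<exists>N. prefix_replacing N f)"
  then obtain N where f: "bij f" and N: "prefix_replacing N f" by blast
  then obtain v where v: "\<And>u. length u = N \<Longrightarrow> cylinder_map f u (v u)"
    unfolding prefix_replacing_def by metis
  have "\<exists>us vs. length us = length vs \<and> distinct us \<and> distinct vs \<and>
        complete_prefix_code (set us) \<and> complete_prefix_code (set vs) \<and>
        (\<forall>i<length us. \<forall>w. f (us ! i @- w) = vs ! i @- w)"
    using distinct_bits complete_prefix_code_bits prefix_replacing_code[OF f v]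
      v length_in_bits[OF nth_mem, of _ N]
    by (intro exI[of _ "bits N"] exI[of _ "map v (bits N)"]) (simp add: cylinder_map_def)
  with f show "f \<in> carrier thompson_V"
    by (simp add: thompson_V_def Bij_def)
qed

lemma subgroup_V: "subgroup (carrier thompson_V) (BijGroup UNIV)"
proof (rule group.subgroupI[OF group_BijGroup])
  show "carrier thompson_V \<subseteq> carrier (BijGroup UNIV)"
    by (auto simp: thompson_V_def BijGroup_def)
  have "id \<in> carrier thompson_V"
    by (auto simp: carrier_V_iff prefix_replacing_def intro: cylinder_map_id)
  then show "carrier thompson_V \<noteq> {}" by blast
next
  fix f assume f: "f \<in> carrier thompson_V"
  then have B: "f \<in> Bij UNIV" by (simp add: thompson_V_def)
  have "inv\<^bsub>BijGroup UNIV\<^esub> f = finv f"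
    using inv_BijGroup[OF B] by (simp add: restrict_def)
  moreover have "finv f \<in> carrier thompson_V"
  proof -
    \<comment> \<open>Inverses are taken with pairs of codes, whose two members are simply
      interchanged; the images of cylinders of depth \<open>N\<close> have no common depth.\<close>
    obtain us vs where uv: "length us = length vs \<and> distinct us \<and> distinct vs \<and>
        complete_prefix_code (set us) \<and> complete_prefix_code (set vs) \<and>
        (\<forall>i<length us. \<forall>w. f (us ! i @- w) = vs ! i @- w)"
      using f by (auto simp: thompson_V_def)
    have b: "bij f" using f by (simp add: carrier_V_iff)
    then have "\<forall>i<length vs. \<forall>w. finv f (vs ! i @- w) = us ! i @- w"
      using uv by (metis bij_inv_eq_iff)
    then have "\<exists>us vs. length us = length vs \<and> distinct us \<and> distinct vs \<and>
        complete_prefix_code (set us) \<and> complete_prefix_code (set vs) \<and>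
        (\<forall>i<length us. \<forall>w. finv f (us ! i @- w) = vs ! i @- w)"
      using uv by (intro exI[of _ vs] exI[of _ us]) simp
    then show ?thesis
      using bij_imp_bij_inv[OF b] by (simp add: thompson_V_def Bij_def)
  qed
  ultimately show "inv\<^bsub>BijGroup UNIV\<^esub> f \<in> carrier thompson_V" by simp
next
  fix f g assume fg: "f \<in> carrier thompson_V" "g \<in> carrier thompson_V"
  then have "f \<otimes>\<^bsub>BijGroup UNIV\<^esub> g = f \<circ> g"
    by (auto simp: thompson_V_def BijGroup_def compose_def)
  moreover have "f \<circ> g \<in> carrier thompson_V"
    using fg prefix_replacing_comp unfolding carrier_V_iff by (blast intro: bij_comp)
  ultimately show "f \<otimes>\<^bsub>BijGroup UNIV\<^esub> g \<in> carrier thompson_V" by simp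
qed

lemma thompson_V_eq: "thompson_V = (BijGroup UNIV)\<lparr>carrier := carrier thompson_V\<rparr>"
  by (simp add: thompson_V_def)

interpretation V: group thompson_V
  using subgroup.subgroup_is_group[OF subgroup_V group_BijGroup] thompson_V_eq by simp

lemma V_mult: "f \<in> carrier thompson_V \<Longrightarrow> g \<in> carrier thompson_V \<Longrightarrow> f \<otimes>\<^bsub>thompson_V\<^esub> g = f \<circ> g"
  by (auto simp: thompson_V_def BijGroup_def compose_def)

lemma V_one: "\<one>\<^bsub>thompson_V\<^esub> = id"
  by (simp add: thompson_V_def BijGroup_def id_def restrict_def)

lemma V_bij: "f \<in> carrier thompson_V \<Longrightarrow> bij f"
  by (simp add: carrier_V_iff)

lemma V_inv:
  assumes "f \<in> carrier thompson_V" shows "inv\<^bsub>thompson_V\<^esub> f = finv f"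
proof -
  have "f \<in> Bij UNIV" using assms by (simp add: thompson_V_def)
  then have "inv\<^bsub>BijGroup UNIV\<^esub> f = finv f"
    using inv_BijGroup by (force simp: restrict_def)
  then show ?thesis
    using group.m_inv_consistent[OF group_BijGroup subgroup_V assms] thompson_V_eq by simp
qed

section \<open>Finite binary trees and tree pair diagrams\<close>

datatype tree = Leaf | Node tree tree

fun leaves :: "tree \<Rightarrow> bool list list" where
  "leaves Leaf = [[]]"
| "leaves (Node l r) = map ((#) False) (leaves l) @ map ((#) True) (leaves r)"

fun full_tree :: "nat \<Rightarrow> tree" where
  "full_tree 0 = Leaf"
| "full_tree (Suc n) = Node (full_tree n) (full_tree n)"

lemma leaves_full_tree: "leaves (full_tree n) = bits n"
  by (induction n) auto

text \<open>Unless the code consists of the empty word, the words beginning with a given bit form,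
  after removing that bit, a complete prefix code of smaller maximal length; the two trees so
  obtained are joined at a new root.\<close>

lemma complete_prefix_code_leaves:
  assumes "complete_prefix_code C"
  shows "\<exists>t. set (leaves t) = C"
proof -
  have fin: "finite C" using assms by (simp add: complete_prefix_code_def)
  then have "\<forall>u\<in>C. length u \<le> Max (length ` C)" by simp
  then show ?thesis using assms
  proof (induction "Max (length ` C)" arbitrary: C rule: less_induct)
    case less
    have fin: "finite C" and pre: "\<And>u v. u \<in> C \<Longrightarrow> v \<in> C \<Longrightarrow> prefix u v \<Longrightarrow> u = v"
      and cov: "\<And>s :: bool stream. \<exists>u\<in>C. \<exists>w. s = u @- w"
      using less.prems by (auto simp: complete_prefix_code_def)
    show ?case
    proof (cases "[] \<in> C")
      case True
      then have "C = {[]}" using pre[of "[]"] by auto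
      then show ?thesis by (intro exI[of _ Leaf]) simp
    next
      case False
      have sub: "\<exists>t. set (leaves t) = {u. b # u \<in> C}" for b
      proof -
        let ?C = "{u. b # u \<in> C}"
        have cov': "\<exists>u\<in>?C. \<exists>w. s = u @- w" for s
        proof -
          obtain u w where u: "u \<in> C" "b ## s = u @- w" using cov by blast
          then obtain u' where "u = b # u'" using False by (cases u) auto
          then show ?thesis using u by auto
        qed
        have fin': "finite ?C"
          using finite_imageD[of "(#) b" ?C] finite_subset[OF _ fin, of "(#) b ` ?C"] by auto
        have "u = v" if "u \<in> ?C" "v \<in> ?C" "prefix u v" for u v
          using pre[of "b # u" "b # v"] that by simp
        then have "complete_prefix_code ?C"
          unfolding complete_prefix_code_def using fin' cov' by blast
        \<comment> \<open>The covering property makes the subcode nonempty, so that the maximum of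
          its lengths is meaningful.\<close>
        moreover obtain u where "u \<in> ?C" using cov' by blast
        then have "Max (length ` ?C) < Max (length ` C)"
        proof (subst Max_less_iff)
          show "\<forall>n\<in>length ` ?C. n < Max (length ` C)"
          proof clarify
            fix u assume "b # u \<in> C"
            then have "length (b # u) \<le> Max (length ` C)" using fin by (intro Max_ge imageI) auto
            then show "length u < Max (length ` C)" by simp
          qed
        qed (use \<open>u \<in> ?C\<close> fin' in auto)
        ultimately show ?thesis using less.hyps[of ?C] fin' by simp
      qed
      obtain l r where "set (leaves l) = {u. False # u \<in> C}" "set (leaves r) = {u. True # u \<in> C}"
        using sub by meson
      moreover have "C = (#) False ` {u. False # u \<in> C} \<union> (#) True ` {u. True # u \<in> C}"
      proof (intro equalityI subsetI)
        fix u assume "u \<in> C"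
        with False obtain b u' where "u = b # u'" by (cases u) auto
        with \<open>u \<in> C\<close> show "u \<in> (#) False ` {u. False # u \<in> C} \<union> (#) True ` {u. True # u \<in> C}"
          by (cases b) auto
      qed auto
      ultimately show ?thesis by (intro exI[of _ "Node l r"]) simp
    qed
  qed
qed

lemma distinct_leaves: "distinct (leaves t)"
  by (induction t) (auto simp: distinct_map)

lemma leaves_cover: "\<exists>u\<in>set (leaves t). \<exists>w. s = u @- w"
proof (induction t arbitrary: s)
  case (Node l r)
  obtain u w where "u \<in> set (leaves (if shd s then r else l))" "stl s = u @- w"
    using Node by (metis (full_types))
  moreover from this have "s = shd s ## u @- w" by (metis stream.collapse)
  ultimately show ?case
    by (intro bexI[of _ "shd s # u"] exI[of _ w]) (auto split: if_splits)
qed auto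

text \<open>The lists are matched in their order. Between the leaves of two trees this is a tree
  pair diagram without permutation, that is, an element of F.\<close>

definition maps_list :: "(bool stream \<Rightarrow> bool stream) \<Rightarrow> bool list list \<Rightarrow> bool list list \<Rightarrow> bool" where
  "maps_list f us vs \<longleftrightarrow> list_all2 (cylinder_map f) us vs"

lemma maps_list_comp: "maps_list g us vs \<Longrightarrow> maps_list f vs ws \<Longrightarrow> maps_list (f \<circ> g) us ws"
  unfolding maps_list_def list_all2_conv_all_nth using cylinder_map_comp by metis

lemma maps_list_inv: "bij f \<Longrightarrow> maps_list f us vs \<Longrightarrow> maps_list (finv f) vs us"
  unfolding maps_list_def by (simp add: list_all2_conv_all_nth cylinder_map_inv)

lemma maps_list_eqI:
  assumes "maps_list f (leaves t) vs" "maps_list g (leaves t) vs"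
  shows "f = g"
proof
  fix s
  obtain u w where u: "u \<in> set (leaves t)" "s = u @- w" using leaves_cover by blast
  then obtain i where "i < length (leaves t)" "u = leaves t ! i" by (metis in_set_conv_nth)
  then have "cylinder_map f u (vs ! i)" "cylinder_map g u (vs ! i)"
    using assms by (auto simp: maps_list_def list_all2_conv_all_nth)
  then show "f s = g s" using u by (simp add: cylinder_map_def)
qed

text \<open>The prefix replacement 0 to 00, 10 to 01, 11 to 1, which is the generator
  \<open>x0\<close> of F acting on binary expansions. On trees its inverse \<open>expand\<close> is
  a rotation.\<close>

definition contract :: "bool stream \<Rightarrow> bool stream" where
  "contract s = (if shd s then if shd (stl s) then stl s else False ## True ## stl (stl s) else False ## s)"

definition expand :: "bool stream \<Rightarrow> bool stream" where
  "expand s = (if shd s then True ## s else if shd (stl s) then True ## False ## stl (stl s) else stl s)"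

definition on_True :: "(bool stream \<Rightarrow> bool stream) \<Rightarrow> bool stream \<Rightarrow> bool stream" where
  "on_True f s = (if shd s then True ## f (stl s) else s)"

definition flip :: "bool stream \<Rightarrow> bool stream" where
  "flip s = (\<not> shd s) ## stl s"

text \<open>The transposition of the cylinders \<open>0\<close> and \<open>10\<close>.\<close>

definition exchange :: "bool stream \<Rightarrow> bool stream" where
  "exchange s = (if shd s then if shd (stl s) then s else stl s else True ## s)"

lemma stream_cases2: obtains a b w where "s = a ## b ## w"
  by (metis stream.collapse)

lemma expand_contract [simp]: "expand (contract s) = s" "contract (expand s) = s"
  by (cases s rule: stream_cases2; auto simp: expand_def contract_def)+

lemma flip_flip [simp]: "flip (flip s) = s"
  by (simp add: flip_def)

lemma exchange_exchange [simp]: "exchange (exchange s) = s"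
  by (cases s rule: stream_cases2) (auto simp: exchange_def)

lemma bij_involution: "(\<And>s. f (f s) = s) \<Longrightarrow> bij f"
  by (metis bijI' )

lemma bij_contract: "bij contract"
  by (metis bijI' expand_contract)

lemma inv_contract: "finv contract = expand"
  by (rule inv_equality) simp_all

lemma on_True_comp: "on_True f \<circ> on_True g = on_True (f \<circ> g)"
  by (auto simp: on_True_def fun_eq_iff)

lemma on_True_id: "on_True id = id"
  by (auto simp: on_True_def fun_eq_iff) (metis stream.collapse)

lemma on_True_inverse: "f \<circ> g = id \<Longrightarrow> on_True f \<circ> on_True g = id"
  by (simp add: on_True_comp on_True_id)

lemma bij_on_True: "bij f \<Longrightarrow> bij (on_True f)"
  using on_True_inverse[of f "finv f"] on_True_inverse[of "finv f" f]
  by (metis bij_is_inj bij_is_surj inv_o_cancel o_bij surj_iff)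

lemma inv_on_True: "bij f \<Longrightarrow> finv (on_True f) = on_True (finv f)"
  using on_True_inverse[of f "finv f"] on_True_inverse[of "finv f" f]
  by (metis bij_is_inj bij_is_surj inv_o_cancel inv_unique_comp surj_iff)

lemma cylinder_map_on_True:
  "cylinder_map f u v \<Longrightarrow> cylinder_map (on_True f) (True # u) (True # v)"
  "cylinder_map (on_True f) (False # u) (False # u)"
  by (simp_all add: cylinder_map_def on_True_def)

lemma cylinder_map_contract:
  "cylinder_map contract (False # u) (False # False # u)"
  "cylinder_map contract (True # False # u) (False # True # u)"
  "cylinder_map contract (True # True # u) (True # u)"
  by (simp_all add: cylinder_map_def contract_def)

lemma cylinder_map_expand:
  "cylinder_map expand (False # False # u) (False # u)"
  "cylinder_map expand (False # True # u) (True # False # u)"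
  "cylinder_map expand (True # u) (True # True # u)"
  by (simp_all add: cylinder_map_def expand_def)

lemma cylinder_map_flip: "cylinder_map flip (b # u) ((\<not> b) # u)"
  by (simp add: cylinder_map_def flip_def)

lemma cylinder_map_exchange:
  "cylinder_map exchange (False # u) (True # False # u)"
  "cylinder_map exchange (True # False # u) (False # u)"
  "cylinder_map exchange (True # True # u) (True # True # u)"
  by (simp_all add: cylinder_map_def exchange_def)

lemma on_True_in_V:
  assumes "f \<in> carrier thompson_V" shows "on_True f \<in> carrier thompson_V"
proof -
  obtain N where N: "prefix_replacing N f" and f: "bij f" using assms by (auto simp: carrier_V_iff)
  have "prefix_replacing (Suc N) (on_True f)"
    unfolding prefix_replacing_def
  proof (intro allI impI)
    fix u :: "bool list" assume "length u = Suc N"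
    then obtain b u' where u: "u = b # u'" "length u' = N" by (cases u) auto
    then obtain v where "cylinder_map f u' v" using N by (auto simp: prefix_replacing_def)
    then show "\<exists>v. cylinder_map (on_True f) u v"
      using u by (cases b) (auto intro: cylinder_map_on_True)
  qed
  then show ?thesis using f bij_on_True by (auto simp: carrier_V_iff)
qed

lemma in_V_two:
  assumes "bij f" "\<And>a b. \<exists>v. cylinder_map f [a, b] v"
  shows "f \<in> carrier thompson_V"
proof -
  have "prefix_replacing (Suc (Suc 0)) f"
    using assms(2) by (auto simp: prefix_replacing_def length_Suc_conv)
  then show ?thesis using assms(1) by (auto simp: carrier_V_iff)
qed

lemma generators_in_V:
  "contract \<in> carrier thompson_V" "flip \<in> carrier thompson_V" "exchange \<in> carrier thompson_V"
proof -
  show "contract \<in> carrier thompson_V"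
    by (rule in_V_two[OF bij_contract]) (metis (full_types) cylinder_map_contract)
  show "flip \<in> carrier thompson_V"
    by (rule in_V_two[OF bij_involution]) (auto intro: cylinder_map_flip)
  show "exchange \<in> carrier thompson_V"
    by (rule in_V_two[OF bij_involution]) (simp, metis (full_types) cylinder_map_exchange)
qed

text \<open>\<open>contract\<close> takes the cylinder 11 to 1 and everything else into 0, where
  \<open>on_True f\<close> is trivial. This is the relation by which \<open>x0\<close> conjugates
  each generator of the infinite presentation of F to the next one, and it reduces nested copies to
  single ones.\<close>

lemma on_True_on_True: "on_True (on_True f) = expand \<circ> on_True f \<circ> contract"
proof
  show "on_True (on_True f) s = (expand \<circ> on_True f \<circ> contract) s" for s
    by (cases s rule: stream_cases2) (auto simp: on_True_def expand_def contract_def)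
qed

lemma generate_on_True:
  assumes A: "A \<subseteq> carrier thompson_V" and B: "B \<subseteq> carrier thompson_V"
    and AB: "\<And>a. a \<in> A \<Longrightarrow> on_True a \<in> generate thompson_V B"
    and f: "f \<in> generate thompson_V A"
  shows "on_True f \<in> generate thompson_V B"
  using f
proof (induction rule: generate.induct)
  case one
  show ?case using generate.one[of thompson_V B] unfolding V_one on_True_id .
next
  case (incl a)
  then show ?case by (rule AB)
next
  case (inv a)
  then have a: "a \<in> carrier thompson_V" using A by blast
  have "on_True (inv\<^bsub>thompson_V\<^esub> a) = inv\<^bsub>thompson_V\<^esub> (on_True a)"
    using a on_True_in_V[OF a] by (simp add: V_inv inv_on_True V_bij)
  then show ?case using V.generate_m_inv_closed[OF B AB[OF inv]] by simp
next
  case (eng f g)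
  have fg: "f \<in> carrier thompson_V" "g \<in> carrier thompson_V"
    using eng(1,2) V.generate_in_carrier[OF A] by auto
  have "on_True (f \<otimes>\<^bsub>thompson_V\<^esub> g) = on_True f \<otimes>\<^bsub>thompson_V\<^esub> on_True g"
    using fg on_True_in_V by (simp add: V_mult on_True_comp)
  then show ?case using generate.eng[OF eng(3,4)] by simp
qed

definition F_gens :: "(bool stream \<Rightarrow> bool stream) set" where
  "F_gens = {contract, on_True contract}"

definition V_gens :: "(bool stream \<Rightarrow> bool stream) set" where
  "V_gens = {contract, on_True contract, flip, on_True flip, exchange, on_True exchange}"

lemma gens_subset: "F_gens \<subseteq> carrier thompson_V" "V_gens \<subseteq> carrier thompson_V"
  using generators_in_V on_True_in_V by (auto simp: F_gens_def V_gens_def)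

abbreviation F_generated :: "(bool stream \<Rightarrow> bool stream) set" where
  "F_generated \<equiv> generate thompson_V F_gens"

abbreviation V_generated :: "(bool stream \<Rightarrow> bool stream) set" where
  "V_generated \<equiv> generate thompson_V V_gens"

lemma generate_comp:
  assumes "A \<subseteq> carrier thompson_V" "f \<in> generate thompson_V A" "g \<in> generate thompson_V A"
  shows "f \<circ> g \<in> generate thompson_V A"
  using generate.eng[OF assms(2,3)] V.generate_in_carrier[OF assms(1)] assms by (simp add: V_mult)

lemma generate_inv:
  assumes "A \<subseteq> carrier thompson_V" "f \<in> generate thompson_V A"
  shows "finv f \<in> generate thompson_V A"
  using V.generate_m_inv_closed[OF assms] V.generate_in_carrier[OF assms] by (simp add: V_inv)

text \<open>A generator that is already a copy inside the cylinder 1 is moved one level deeper by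
  conjugation with \<open>contract\<close>, so one level of copies in the generating set is
  enough.\<close>

lemma on_True_closed:
  assumes A: "A \<subseteq> carrier thompson_V" "contract \<in> A"
    and AA: "\<And>a. a \<in> A \<Longrightarrow> on_True a \<in> A \<or> (\<exists>b. a = on_True b)"
    and f: "f \<in> generate thompson_V A"
  shows "on_True f \<in> generate thompson_V A"
proof (rule generate_on_True[OF A(1) A(1) _ f])
  fix a assume a: "a \<in> A"
  from AA[OF a] show "on_True a \<in> generate thompson_V A"
  proof
    assume "\<exists>b. a = on_True b"
    then have "on_True a = finv contract \<circ> a \<circ> contract"
      using on_True_on_True inv_contract by auto
    then show ?thesis
      using generate_comp[OF A(1)] generate_inv[OF A(1)] generate.incl a A(2) by metis
  qed (rule generate.incl)
qed

lemma F_gens_on_True: "f \<in> F_generated \<Longrightarrow> on_True f \<in> F_generated"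
  by (rule on_True_closed[OF gens_subset(1)]) (auto simp: F_gens_def)

lemma V_gens_on_True: "f \<in> V_generated \<Longrightarrow> on_True f \<in> V_generated"
  by (rule on_True_closed[OF gens_subset(2)]) (auto simp: V_gens_def)

text \<open>The leaves 0, 10, 110, ... of the right comb, which serves as the normal form of a tree
  with \<open>n + 1\<close> leaves.\<close>

fun comb :: "nat \<Rightarrow> bool list list" where
  "comb 0 = [[]]"
| "comb (Suc n) = [False] # map ((#) True) (comb n)"

text \<open>
  Rotating \<open>Node (Node a b) r\<close> to \<open>Node a (Node b r)\<close>, which is the effect of \<open>expand\<close>, lowers the
  weight.
\<close>

fun weight :: "tree \<Rightarrow> nat" where
  "weight Leaf = 0"
| "weight (Node l r) = Suc (2 * weight l + weight r)"

text \<open>A left subtree that is not a leaf is rotated to the right. Once it is a leaf, the work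
  continues inside the cylinder 1, where \<open>F_gens_on_True\<close> provides the necessary
  copies.\<close>

lemma tree_to_comb:
  "\<exists>f \<in> F_generated. \<exists>n. maps_list f (leaves t) (comb n)"
proof (induction t rule: measure_induct_rule[of weight])
  case (less t)
  show ?case
  proof (cases t)
    case Leaf
    have "id \<in> F_generated"
      using generate.one[of thompson_V F_gens] by (simp add: V_one)
    then show ?thesis
      using Leaf by (intro bexI[of _ id] exI[of _ 0]) (auto simp: maps_list_def cylinder_map_def)
  next
    case (Node l r)
    show ?thesis
    proof (cases l)
      case Leaf
      obtain f n where f: "f \<in> F_generated" "maps_list f (leaves r) (comb n)"
        using less[of r] Node Leaf by auto
      have "maps_list (on_True f) (leaves t) (comb (Suc n))"
        using f(2) cylinder_map_on_True unfolding Node Leaf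
        by (auto simp: maps_list_def list_all2_map1 list_all2_map2 elim!: list_all2_mono)
      then show ?thesis using F_gens_on_True[OF f(1)] by blast
    next
      case l: (Node a b)
      let ?t = "Node a (Node b r)"
      have "maps_list expand (leaves t) (leaves ?t)"
        unfolding Node l maps_list_def using cylinder_map_expand
        by (auto simp: comp_def list_all2_map1 list_all2_map2 intro!: list_all2_appendI list_all2_refl)
      moreover obtain f n where f: "f \<in> F_generated" "maps_list f (leaves ?t) (comb n)"
        using less[of ?t] unfolding Node l by auto
      ultimately have "maps_list (f \<circ> expand) (leaves t) (comb n)"
        using maps_list_comp by blast
      moreover have "f \<circ> expand \<in> F_generated"
        unfolding inv_contract[symmetric]
        by (intro generate_comp[OF gens_subset(1)] generate_inv[OF gens_subset(1)] f generate.incl)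
          (simp add: F_gens_def)
      ultimately show ?thesis by blast
    qed
  qed
qed

lemma length_comb [simp]: "length (comb n) = Suc n"
  by (induction n) auto

text \<open>Both trees have equally many leaves and are therefore brought to the same comb; a map is
  determined by what it does to the leaves of a tree, so \<open>f\<close> is the composition of the
  two reductions.\<close>

theorem tree_pair_in_generate:
  assumes "f \<in> carrier thompson_V" "maps_list f (leaves s) (leaves t)"
  shows "f \<in> F_generated"
proof -
  obtain g n where g: "g \<in> F_generated" "maps_list g (leaves s) (comb n)"
    using tree_to_comb by blast
  obtain h m where h: "h \<in> F_generated" "maps_list h (leaves t) (comb m)"
    using tree_to_comb by blast
  have "length (comb n) = length (comb m)"
    using g(2) h(2) assms(2) unfolding maps_list_def by (metis list_all2_lengthD)
  then have "m = n" by simp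
  have b: "bij h" using V.generate_in_carrier[OF gens_subset(1) h(1)] by (rule V_bij)
  have "maps_list (finv h \<circ> g) (leaves s) (leaves t)"
    using maps_list_comp[OF g(2) maps_list_inv[OF b]] h(2) \<open>m = n\<close> by blast
  then have "f = finv h \<circ> g" using maps_list_eqI assms(2) by blast
  then show ?thesis
    using generate_comp[OF gens_subset(1) generate_inv[OF gens_subset(1) h(1)] g(1)] by simp
qed

section \<open>Permutations of the leaves of a comb\<close>

abbreviation swap :: "bool list \<Rightarrow> bool list \<Rightarrow> bool list \<Rightarrow> bool list" where
  "swap \<equiv> Transposition.transpose"

definition realizable :: "nat \<Rightarrow> (bool list \<Rightarrow> bool list) \<Rightarrow> bool" where
  "realizable n p \<longleftrightarrow> (\<exists>f \<in> V_generated. \<forall>x\<in>set (comb n). cylinder_map f x (p x))"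

lemma generate_V_comp: "f \<in> V_generated \<Longrightarrow> g \<in> V_generated \<Longrightarrow>
    f \<circ> g \<in> V_generated"
  by (rule generate_comp[OF gens_subset(2)])

lemma realizable_comp:
  assumes "realizable n p" "realizable n q" "\<And>x. x \<in> set (comb n) \<Longrightarrow> q x \<in> set (comb n)"
  shows "realizable n (p \<circ> q)"
proof -
  obtain f g where f: "f \<in> V_generated" "\<And>x. x\<in>set (comb n) \<Longrightarrow> cylinder_map f x (p x)"
    and g: "g \<in> V_generated" "\<And>x. x\<in>set (comb n) \<Longrightarrow> cylinder_map g x (q x)"
    using assms(1,2) unfolding realizable_def by blast
  show ?thesis
    using generate_V_comp[OF f(1) g(1)] cylinder_map_comp[OF g(2) f(2)[OF assms(3)]]
    unfolding realizable_def by auto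
qed

text \<open>Transpositions that avoid the first leaf 0 come by induction from the smaller comb in
  the cylinder 1. Conjugating one transposition that involves 0 with these yields all others that
  involve it.\<close>

lemma transpose_in_generate:
  "u \<in> set (comb n) \<Longrightarrow> v \<in> set (comb n) \<Longrightarrow> u \<noteq> v \<Longrightarrow> realizable n (swap u v)"
proof (induction n arbitrary: u v)
  case 0
  then show ?case by simp
next
  case (Suc n)
  have on_True: "realizable (Suc n) (swap (True # a) (True # b))"
    if ab: "a \<in> set (comb n)" "b \<in> set (comb n)" "a \<noteq> b" for a b
  proof -
    obtain f where f: "f \<in> V_generated"
      "\<forall>x\<in>set (comb n). cylinder_map f x (swap a b x)"
      using Suc.IH[OF ab] unfolding realizable_def by blast
    have "cylinder_map (on_True f) (True # x) (swap (True # a) (True # b) (True # x))"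
      if "x \<in> set (comb n)" for x
    proof -
      have "swap (True # a) (True # b) (True # x) = True # swap a b x"
        by (simp add: Transposition.transpose_def)
      then show ?thesis using f(2) that cylinder_map_on_True(1) by metis
    qed
    moreover have "cylinder_map (on_True f) [False] (swap (True # a) (True # b) [False])"
      using cylinder_map_on_True(2) by (simp add: Transposition.transpose_def)
    ultimately show ?thesis
      using V_gens_on_True[OF f(1)] unfolding realizable_def by auto
  qed
  \<comment> \<open>With two leaves the partner of 0 is 1, and \<open>flip\<close> exchanges them;
    with more leaves it is 10, and \<open>exchange\<close> does so while fixing the cylinder
    11.\<close>
  obtain e where e: "e \<in> set (comb n)" "realizable (Suc n) (swap [False] (True # e))"
  proof (cases n)
    case 0
    have "cylinder_map flip [False] [True]" "cylinder_map flip [True] [False]"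
      using cylinder_map_flip[of False "[]"] cylinder_map_flip[of True "[]"] by auto
    then have "realizable (Suc n) (swap [False] (True # []))"
      using 0 generate.incl[of flip V_gens thompson_V] by (auto simp: V_gens_def realizable_def)
    then show thesis using that[of "[]"] 0 by simp
  next
    case (Suc m)
    have "realizable (Suc n) (swap [False] (True # [False]))"
      unfolding realizable_def
      using Suc generate.incl[of exchange V_gens thompson_V] cylinder_map_exchange
      by (intro bexI[of _ exchange]) (auto simp: V_gens_def Transposition.transpose_def)
    then show thesis using that[of "[False]"] Suc by simp
  qed
  have first: "realizable (Suc n) (swap [False] (True # b))" if "b \<in> set (comb n)" for b
  proof (cases "b = e")
    case False
    let ?s = "swap (True # e) (True # b)"
    \<comment> \<open>Conjugation by \<open>?s\<close> renames \<open>e\<close> to \<open>b\<close>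
      and leaves the first leaf alone.\<close>
    have "swap [False] (True # b) = ?s \<circ> swap [False] (True # e) \<circ> ?s"
      using False by (auto simp: Transposition.transpose_def fun_eq_iff)
    moreover have "realizable (Suc n) ?s" using on_True e(1) that False by blast
    moreover have "?s x \<in> set (comb (Suc n))" if "x \<in> set (comb (Suc n))" for x
      using that \<open>b \<in> set (comb n)\<close> e(1) by (auto simp: Transposition.transpose_def)
    moreover have "swap [False] (True # e) x \<in> set (comb (Suc n))" if "x \<in> set (comb (Suc n))" for x
      using that e(1) by (auto simp: Transposition.transpose_def)
    ultimately show ?thesis
      using e(2) realizable_comp[of "Suc n" "?s \<circ> swap [False] (True # e)" ?s]
        realizable_comp[of "Suc n" ?s "swap [False] (True # e)"] by metis
  qed (use e in simp)
  from Suc.prems show ?case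
    using on_True first by (auto simp: transpose_commute)
qed

lemma permutation_in_generate:
  assumes "p permutes set (comb n)" shows "realizable n p"
  using assms List.finite_set[of "comb n"]
proof (induction p rule: permutes_induct)
  case id
  have "id \<in> V_generated"
    using generate.one[of thompson_V V_gens] by (simp add: V_one)
  then show ?case unfolding realizable_def by (intro bexI[of _ id]) (auto simp: cylinder_map_def)
next
  case (swap a b p)
  then show ?case
    using realizable_comp[OF transpose_in_generate[of a n b], of p]
    by (simp add: permutes_in_image comp_def)
qed

text \<open>If one image were a proper prefix of the other, every stream would begin with the first
  letter of the remainder, which a constant stream of the opposite letter refutes.\<close>

lemma cylinder_map_unique:
  assumes "cylinder_map f u v" "cylinder_map f u v'"
  shows "v = v'"
proof -
  have *: "v @- w = v' @- w" for w
    using assms unfolding cylinder_map_def by metis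
  have "a = b" if ab: "length a \<le> length b" "\<And>w. a @- w = b @- w" for a b :: "bool list"
  proof -
    have b: "b = a @ drop (length a) b"
      using arg_cong[OF ab(2), of "stake (length a)" "sconst True"] ab(1)
      by (simp add: stake_shift) (metis append_take_drop_id)
    have w: "w = drop (length a) b @- w" for w
      using ab(2)[of w] b by (metis shift_append shift_left_inj)
    show ?thesis
    proof (cases "drop (length a) b")
      case (Cons c x)
      then show ?thesis using arg_cong[OF w[of "sconst (\<not> c)"], of shd] by simp
    qed (use b in simp)
  qed
  then show ?thesis using * by (metis nle_le)
qed

lemma comb_leaves: "\<exists>t. leaves t = comb n"
proof (induction n)
  case 0
  show ?case by (intro exI[of _ Leaf]) simp
next
  case (Suc n)
  then obtain t where "leaves t = comb n" by blast
  then show ?case by (intro exI[of _ "Node Leaf t"]) simp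
qed

text \<open>Every element is a permutation of the leaves of a comb between two elements of F that
  reduce the trees of its two codes to that comb. Equal size of the codes makes the two combs
  agree.\<close>

theorem generate_V: "V_generated = carrier thompson_V"
proof (intro equalityI subsetI)
  show "f \<in> carrier thompson_V" if "f \<in> V_generated" for f
    using V.generate_in_carrier[OF gens_subset(2) that] .
next
  fix f assume f: "f \<in> carrier thompson_V"
  have sub: "F_generated \<subseteq> V_generated"
    by (rule V.mono_generate) (auto simp: F_gens_def V_gens_def)
  obtain us vs where uv: "length us = length vs" "distinct us" "distinct vs"
    "complete_prefix_code (set us)" "complete_prefix_code (set vs)" "maps_list f us vs"
    using f by (auto simp: thompson_V_def maps_list_def list_all2_conv_all_nth cylinder_map_def)
  obtain s t where st: "set (leaves s) = set us" "set (leaves t) = set vs"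
    using complete_prefix_code_leaves uv by meson
  obtain g n where g: "g \<in> F_generated" "maps_list g (leaves s) (comb n)"
    using tree_to_comb by blast
  obtain h m where h: "h \<in> F_generated" "maps_list h (leaves t) (comb m)"
    using tree_to_comb by blast
  have gh: "bij g" "bij h"
    using g(1) h(1) V.generate_in_carrier[OF gens_subset(1)] V_bij by blast+
  have "length us = Suc n" "length vs = Suc m"
    using st uv(2,3) distinct_leaves distinct_card g(2) h(2)
    by (metis length_comb list_all2_lengthD maps_list_def)+
  then have m: "m = n" using uv(1) by simp
  define f' where "f' = h \<circ> f \<circ> finv g"
  have "\<exists>y \<in> set (comb n). cylinder_map f' x y" if x: "x \<in> set (comb n)" for x
  proof -
    obtain u where u: "u \<in> set us" "cylinder_map (finv g) x u"
      using maps_list_inv[OF gh(1) g(2)] x st(1)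
      unfolding maps_list_def list_all2_conv_all_nth by (metis in_set_conv_nth nth_mem)
    obtain v where v: "v \<in> set vs" "cylinder_map f u v"
      using uv(6) u(1) unfolding maps_list_def list_all2_conv_all_nth by (metis in_set_conv_nth nth_mem)
    obtain y where "y \<in> set (comb n)" "cylinder_map h v y"
      using h(2) v(1) st(2) m unfolding maps_list_def list_all2_conv_all_nth
      by (metis in_set_conv_nth nth_mem)
    then show ?thesis
      using u v cylinder_map_comp unfolding f'_def by blast
  qed
  then obtain q where q: "\<And>x. x \<in> set (comb n) \<Longrightarrow> q x \<in> set (comb n) \<and> cylinder_map f' x (q x)"
    by metis
  \<comment> \<open>\<open>permutes\<close> asks for the identity outside the set, about which
    \<open>q\<close> says nothing.\<close>
  define p where "p x = (if x \<in> set (comb n) then q x else x)" for x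
  have f': "bij f'"
    unfolding f'_def using gh V_bij[OF f] by (intro bij_comp bij_imp_bij_inv)
  have "inj_on q (set (comb n))"
  proof (rule inj_onI)
    fix x y assume "x \<in> set (comb n)" "y \<in> set (comb n)" "q x = q y"
    then have "cylinder_map (finv f') (q x) x" "cylinder_map (finv f') (q x) y"
      using q cylinder_map_inv[OF f'] by metis+
    then show "x = y" by (rule cylinder_map_unique)
  qed
  moreover have "q ` set (comb n) \<subseteq> set (comb n)" using q by blast
  ultimately have "bij_betw q (set (comb n)) (set (comb n))"
    by (simp add: bij_betw_def endo_inj_surj)
  then have "p permutes set (comb n)"
    by (intro bij_imp_permutes) (auto simp: p_def cong: bij_betw_cong)
  then obtain \<sigma> where \<sigma>: "\<sigma> \<in> V_generated"
      "\<forall>x\<in>set (comb n). cylinder_map \<sigma> x (p x)"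
    using permutation_in_generate unfolding realizable_def by blast
  obtain r where r: "leaves r = comb n" using comb_leaves by blast
  have "maps_list \<sigma> (leaves r) (map p (comb n))" "maps_list f' (leaves r) (map p (comb n))"
    unfolding r maps_list_def using \<sigma>(2) q by (auto simp: list_all2_conv_all_nth p_def)
  then have "\<sigma> = f'" by (rule maps_list_eqI)
  then have "f = finv h \<circ> \<sigma> \<circ> g"
    using gh by (simp add: f'_def fun_eq_iff bij_is_inj bij_is_surj surj_f_inv_f inv_f_f)
  moreover have "finv h \<in> V_generated"
    using generate_inv[OF gens_subset(2)] sub h(1) by blast
  ultimately show "f \<in> V_generated"
    using generate_V_comp \<sigma>(1) g(1) sub by auto
qed

section \<open>Dyadic piecewise affine maps of the line\<close>

lemma dyadics_iff: "x \<in> dyadics \<longleftrightarrow> (\<exists>n. x * 2 ^ n \<in> \<int>)"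
proof
  assume "x \<in> dyadics"
  then obtain m n where "x = of_int m / 2 ^ n" by (auto simp: dyadics_def)
  then show "\<exists>n. x * 2 ^ n \<in> \<int>" by (intro exI[of _ n]) simp
next
  assume "\<exists>n. x * 2 ^ n \<in> \<int>"
  then obtain n m where "x * 2 ^ n = of_int m" by (auto elim: Ints_cases)
  then have "x = of_int m / 2 ^ n" by (simp add: field_simps)
  then show "x \<in> dyadics" by (auto simp: dyadics_def)
qed

lemma dyadics_of_int [simp]: "of_int m \<in> dyadics"
  unfolding dyadics_iff by (intro exI[of _ 0]) simp

lemma dyadics_0 [simp]: "0 \<in> dyadics" and dyadics_1 [simp]: "1 \<in> dyadics"
  using dyadics_of_int[of 0] dyadics_of_int[of 1] by simp_all

lemma dyadics_add [simp]:
  assumes "x \<in> dyadics" "y \<in> dyadics" shows "x + y \<in> dyadics"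
proof -
  obtain m n where "x * 2 ^ m \<in> \<int>" "y * 2 ^ n \<in> \<int>" using assms by (auto simp: dyadics_iff)
  then have "(x * 2 ^ m) * 2 ^ n + (y * 2 ^ n) * 2 ^ m \<in> \<int>" by (metis Ints_add Ints_mult Ints_numeral Ints_power)
  also have "(x * 2 ^ m) * 2 ^ n + (y * 2 ^ n) * 2 ^ m = (x + y) * 2 ^ (m + n)"
    by (simp add: power_add algebra_simps)
  finally show ?thesis by (auto simp: dyadics_iff)
qed

lemma dyadics_mult [simp]:
  assumes "x \<in> dyadics" "y \<in> dyadics" shows "x * y \<in> dyadics"
proof -
  obtain m n where "x * 2 ^ m \<in> \<int>" "y * 2 ^ n \<in> \<int>" using assms by (auto simp: dyadics_iff)
  then have "(x * 2 ^ m) * (y * 2 ^ n) \<in> \<int>" by (rule Ints_mult)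
  also have "(x * 2 ^ m) * (y * 2 ^ n) = (x * y) * 2 ^ (m + n)"
    by (simp add: power_add algebra_simps)
  finally show ?thesis by (auto simp: dyadics_iff)
qed

lemma dyadics_diff [simp]: "x \<in> dyadics \<Longrightarrow> y \<in> dyadics \<Longrightarrow> x - y \<in> dyadics"
  using dyadics_add[of x "of_int (-1) * y"] dyadics_mult[of "of_int (-1)" y] dyadics_of_int[of "-1"] by simp

lemma dyadics_power_int [simp]: "2 powi k \<in> dyadics"
proof (cases "k \<ge> 0")
  case True
  then have "(2::real) powi k = of_int (2 ^ nat k)" by (simp add: power_int_def)
  then show ?thesis by (metis dyadics_of_int)
next
  case False
  then have "(2::real) powi k * 2 ^ nat (- k) = 1" by (simp add: power_int_def field_simps)
  then show ?thesis unfolding dyadics_iff by (intro exI[of _ "nat (- k)"]) simp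
qed

lemma dyadics_dense:
  assumes "a < b" shows "\<exists>t \<in> dyadics. a < t \<and> t < b"
proof -
  obtain n :: nat where "inverse (b - a) < 2 ^ n"
    using real_arch_pow[of 2 "inverse (b - a)"] by auto
  then have n: "1 < (b - a) * 2 ^ n" using assms by (simp add: field_simps)
  let ?t = "of_int (\<lfloor>a * 2 ^ n\<rfloor> + 1) / 2 ^ n :: real"
  have "a * 2 ^ n < of_int (\<lfloor>a * 2 ^ n\<rfloor> + 1)" "of_int (\<lfloor>a * 2 ^ n\<rfloor> + 1) \<le> a * 2 ^ n + 1"
    by linarith+
  moreover have "a * 2 ^ n + 1 < b * 2 ^ n" using n by (simp add: left_diff_distrib)
  ultimately have "a * 2 ^ n < of_int (\<lfloor>a * 2 ^ n\<rfloor> + 1)" "of_int (\<lfloor>a * 2 ^ n\<rfloor> + 1) < b * 2 ^ n"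
    by linarith+
  then have "a < ?t" "?t < b" by (simp_all add: less_divide_eq divide_less_eq)
  moreover have "?t \<in> dyadics" unfolding dyadics_def by blast
  ultimately show ?thesis by blast
qed

text \<open>On the whole line the breakpoints of a periodic map repeat with period 1, so they are
  required to be finite in number only on bounded intervals.\<close>

definition piecewise_affine :: "(real \<Rightarrow> real) \<Rightarrow> bool" where
  "piecewise_affine h \<longleftrightarrow> (\<exists>B \<subseteq> dyadics. (\<forall>p q. finite (B \<inter> {p..q})) \<and>
    (\<forall>a b. a < b \<and> {a<..<b} \<inter> B = {} \<longrightarrow>
      (\<exists>(k::int) (c::real). \<forall>x\<in>{a..b}. h x = 2 powi k * x + c)))"

text \<open>The lifts to the line of the elements of T. The elements of F become the lifts that fix
  0, so closure under composition and inverses is proved once for both groups.\<close>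

definition lifts :: "(real \<Rightarrow> real) set" where
  "lifts = {h. strict_mono h \<and> surj h \<and> (\<forall>x. h (x + 1) = h x + 1) \<and> h ` dyadics \<subseteq> dyadics \<and>
    piecewise_affine h}"

lemma periodic_of_int:
  assumes "\<And>x. h (x + 1) = h x + (1::real)"
  shows "h (x + of_int n) = h x + of_int n"
proof (induction n rule: int_induct[where k = 0])
  case (step1 i)
  then show ?case using assms[of "x + of_int i"] by (simp add: algebra_simps)
next
  case (step2 i)
  then show ?case using assms[of "x + of_int (i - 1)"] by (simp add: algebra_simps)
qed simp

lemma lifts_pieces:
  assumes "h \<in> lifts"
  obtains B where "B \<subseteq> dyadics" "\<And>p q. finite (B \<inter> {p..q})"
    "\<And>a b. a < b \<Longrightarrow> {a<..<b} \<inter> B = {} \<Longrightarrow> \<exists>(k::int) (c::real). \<forall>x\<in>{a..b}. h x = 2 powi k * x + c"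
proof -
  have "piecewise_affine h" using assms by (simp add: lifts_def)
  then show thesis unfolding piecewise_affine_def using that by meson
qed

lemma lifts_of_int: "h \<in> lifts \<Longrightarrow> h (x + of_int n) = h x + of_int n"
  by (rule periodic_of_int) (simp add: lifts_def)

lemma lifts_bij: "h \<in> lifts \<Longrightarrow> bij h"
  by (simp add: lifts_def bij_def strict_mono_imp_inj_on)

lemma lifts_less_iff: "h \<in> lifts \<Longrightarrow> h x < h y \<longleftrightarrow> x < y"
  by (simp add: lifts_def strict_mono_less)

lemma lifts_le_iff: "h \<in> lifts \<Longrightarrow> h x \<le> h y \<longleftrightarrow> x \<le> y"
  by (simp add: lifts_def strict_mono_less_eq)

lemma finv_apply [simp]: "h \<in> lifts \<Longrightarrow> h (finv h x) = x" "h \<in> lifts \<Longrightarrow> finv h (h x) = x"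
  using lifts_bij by (simp_all add: bij_is_surj surj_f_inv_f bij_is_inj)

lemma lifts_continuous: "h \<in> lifts \<Longrightarrow> continuous_on A h"
  by (rule continuous_on_subset[of UNIV], rule continuous_onI_mono) (auto simp: lifts_le_iff lifts_def)

lemma affine_piece_dyadic:
  assumes h: "h \<in> lifts" and ab: "a < b" and kc: "\<And>t. t \<in> {a..b} \<Longrightarrow> h t = 2 powi k * t + c"
  shows "c \<in> dyadics"
proof -
  obtain t where t: "t \<in> dyadics" "a < t" "t < b" using dyadics_dense ab by blast
  have "h t \<in> dyadics" using t(1) h by (auto simp: lifts_def)
  then have "h t - 2 powi k * t \<in> dyadics" using t(1) by simp
  then show ?thesis using kc[of t] t by simp
qed

text \<open>Only that dyadic points go to dyadic points is required of a lift. The converse holds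
  since on an affine piece starting at \<open>x\<close> the equation \<open>h x = 2^k x + c\<close>
  can be solved for \<open>x\<close>, and \<open>c\<close> is dyadic.\<close>

lemma lifts_dyadic_iff:
  assumes h: "h \<in> lifts" shows "h x \<in> dyadics \<longleftrightarrow> x \<in> dyadics"
proof
  assume hx: "h x \<in> dyadics"
  obtain B where B: "\<And>p q. finite (B \<inter> {p..q})"
    "\<And>a b. a < b \<Longrightarrow> {a<..<b} \<inter> B = {} \<Longrightarrow> (\<exists>(k::int) (c::real). \<forall>x\<in>{a..b}. h x = 2 powi k * x + c)"
    using lifts_pieces[OF h] by metis
  \<comment> \<open>The next breakpoint after \<open>x\<close>; the point \<open>x + 1\<close> keeps
    the set nonempty if none is near.\<close>
  let ?B = "insert (x + 1) (B \<inter> {x..x+1} \<inter> {x<..})"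
  define b where "b = Min ?B"
  have fin: "finite ?B" using B(1) by simp
  have b: "b \<in> ?B" unfolding b_def using fin by (intro Min_in) auto
  then have xb: "x < b" "b \<le> x + 1" by auto
  have "{x<..<b} \<inter> B = {}"
  proof (rule ccontr)
    assume "\<not> ?thesis"
    then obtain y where y: "y \<in> B" "x < y" "y < b" by auto
    then have "y \<in> ?B" using xb by auto
    then show False using y fin Min_le[of ?B y] unfolding b_def by linarith
  qed
  then obtain k c where kc: "\<And>t. t \<in> {x..b} \<Longrightarrow> h t = 2 powi k * t + c"
    using B(2) xb(1) by blast
  then have c: "c \<in> dyadics" by (intro affine_piece_dyadic[OF h xb(1)])
  have "x = 2 powi (- k) * (h x - c)"
    using kc[of x] xb by (simp add: power_int_minus)
  then show "x \<in> dyadics" using hx c by (metis dyadics_diff dyadics_mult dyadics_power_int)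
qed (use h in \<open>auto simp: lifts_def\<close>)

lemma translation_lifts:
  assumes "a \<in> dyadics" shows "(\<lambda>x. x + a) \<in> lifts"
proof -
  have "piecewise_affine (\<lambda>x. x + a)"
    unfolding piecewise_affine_def
    by (intro exI[of _ "{}"]) (auto intro!: exI[of _ "0::int"] exI[of _ a])
  moreover have "surj (\<lambda>x. x + a)" by (rule surjI[where f = "\<lambda>x. x - a"]) simp
  ultimately show ?thesis using assms by (auto simp: lifts_def strict_mono_def)
qed

lemma id_lifts: "id \<in> lifts"
  using translation_lifts[OF dyadics_0] by (simp add: id_def)

text \<open>The breakpoints of the composition are among those of \<open>g\<close> and the preimages
  under \<open>g\<close> of those of \<open>f\<close>; the latter are dyadic because
  \<open>g\<close> also reflects dyadic points.\<close>

lemma lifts_comp: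
  assumes f: "f \<in> lifts" and g: "g \<in> lifts" shows "f \<circ> g \<in> lifts"
proof -
  obtain B where B: "B \<subseteq> dyadics" "\<And>p q. finite (B \<inter> {p..q})"
    "\<And>a b. a < b \<Longrightarrow> {a<..<b} \<inter> B = {} \<Longrightarrow> (\<exists>(k::int) (c::real). \<forall>x\<in>{a..b}. f x = 2 powi k * x + c)"
    using lifts_pieces[OF f] by metis
  obtain B' where B': "B' \<subseteq> dyadics" "\<And>p q. finite (B' \<inter> {p..q})"
    "\<And>a b. a < b \<Longrightarrow> {a<..<b} \<inter> B' = {} \<Longrightarrow> (\<exists>(k::int) (c::real). \<forall>x\<in>{a..b}. g x = 2 powi k * x + c)"
    using lifts_pieces[OF g] by metis
  have "piecewise_affine (f \<circ> g)"
    unfolding piecewise_affine_def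
  proof (intro exI[of _ "B' \<union> g -` B"] conjI allI impI)
    show "B' \<union> g -` B \<subseteq> dyadics"
      using B(1) B'(1) lifts_dyadic_iff[OF g] by auto
    fix p q :: real
    have sub: "g -` B \<inter> {p..q} \<subseteq> g -` (B \<inter> {g p..g q})" using g by (auto simp: lifts_le_iff)
    have "finite (g -` (B \<inter> {g p..g q}))"
      using B(2) lifts_bij[OF g] by (intro finite_vimageI) (auto simp: bij_is_inj)
    from finite_subset[OF sub this] show "finite ((B' \<union> g -` B) \<inter> {p..q})"
      using B'(2) by (simp add: Int_Un_distrib2)
  next
    fix a b assume ab: "a < b \<and> {a<..<b} \<inter> (B' \<union> g -` B) = {}"
    then obtain k c where kc: "\<And>x. x \<in> {a..b} \<Longrightarrow> g x = 2 powi k * x + c"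
      using B'(3)[of a b] by blast
    have "y \<notin> B" if y: "y \<in> {g a<..<g b}" for y
    proof
      assume "y \<in> B"
      have "a < finv g y" "finv g y < b"
        using y lifts_less_iff[OF g, of a "finv g y"] lifts_less_iff[OF g, of "finv g y" b] g by auto
      then have "finv g y \<in> {a<..<b} \<inter> (g -` B)" using \<open>y \<in> B\<close> g by auto
      then show False using ab by blast
    qed
    then have "{g a<..<g b} \<inter> B = {}" by blast
    then obtain k' c' where kc': "\<And>x. x \<in> {g a..g b} \<Longrightarrow> f x = 2 powi k' * x + c'"
      using B(3)[of "g a" "g b"] ab lifts_less_iff[OF g, of a b] by blast
    have "(f \<circ> g) x = 2 powi (k' + k) * x + (2 powi k' * c + c')" if "x \<in> {a..b}" for x
    proof -
      have "f (g x) = 2 powi k' * g x + c'" using kc'[of "g x"] that lifts_le_iff[OF g] by simp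
      then show ?thesis using kc[OF that] by (simp add: power_int_add algebra_simps)
    qed
    then show "\<exists>(k::int) (c::real). \<forall>x\<in>{a..b}. (f \<circ> g) x = 2 powi k * x + c" by blast
  qed
  moreover have "f (g x) \<in> dyadics" if "x \<in> dyadics" for x
    using that f g by (simp add: lifts_dyadic_iff)
  moreover have "surj (f \<circ> g)"
    using bij_comp[OF lifts_bij[OF g] lifts_bij[OF f]] by (rule bij_is_surj)
  ultimately show ?thesis
    using f g by (simp add: lifts_def strict_mono_def image_subset_iff)
qed

lemma lifts_finv:
  assumes h: "h \<in> lifts" shows "finv h \<in> lifts"
proof -
  have less: "finv h x < finv h y \<longleftrightarrow> x < y" for x y
    using lifts_less_iff[OF h, of "finv h x" "finv h y"] h by simp
  have le: "finv h x \<le> finv h y \<longleftrightarrow> x \<le> y" for x y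
    using lifts_le_iff[OF h, of "finv h x" "finv h y"] h by simp
  obtain B where B: "B \<subseteq> dyadics" "\<And>p q. finite (B \<inter> {p..q})"
    "\<And>a b. a < b \<Longrightarrow> {a<..<b} \<inter> B = {} \<Longrightarrow> (\<exists>(k::int) (c::real). \<forall>x\<in>{a..b}. h x = 2 powi k * x + c)"
    using lifts_pieces[OF h] by metis
  have "piecewise_affine (finv h)"
    unfolding piecewise_affine_def
  proof (intro exI[of _ "h ` B"] conjI allI impI)
    show "h ` B \<subseteq> dyadics" using B(1) lifts_dyadic_iff[OF h] by auto
    fix p q :: real
    have "h ` B \<inter> {p..q} \<subseteq> h ` (B \<inter> {finv h p..finv h q})"
    proof
      fix y assume "y \<in> h ` B \<inter> {p..q}"
      then obtain x where x: "x \<in> B" "y = h x" "p \<le> h x" "h x \<le> q" by auto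
      then have "finv h p \<le> x" "x \<le> finv h q" using le[of p "h x"] le[of "h x" q] h by simp_all
      then show "y \<in> h ` (B \<inter> {finv h p..finv h q})" using x by auto
    qed
    then show "finite (h ` B \<inter> {p..q})" using finite_subset[OF _ finite_imageI[OF B(2)]] by blast
  next
    fix a b assume ab: "a < b \<and> {a<..<b} \<inter> h ` B = {}"
    have "x \<notin> B" if x: "x \<in> {finv h a<..<finv h b}" for x
    proof
      assume "x \<in> B"
      moreover have "h x \<in> {a<..<b}"
        using x lifts_less_iff[OF h, of "finv h a" x] lifts_less_iff[OF h, of x "finv h b"] h by auto
      ultimately show False using ab by blast
    qed
    then have "{finv h a<..<finv h b} \<inter> B = {}" by blast
    moreover have "finv h a < finv h b" using ab less by simp
    ultimately have "\<exists>(k::int) (c::real). \<forall>x\<in>{finv h a..finv h b}. h x = 2 powi k * x + c"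
      by (intro B(3))
    then obtain k c where kc: "\<And>x. x \<in> {finv h a..finv h b} \<Longrightarrow> h x = 2 powi k * x + c"
      by blast
    have "finv h y = 2 powi (- k) * y + (- (2 powi (- k) * c))" if y: "y \<in> {a..b}" for y
    proof -
      have "finv h y \<in> {finv h a..finv h b}" using y le by simp
      from kc[OF this] have "y - c = 2 powi k * finv h y" unfolding finv_apply(1)[OF h] by linarith
      then have "2 powi (- k) * (y - c) = 2 powi (- k) * (2 powi k * finv h y)" by (simp only:)
      also have "\<dots> = finv h y" by (simp add: power_int_minus)
      finally have "finv h y = 2 powi (- k) * (y - c)" by simp
      then show ?thesis by (simp add: algebra_simps)
    qed
    then show "\<exists>(k::int) (c::real). \<forall>x\<in>{a..b}. finv h x = 2 powi k * x + c" by blast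
  qed
  moreover have "finv h (x + 1) = finv h x + 1" for x
  proof -
    have "h (finv h x + 1) = x + 1" using lifts_of_int[OF h, of "finv h x" 1] h by simp
    then show ?thesis using h by (metis finv_apply(2))
  qed
  moreover have "finv h ` dyadics \<subseteq> dyadics"
  proof clarify
    fix x assume "x \<in> dyadics"
    then show "finv h x \<in> dyadics" using lifts_dyadic_iff[OF h, of "finv h x"] h by simp
  qed
  moreover have "surj (finv h)" using lifts_bij[OF h] by (simp add: bij_imp_bij_inv bij_is_surj)
  ultimately show ?thesis using less by (simp add: lifts_def strict_mono_def)
qed

lemma dyadic_pieces:
  assumes "dyadic_piecewise_affine_on p q f"
  obtains B where "finite B" "B \<subseteq> dyadics"
    "\<And>a b. p \<le> a \<Longrightarrow> a < b \<Longrightarrow> b \<le> q \<Longrightarrow> {a<..<b} \<inter> B = {} \<Longrightarrow>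
      \<exists>(k::int) (c::real). \<forall>x\<in>{a..b}. f x = 2 powi k * x + c"
  using assms unfolding dyadic_piecewise_affine_on_def using that by meson

lemma piecewise_affine_periodic:
  assumes per: "\<And>x. h (x + 1) = h x + (1::real)" and h: "dyadic_piecewise_affine_on 0 1 h"
  shows "piecewise_affine h"
proof -
  obtain B where B: "finite B" "B \<subseteq> dyadics"
    "\<And>a b. 0 \<le> a \<Longrightarrow> a < b \<Longrightarrow> b \<le> 1 \<Longrightarrow> {a<..<b} \<inter> B = {} \<Longrightarrow>
      (\<exists>(k::int) (c::real). \<forall>x\<in>{a..b}. h x = 2 powi k * x + c)"
    using dyadic_pieces[OF h] by metis
  \<comment> \<open>Inserting 0 turns every integer into a breakpoint, so that a piece never reaches
    across an integer and can be translated back into the unit interval.\<close>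
  define B' where "B' = (\<lambda>(b, n). b + of_int n) ` ((insert 0 B \<inter> {0..1}) \<times> UNIV)"
  have int: "of_int n \<in> B'" for n
    unfolding B'_def by (rule image_eqI[of _ _ "(0, n)"]) auto
  show ?thesis
    unfolding piecewise_affine_def
  proof (intro exI[of _ B'] conjI allI impI)
    show "B' \<subseteq> dyadics" using B(2) by (auto simp: B'_def)
    fix p q :: real
    have "B' \<inter> {p..q} \<subseteq> (\<lambda>(b, n). b + of_int n) ` ((insert 0 B \<inter> {0..1}) \<times> {\<lfloor>p\<rfloor> - 1..\<lceil>q\<rceil>})"
    proof
      fix y assume y: "y \<in> B' \<inter> {p..q}"
      then obtain z where "z \<in> (insert 0 B \<inter> {0..1}) \<times> (UNIV :: int set)" "y = (case z of (b, n) \<Rightarrow> b + of_int n)"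
        unfolding B'_def by blast
      then obtain b n where "b \<in> insert 0 B \<inter> {0..1}" "y = b + of_int n" "p \<le> b + of_int n" "b + of_int n \<le> q"
        using y by (cases z) auto
      moreover from this have "n \<in> {\<lfloor>p\<rfloor> - 1..\<lceil>q\<rceil>}" by simp linarith
      ultimately show "y \<in> (\<lambda>(b, n). b + of_int n) ` ((insert 0 B \<inter> {0..1}) \<times> {\<lfloor>p\<rfloor> - 1..\<lceil>q\<rceil>})"
        by (intro image_eqI[of _ _ "(b, n)"]) auto
    qed
    then show "finite (B' \<inter> {p..q})"
      using B(1) by (elim finite_subset) auto
  next
    fix a b assume ab: "a < b \<and> {a<..<b} \<inter> B' = {}"
    define n where "n = \<lfloor>a\<rfloor>"
    have n: "of_int n \<le> a" "a < of_int n + 1" unfolding n_def by linarith+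
    have "b \<le> of_int n + 1"
    proof (rule ccontr)
      assume "\<not> ?thesis"
      then have "of_int (n + 1) \<in> {a<..<b}" using n by simp
      then show False using ab int by blast
    qed
    moreover have "{a - of_int n<..<b - of_int n} \<inter> B = {}"
    proof (rule ccontr)
      assume "\<not> ?thesis"
      then obtain x where x: "x \<in> B" "a - of_int n < x" "x < b - of_int n" by auto
      then have "x \<in> {0..1}" using n \<open>b \<le> of_int n + 1\<close> by auto
      then have "x + of_int n \<in> B'" unfolding B'_def using x by (intro image_eqI[of _ _ "(x, n)"]) auto
      moreover have "x + of_int n \<in> {a<..<b}" using x by (simp add: less_diff_eq diff_less_eq)
      ultimately show False using ab by blast
    qed
    ultimately obtain k c where kc: "\<And>x. x \<in> {a - of_int n..b - of_int n} \<Longrightarrow> h x = 2 powi k * x + c"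
      using B(3)[of "a - of_int n" "b - of_int n"] n ab by auto
    have "h x = 2 powi k * x + (c + of_int n - 2 powi k * of_int n)" if "x \<in> {a..b}" for x
    proof -
      have "h x = h (x - of_int n) + of_int n"
        using periodic_of_int[of h "x - of_int n" n] per by simp
      then show ?thesis using kc[of "x - of_int n"] that by (simp add: algebra_simps)
    qed
    then show "\<exists>(k::int) (c::real). \<forall>x\<in>{a..b}. h x = 2 powi k * x + c" by blast
  qed
qed

lemma lifts_piecewise_affine_on:
  assumes "h \<in> lifts" "\<And>x. x \<in> {0..1} \<Longrightarrow> f x = h x"
  shows "dyadic_piecewise_affine_on 0 1 f"
proof -
  obtain B where B: "B \<subseteq> dyadics" "\<And>p q. finite (B \<inter> {p..q})"
    "\<And>a b. a < b \<Longrightarrow> {a<..<b} \<inter> B = {} \<Longrightarrow> (\<exists>(k::int) (c::real). \<forall>x\<in>{a..b}. h x = 2 powi k * x + c)"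
    using lifts_pieces[OF assms(1)] by metis
  show ?thesis
    unfolding dyadic_piecewise_affine_on_def
  proof (intro exI[of _ "B \<inter> {0..1}"] conjI allI impI)
    fix a b assume ab: "0 \<le> a \<and> a < b \<and> b \<le> 1 \<and> {a<..<b} \<inter> (B \<inter> {0..1}) = {}"
    then have "{a<..<b} \<inter> B = {}" by auto
    then show "\<exists>(k::int) (c::real). \<forall>x\<in>{a..b}. f x = 2 powi k * x + c"
      using B(3)[of a b] ab assms(2) by auto
  qed (use B in auto)
qed

text \<open>The definition of F does not speak of images of dyadic points. They are dyadic because 0
  is fixed and \<open>f x - f b = 2^k (x - b)\<close> from one breakpoint to the next; the induction
  counts the breakpoints below \<open>x\<close>.\<close>

lemma dyadic_piecewise_affine_on_dyadic:
  assumes f: "dyadic_piecewise_affine_on 0 1 f" "f 0 = 0" and x: "x \<in> dyadics" "0 \<le> x" "x \<le> 1"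
  shows "f x \<in> dyadics"
proof -
  obtain B where B: "finite B" "B \<subseteq> dyadics"
    "\<And>a b. 0 \<le> a \<Longrightarrow> a < b \<Longrightarrow> b \<le> 1 \<Longrightarrow> {a<..<b} \<inter> B = {} \<Longrightarrow>
      (\<exists>(k::int) (c::real). \<forall>x\<in>{a..b}. f x = 2 powi k * x + c)"
    using dyadic_pieces[OF f(1)] by metis
  show ?thesis
    using x
  proof (induction "card (B \<inter> {0<..<x})" arbitrary: x rule: less_induct)
    case less
    let ?B = "insert 0 (B \<inter> {0<..<x})"
    define b where "b = Max ?B"
    have fin: "finite ?B" using B(1) by simp
    have b: "b \<in> ?B" unfolding b_def using fin by (intro Max_in) auto
    show ?case
    proof (cases "x = 0")
      case True
      then show ?thesis using f(2) by simp
    next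
      case False
      then have bx: "0 \<le> b" "b < x" using b less.prems by auto
      have fb: "f b \<in> dyadics"
      proof (cases "b = 0")
        case False
        then have "b \<in> B" "b > 0" using b by auto
        then have "B \<inter> {0<..<b} \<subset> B \<inter> {0<..<x}" using bx by auto
        then have "card (B \<inter> {0<..<b}) < card (B \<inter> {0<..<x})" using B(1) by (intro psubset_card_mono) auto
        then show ?thesis using less.hyps[of b] \<open>b \<in> B\<close> B(2) bx less.prems by auto
      qed (use f(2) in simp)
      have "y \<le> b" if "y \<in> B" "0 < y" "y < x" for y
        unfolding b_def using fin that by (intro Max_ge) auto
      then have "{b<..<x} \<inter> B = {}" using bx by force
      then obtain k c where kc: "\<And>t. t \<in> {b..x} \<Longrightarrow> f t = 2 powi k * t + c"
        using B(3)[of b x] bx less.prems by auto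
      have "f x = f b + 2 powi k * (x - b)"
        using kc[of b] kc[of x] bx by (simp add: algebra_simps)
      moreover have "b \<in> dyadics" using b B(2) by auto
      ultimately show ?thesis using fb less.prems by simp
    qed
  qed
qed

section \<open>The groups F and T\<close>

lemma group_of_maps:
  assumes carrier: "carrier G = r ` L" and one: "\<one>\<^bsub>G\<^esub> = r id" "id \<in> L"
    and mult: "\<And>f g. f \<in> L \<Longrightarrow> g \<in> L \<Longrightarrow> r f \<otimes>\<^bsub>G\<^esub> r g = r (f \<circ> g)"
    and comp: "\<And>f g. f \<in> L \<Longrightarrow> g \<in> L \<Longrightarrow> f \<circ> g \<in> L"
    and inv: "\<And>f. f \<in> L \<Longrightarrow> bij f" "\<And>f. f \<in> L \<Longrightarrow> finv f \<in> L"
  shows "group G"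
proof (rule groupI)
  show "\<one>\<^bsub>G\<^esub> \<in> carrier G" using carrier one by blast
  fix x assume "x \<in> carrier G"
  then obtain f where f: "f \<in> L" "x = r f" unfolding carrier by blast
  show "\<one>\<^bsub>G\<^esub> \<otimes>\<^bsub>G\<^esub> x = x"
    using mult[OF one(2) f(1)] f(2) one(1) by simp
  have "finv f \<circ> f = id" using inv(1)[OF f(1)] by (simp add: bij_is_inj)
  then have "r (finv f) \<otimes>\<^bsub>G\<^esub> x = \<one>\<^bsub>G\<^esub>"
    using mult[OF inv(2)[OF f(1)] f(1)] f(2) one(1) by simp
  then show "\<exists>y\<in>carrier G. y \<otimes>\<^bsub>G\<^esub> x = \<one>\<^bsub>G\<^esub>"
    using inv(2)[OF f(1)] carrier by blast
  fix y assume "y \<in> carrier G"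
  then obtain g where g: "g \<in> L" "y = r g" unfolding carrier by blast
  show "x \<otimes>\<^bsub>G\<^esub> y \<in> carrier G"
    using mult[OF f(1) g(1)] comp[OF f(1) g(1)] carrier f(2) g(2) by simp
  fix z assume "z \<in> carrier G"
  then obtain h where h: "h \<in> L" "z = r h" unfolding carrier by blast
  show "x \<otimes>\<^bsub>G\<^esub> y \<otimes>\<^bsub>G\<^esub> z = x \<otimes>\<^bsub>G\<^esub> (y \<otimes>\<^bsub>G\<^esub> z)"
    using f g h by (simp add: mult comp comp_assoc)
qed

lemma lifts_homeomorphism:
  assumes h: "h \<in> lifts" shows "homeomorphism UNIV UNIV h (finv h)"
  using h lifts_continuous[OF h] lifts_continuous[OF lifts_finv[OF h]]
  by (auto simp: homeomorphism_def lifts_def) (metis finv_apply(2) h rangeI)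

text \<open>The periodic extensions of the elements of F; restriction to the unit interval and
  \<open>periodic_extension\<close> are inverse to each other.\<close>

definition fixing_lifts :: "(real \<Rightarrow> real) set" where
  "fixing_lifts = {h \<in> lifts. h 0 = 0}"

lemma fixing_lifts_finv: "h \<in> fixing_lifts \<Longrightarrow> finv h \<in> fixing_lifts"
  unfolding fixing_lifts_def using lifts_finv by (auto, metis finv_apply(2))

lemma fixing_lifts_comp: "f \<in> fixing_lifts \<Longrightarrow> g \<in> fixing_lifts \<Longrightarrow> f \<circ> g \<in> fixing_lifts"
  unfolding fixing_lifts_def using lifts_comp by auto

lemma fixing_lifts_1: "h \<in> fixing_lifts \<Longrightarrow> h 1 = 1"
  using lifts_of_int[of h 0 1] by (simp add: fixing_lifts_def)

lemma fixing_lifts_unit: "h \<in> fixing_lifts \<Longrightarrow> h x \<in> {0..1} \<longleftrightarrow> x \<in> {0..1}"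
  using lifts_le_iff[of h 0 x] lifts_le_iff[of h x 1] fixing_lifts_1[of h] by (simp add: fixing_lifts_def)

lemma fixing_lifts_bij_betw: "h \<in> fixing_lifts \<Longrightarrow> bij_betw h {0..1} {0..1}"
  by (rule bij_betw_byWitness[where f' = "finv h"])
    (use fixing_lifts_unit fixing_lifts_finv in \<open>auto simp: fixing_lifts_def image_subset_iff\<close>)

lemma restrict_in_F:
  assumes h: "h \<in> fixing_lifts" shows "restrict h {0..1} \<in> carrier thompson_F"
proof -
  have l: "h \<in> lifts" using h by (simp add: fixing_lifts_def)
  have "homeomorphism {0..1} {0..1} (restrict h {0..1}) (finv h)"
    unfolding homeomorphism_def
  proof (intro conjI ballI)
    show "continuous_on {0..1} (restrict h {0..1})"
      by (rule continuous_on_eq[OF lifts_continuous[OF l]]) simp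
    show "continuous_on {0..1} (finv h)"
      using lifts_continuous[OF lifts_finv[OF l]] .
    show "restrict h {0..1} ` {0..1} = {0..1}"
      using fixing_lifts_bij_betw[OF h] by (simp add: bij_betw_def)
    show "finv h ` {0..1} = {0..1}"
      using fixing_lifts_bij_betw[OF fixing_lifts_finv[OF h]] by (simp add: bij_betw_def)
  qed (use l fixing_lifts_unit[OF fixing_lifts_finv[OF h]] in auto)
  moreover have "strict_mono_on {0..1} (restrict h {0..1})"
    using l by (auto simp: strict_mono_on_def lifts_less_iff)
  moreover have "dyadic_piecewise_affine_on 0 1 (restrict h {0..1})"
    by (rule lifts_piecewise_affine_on[OF l]) simp
  moreover have "bij_betw (restrict h {0..1}) {0..1} {0..1}"
    using fixing_lifts_bij_betw[OF h] bij_betw_cong[of "{0..1}" "restrict h {0..1}" h "{0..1}"] by simp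
  ultimately show ?thesis
    by (auto simp: thompson_F_def Bij_def)
qed

definition periodic_extension :: "(real \<Rightarrow> real) \<Rightarrow> real \<Rightarrow> real" where
  "periodic_extension f x = of_int \<lfloor>x\<rfloor> + f (x - of_int \<lfloor>x\<rfloor>)"

lemma F_endpoints:
  assumes "f \<in> carrier thompson_F" shows "f 0 = 0" "f 1 = 1"
proof -
  have f: "bij_betw f {0..1} {0..1}" "strict_mono_on {0..1} f"
    using assms by (auto simp: thompson_F_def Bij_def)
  have r: "f x \<in> {0..1}" if "x \<in> {0..1}" for x using f(1) that by (metis bij_betwE)
  have le: "x \<in> {0..1} \<Longrightarrow> y \<in> {0..1} \<Longrightarrow> x \<le> y \<Longrightarrow> f x \<le> f y" for x y
    using f(2) by (metis strict_mono_onD order_le_less)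
  obtain x where x: "x \<in> {0..1}" "f x = 0" using f(1) by (metis atLeastAtMost_iff bij_betw_iff_bijections order_refl zero_le_one)
  obtain y where y: "y \<in> {0..1}" "f y = 1" using f(1) by (metis atLeastAtMost_iff bij_betw_iff_bijections order_refl zero_le_one)
  show "f 0 = 0" using le[of 0 x] x r[of 0] by auto
  show "f 1 = 1" using le[of y 1] y r[of 1] by auto
qed

lemma frac_range: "x - of_int \<lfloor>x\<rfloor> \<in> {0..<1::real}"
  by simp linarith

lemma periodic_extension_eq:
  assumes "f \<in> carrier thompson_F" "x \<in> {0..1}" shows "periodic_extension f x = f x"
proof (cases "x = 1")
  case False
  then have "\<lfloor>x\<rfloor> = 0" using assms(2) by (simp add: floor_eq_iff)
  then show ?thesis by (simp add: periodic_extension_def)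
qed (use F_endpoints[OF assms(1)] in \<open>simp add: periodic_extension_def\<close>)

lemma periodic_extension_lift:
  assumes F: "f \<in> carrier thompson_F" shows "periodic_extension f \<in> fixing_lifts"
proof -
  let ?h = "periodic_extension f"
  have f: "bij_betw f {0..1} {0..1}" "strict_mono_on {0..1} f" "dyadic_piecewise_affine_on 0 1 f"
    using F by (auto simp: thompson_F_def Bij_def)
  have r: "f x \<in> {0..<1}" if "x \<in> {0..<1}" for x
    using that f(1) strict_mono_onD[OF f(2), of x 1] F_endpoints[OF F] bij_betwE[OF f(1)] by auto
  have per: "?h (x + 1) = ?h x + 1" for x by (simp add: periodic_extension_def)
  have "strict_mono ?h"
  proof (rule strict_monoI)
    fix x y :: real assume xy: "x < y"
    show "?h x < ?h y"
    proof (cases "\<lfloor>x\<rfloor> = \<lfloor>y\<rfloor>")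
      case True
      then show ?thesis
        using strict_mono_onD[OF f(2), of "x - of_int \<lfloor>x\<rfloor>" "y - of_int \<lfloor>y\<rfloor>"] xy frac_range[of x] frac_range[of y]
        by (auto simp: periodic_extension_def)
    next
      case False
      then have "\<lfloor>x\<rfloor> + 1 \<le> \<lfloor>y\<rfloor>" using xy floor_mono[of x y] by simp
      then have "of_int \<lfloor>x\<rfloor> + 1 \<le> (of_int \<lfloor>y\<rfloor> :: real)" by linarith
      then show ?thesis using r[OF frac_range[of x]] r[OF frac_range[of y]]
        by (simp add: periodic_extension_def)
    qed
  qed
  moreover have "surj ?h"
  proof (rule surjI)
    fix y :: real
    let ?z = "inv_into {0..1} f (y - of_int \<lfloor>y\<rfloor>)"
    have y: "y - of_int \<lfloor>y\<rfloor> \<in> {0..1}" "y - of_int \<lfloor>y\<rfloor> \<noteq> 1" using frac_range[of y] by auto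
    have z: "?z \<in> {0..1}" "f ?z = y - of_int \<lfloor>y\<rfloor>"
    proof -
      have "y - of_int \<lfloor>y\<rfloor> \<in> f ` {0..1}" using y(1) f(1) by (simp only: bij_betw_def)
      then show "?z \<in> {0..1}" "f ?z = y - of_int \<lfloor>y\<rfloor>"
        by (rule inv_into_into, rule f_inv_into_f)
    qed
    then have "?z \<noteq> 1" using y F_endpoints[OF F] by auto
    then have "\<lfloor>of_int \<lfloor>y\<rfloor> + ?z\<rfloor> = \<lfloor>y\<rfloor>" using z(1) by (simp add: floor_eq_iff)
    then show "?h (of_int \<lfloor>y\<rfloor> + ?z) = y" using z by (simp add: periodic_extension_def)
  qed
  moreover have "?h ` dyadics \<subseteq> dyadics"
  proof clarify
    fix x assume "x \<in> dyadics"
    then have "f (x - of_int \<lfloor>x\<rfloor>) \<in> dyadics"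
      using dyadic_piecewise_affine_on_dyadic[OF f(3) F_endpoints(1)[OF F]] frac_range[of x] by auto
    then show "?h x \<in> dyadics" by (simp add: periodic_extension_def)
  qed
  moreover have "piecewise_affine ?h"
  proof (rule piecewise_affine_periodic[of ?h])
    show "?h (x + 1) = ?h x + 1" for x by (rule per)
    show "dyadic_piecewise_affine_on 0 1 ?h"
      using f(3) periodic_extension_eq[OF F] unfolding dyadic_piecewise_affine_on_def
      by (auto elim!: ex_forward simp: Ball_def)
  qed
  ultimately show ?thesis
    using per F_endpoints[OF F] by (simp add: fixing_lifts_def lifts_def periodic_extension_def)
qed

lemma restrict_periodic_extension:
  assumes F: "f \<in> carrier thompson_F" shows "restrict (periodic_extension f) {0..1} = f"
proof
  fix x
  have "f \<in> extensional {0..1}" using F by (simp add: thompson_F_def Bij_def)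
  then show "restrict (periodic_extension f) {0..1} x = f x"
    using periodic_extension_eq[OF F] by (auto simp: extensional_def)
qed

lemma periodic_extension_restrict:
  assumes h: "h \<in> fixing_lifts" shows "periodic_extension (restrict h {0..1}) = h"
proof
  fix x
  have "restrict h {0..1} (x - of_int \<lfloor>x\<rfloor>) = h (x - of_int \<lfloor>x\<rfloor>)"
    using frac_range[of x] by auto
  then show "periodic_extension (restrict h {0..1}) x = h x"
    using lifts_of_int[of h "x - of_int \<lfloor>x\<rfloor>" "\<lfloor>x\<rfloor>"] h by (simp add: periodic_extension_def fixing_lifts_def)
qed

lemma carrier_F: "carrier thompson_F = (\<lambda>h. restrict h {0..1}) ` fixing_lifts"
proof (intro equalityI subsetI)
  fix f assume "f \<in> carrier thompson_F"
  then show "f \<in> (\<lambda>h. restrict h {0..1}) ` fixing_lifts"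
    using restrict_periodic_extension periodic_extension_lift by (metis image_eqI)
qed (use restrict_in_F in blast)

lemma F_mult:
  assumes "f \<in> fixing_lifts" "g \<in> fixing_lifts"
  shows "restrict f {0..1} \<otimes>\<^bsub>thompson_F\<^esub> restrict g {0..1} = restrict (f \<circ> g) {0..1}"
proof -
  have "restrict f {0..1} \<in> Bij {0..1}" "restrict g {0..1} \<in> Bij {0..1}"
    using restrict_in_F assms by (auto simp: thompson_F_def)
  then have "restrict f {0..1} \<otimes>\<^bsub>thompson_F\<^esub> restrict g {0..1} = compose {0..1} (restrict f {0..1}) (restrict g {0..1})"
    by (simp add: thompson_F_def BijGroup_def)
  also have "\<dots> = restrict (f \<circ> g) {0..1}"
    using fixing_lifts_unit[OF assms(2)] by (auto simp: compose_def fun_eq_iff)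
  finally show ?thesis .
qed

lemma F_one: "\<one>\<^bsub>thompson_F\<^esub> = restrict id {0..1}"
  by (simp add: thompson_F_def BijGroup_def fun_eq_iff)

lemma id_fixing: "id \<in> fixing_lifts"
  by (simp add: fixing_lifts_def id_lifts)

interpretation F: group thompson_F
  by (rule group_of_maps[OF carrier_F])
    (use F_mult F_one id_fixing fixing_lifts_comp fixing_lifts_finv in \<open>auto simp: fixing_lifts_def lifts_bij\<close>)

section \<open>Maps of the circle induced by lifts\<close>

lemma circle_proj_eq_iff: "circle_proj x = circle_proj y \<longleftrightarrow> x - y \<in> \<int>"
proof
  assume "circle_proj x = circle_proj y"
  then have "x \<in> circle_proj y" by (auto simp: circle_proj_def)
  then show "x - y \<in> \<int>" by (simp add: circle_proj_def)
next
  assume xy: "x - y \<in> \<int>"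
  have "z - x \<in> \<int> \<longleftrightarrow> z - y \<in> \<int>" for z
    using Ints_add[OF _ xy, of "z - x"] Ints_diff[OF _ xy, of "z - y"] by auto
  then show "circle_proj x = circle_proj y" by (auto simp: circle_proj_def)
qed

lemma circle_proj_add_int [simp]: "circle_proj (x + of_int n) = circle_proj x"
  by (simp add: circle_proj_eq_iff)

lemma circle_proj_in_circle [simp]: "circle_proj x \<in> circle"
  by (simp add: circle_def)

lemma circle_proj_eq_unit: 
  assumes "circle_proj x = circle_proj y" "0 \<le> x" "x < 1" "0 \<le> y" "y < 1" shows "x = y"
proof -
  obtain n where "x - y = of_int n" using assms(1) by (auto simp: circle_proj_eq_iff elim: Ints_cases)
  moreover from this have "n = 0" using assms by linarith
  ultimately show ?thesis by simp
qed

text \<open>A coset has no distinguished representative, so one is chosen;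
  \<open>circle_map_proj\<close> shows that the choice does not matter for lifts. The domain is
  restricted because elements of \<open>Bij circle\<close> are extensional functions.\<close>

definition circle_map :: "(real \<Rightarrow> real) \<Rightarrow> real set \<Rightarrow> real set" where
  "circle_map h = (\<lambda>c\<in>circle. circle_proj (h (SOME x. c = circle_proj x)))"

lemma circle_map_proj [simp]:
  assumes "h \<in> lifts" shows "circle_map h (circle_proj x) = circle_proj (h x)"
proof -
  have "circle_proj x = circle_proj (SOME y. circle_proj x = circle_proj y)" by (rule someI[of _ x]) simp
  then have "x - (SOME y. circle_proj x = circle_proj y) \<in> \<int>" by (simp only: circle_proj_eq_iff)
  then obtain n where "x - (SOME y. circle_proj x = circle_proj y) = of_int n" by (auto elim: Ints_cases)
  then have "(SOME y. circle_proj x = circle_proj y) = x + of_int (- n)" by simp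
  then have "h (SOME y. circle_proj x = circle_proj y) = h x + of_int (- n)"
    using lifts_of_int[OF assms] by presburger
  then show ?thesis
    unfolding circle_map_def using circle_proj_add_int[of "h x" "- n"] by simp
qed

lemma circle_map_eqI:
  assumes "f \<in> extensional circle" "h \<in> lifts" "\<And>x. f (circle_proj x) = circle_proj (h x)"
  shows "f = circle_map h"
proof
  fix c show "f c = circle_map h c"
  proof (cases "c \<in> circle")
    case True
    then obtain x where "c = circle_proj x" by (auto simp: circle_def)
    then show ?thesis using assms by simp
  qed (use assms(1) in \<open>auto simp: extensional_def circle_map_def\<close>)
qed

lemma circle_map_in_T:
  assumes h: "h \<in> lifts" shows "circle_map h \<in> carrier thompson_T"
proof -
  have "bij_betw (circle_map h) circle circle"
  proof (rule bij_betw_byWitness[where f' = "circle_map (finv h)"])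
    show "\<forall>c\<in>circle. circle_map (finv h) (circle_map h c) = c"
      "\<forall>c\<in>circle. circle_map h (circle_map (finv h) c) = c"
      using h lifts_finv[OF h] by (auto simp: circle_def)
    show "circle_map h ` circle \<subseteq> circle" "circle_map (finv h) ` circle \<subseteq> circle"
      using h lifts_finv[OF h] by (auto simp: circle_def)
  qed
  then have B: "circle_map h \<in> Bij circle" by (simp add: Bij_def circle_map_def)
  have "\<exists>g. homeomorphism UNIV UNIV h g" using lifts_homeomorphism[OF h] by blast
  moreover have "dyadic_piecewise_affine_on 0 1 h" by (rule lifts_piecewise_affine_on[OF h]) simp
  moreover have "strict_mono h" "\<And>x. h (x + 1) = h x + 1" "h ` dyadics \<subseteq> dyadics"
    using h by (simp_all add: lifts_def)
  ultimately have "\<exists>h'. (\<forall>x. circle_map h (circle_proj x) = circle_proj (h' x)) \<and>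
      (\<exists>g. homeomorphism UNIV UNIV h' g) \<and> strict_mono h' \<and> (\<forall>x. h' (x + 1) = h' x + 1) \<and>
      dyadic_piecewise_affine_on 0 1 h' \<and> h' ` dyadics \<subseteq> dyadics"
    by (intro exI[of _ h]) (simp add: circle_map_proj[OF h])
  then show ?thesis
    using B by (simp add: thompson_T_def)
qed

lemma carrier_T: "carrier thompson_T = circle_map ` lifts"
proof (intro equalityI subsetI)
  fix f assume "f \<in> carrier thompson_T"
  then obtain h where f: "f \<in> Bij circle" "\<And>x. f (circle_proj x) = circle_proj (h x)"
    and h: "\<exists>g. homeomorphism UNIV UNIV h g" "strict_mono h" "\<And>x. h (x + 1) = h x + 1"
      "dyadic_piecewise_affine_on 0 1 h" "h ` dyadics \<subseteq> dyadics"
    by (auto simp: thompson_T_def)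
  have "surj h" using h(1) by (auto simp: homeomorphism_def)
  then have "h \<in> lifts"
    using h piecewise_affine_periodic[OF h(3,4)] by (simp add: lifts_def)
  then show "f \<in> circle_map ` lifts"
    using f circle_map_eqI[of f h] by (auto simp: Bij_def)
qed (use circle_map_in_T in blast)

lemma T_mult:
  assumes "f \<in> lifts" "g \<in> lifts"
  shows "circle_map f \<otimes>\<^bsub>thompson_T\<^esub> circle_map g = circle_map (f \<circ> g)"
proof -
  have "circle_map f \<in> Bij circle" "circle_map g \<in> Bij circle"
    using circle_map_in_T assms by (auto simp: thompson_T_def)
  then have "circle_map f \<otimes>\<^bsub>thompson_T\<^esub> circle_map g = compose circle (circle_map f) (circle_map g)"
    by (simp add: thompson_T_def BijGroup_def)
  also have "\<dots> = circle_map (f \<circ> g)"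
    using assms lifts_comp[OF assms] by (intro circle_map_eqI) (auto simp: compose_def)
  finally show ?thesis .
qed

lemma T_one: "\<one>\<^bsub>thompson_T\<^esub> = circle_map id"
  using id_lifts by (intro circle_map_eqI) (auto simp: thompson_T_def BijGroup_def)

interpretation T: group thompson_T
  by (rule group_of_maps[OF carrier_T])
    (use T_mult T_one id_lifts lifts_comp lifts_finv lifts_bij in auto)

definition F_to_T :: "(real \<Rightarrow> real) \<Rightarrow> real set \<Rightarrow> real set" where
  "F_to_T f = circle_map (periodic_extension f)"

lemma F_to_T_restrict: "h \<in> fixing_lifts \<Longrightarrow> F_to_T (restrict h {0..1}) = circle_map h"
  by (simp add: F_to_T_def periodic_extension_restrict)

lemma F_to_T_proj:
  assumes "f \<in> carrier thompson_F" "x \<in> {0..1}"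
  shows "F_to_T f (circle_proj x) = circle_proj (f x)"
  using periodic_extension_lift[OF assms(1)] periodic_extension_eq[OF assms]
  by (simp add: F_to_T_def fixing_lifts_def)

lemma F_unit: "f \<in> carrier thompson_F \<Longrightarrow> x \<in> {0..<1} \<Longrightarrow> f x \<in> {0..<1}"
proof -
  assume F: "f \<in> carrier thompson_F" and x: "x \<in> {0..<1}"
  then have "strict_mono_on {0..1} f" "bij_betw f {0..1} {0..1}" by (auto simp: thompson_F_def Bij_def)
  then show ?thesis
    using x strict_mono_onD[of "{0..1}" f x 1] F_endpoints[OF F] bij_betwE[of f "{0..1}" "{0..1}"] by auto
qed

lemma F_to_T_mon: "F_to_T \<in> mon thompson_F thompson_T"
  unfolding mon_def hom_def
proof (intro CollectI conjI funcsetI ballI inj_onI)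
  fix x y assume x: "x \<in> carrier thompson_F" and y: "y \<in> carrier thompson_F"
  obtain f where f: "f \<in> fixing_lifts" "x = restrict f {0..1}" using x unfolding carrier_F by blast
  obtain g where g: "g \<in> fixing_lifts" "y = restrict g {0..1}" using y unfolding carrier_F by blast
  show "F_to_T x \<in> carrier thompson_T"
    using f by (simp add: F_to_T_restrict fixing_lifts_def circle_map_in_T)
  show "F_to_T (x \<otimes>\<^bsub>thompson_F\<^esub> y) = F_to_T x \<otimes>\<^bsub>thompson_T\<^esub> F_to_T y"
    unfolding f(2) g(2) F_mult[OF f(1) g(1)]
    using f(1) g(1) fixing_lifts_comp[OF f(1) g(1)] by (simp add: F_to_T_restrict T_mult fixing_lifts_def)
  assume eq: "F_to_T x = F_to_T y"
  \<comment> \<open>The projection is injective on the half-open unit interval, which elements of F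
    preserve. The endpoint 1 is fixed, and outside the closed interval both functions are
    \<open>undefined\<close>.\<close>
  have "x t = y t" for t
  proof (cases "t \<in> {0..<1}")
    case True
    then show ?thesis
      using F_to_T_proj[OF x, of t] F_to_T_proj[OF y, of t] eq F_unit[OF x True] F_unit[OF y True]
        circle_proj_eq_unit[of "x t" "y t"] by auto
  next
    case False
    show ?thesis
    proof (cases "t = 1")
      case True then show ?thesis using F_endpoints x y by metis
    next
      case f: False
      then show ?thesis using False x y by (auto simp: carrier_F)
    qed
  qed
  then show "x = y" by blast
qed

section \<open>The action on binary expansions\<close>

definition binary_value :: "bool stream \<Rightarrow> real" where
  "binary_value s = (\<Sum>n. of_bool (s !! n) / 2 ^ Suc n)"

lemma summable_binary: "summable (\<lambda>n. of_bool (s !! n) / (2::real) ^ Suc n)"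
proof (rule summable_comparison_test')
  show "summable (\<lambda>n. (1 / 2 :: real) ^ Suc n)" using power_half_series sums_summable by blast
  show "norm (of_bool (s !! n) / (2::real) ^ Suc n) \<le> (1 / 2) ^ Suc n" for n
    by (simp add: power_divide)
qed

lemma binary_value_SCons: "binary_value (b ## s) = of_bool b / 2 + binary_value s / 2"
proof -
  have "binary_value (b ## s) = of_bool b / 2 + (\<Sum>n. of_bool ((b ## s) !! Suc n) / 2 ^ Suc (Suc n))"
    unfolding binary_value_def using suminf_split_head[OF summable_binary[of "b ## s"]] by simp
  also have "(\<Sum>n. of_bool ((b ## s) !! Suc n) / 2 ^ Suc (Suc n)) = (\<Sum>n. (of_bool (s !! n) / 2 ^ Suc n) / 2 :: real)"
    by (rule suminf_cong) simp
  also have "\<dots> = binary_value s / 2"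
    unfolding binary_value_def by (rule suminf_divide[OF summable_binary])
  finally show ?thesis .
qed

lemma binary_value_nonneg: "0 \<le> binary_value s"
  unfolding binary_value_def by (rule suminf_nonneg[OF summable_binary]) simp

lemma binary_value_le_1: "binary_value s \<le> 1"
proof -
  have "binary_value s \<le> (\<Sum>n. (1 / 2) ^ Suc n)"
    unfolding binary_value_def using summable_binary power_half_series
    by (intro suminf_le) (auto simp: power_divide sums_iff)
  then show ?thesis using power_half_series by (simp add: sums_iff)
qed

lemma binary_value_stl: "binary_value s = of_bool (shd s) / 2 + binary_value (stl s) / 2"
  using binary_value_SCons[of "shd s" "stl s"] by simp

lemma binary_value_shift:
  "binary_value (u @- s) = (real (bits_value u) + binary_value s) / 2 ^ length u"
  by (induction u) (auto simp: binary_value_SCons horner_sum_append field_simps)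

lemma bits_value_nth:
  assumes "m < 2 ^ n" shows "bits_value (bits n ! m) = m" "length (bits n ! m) = n"
proof -
  show "bits_value (bits n ! m) = m"
    using assms nth_map[of m "bits n" bits_value] by (simp add: map_horner_sum_bits)
  show "length (bits n ! m) = n"
    using assms by (intro length_in_bits nth_mem) simp
qed

lemma snth_ext: "(\<And>n. s !! n = t !! n) \<Longrightarrow> s = t"
  by (metis stream_smap_nats ext)

lemma sdrop_Suc_stl: "sdrop (Suc n) s = stl (sdrop n s)"
  by (rule sdrop_simps(2)[symmetric])

lemma binary_value_eq_1:
  assumes "binary_value s = 1" shows "s = sconst True"
proof -
  have *: "binary_value (sdrop n s) = 1" for n
  proof (induction n)
    case (Suc n)
    then show ?case
      unfolding sdrop_Suc_stl
      using binary_value_stl[of "sdrop n s"] binary_value_le_1[of "stl (sdrop n s)"]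
      by (cases "shd (sdrop n s)") simp_all
  qed (use assms in simp)
  have "shd (sdrop n s)" for n
    using *[of n] binary_value_stl[of "sdrop n s"] binary_value_le_1[of "stl (sdrop n s)"]
    by (cases "shd (sdrop n s)") simp_all
  then show ?thesis
    by (intro snth_ext) (simp add: id_funpow)
qed

lemma binary_value_eq_0:
  assumes "binary_value s = 0" shows "s = sconst False"
proof -
  have *: "binary_value (sdrop n s) = 0" for n
  proof (induction n)
    case (Suc n)
    then show ?case
      unfolding sdrop_Suc_stl
      using binary_value_stl[of "sdrop n s"] binary_value_nonneg[of "stl (sdrop n s)"]
      by (cases "shd (sdrop n s)") simp_all
  qed (use assms in simp)
  have "\<not> shd (sdrop n s)" for n
    using *[of n] binary_value_stl[of "sdrop n s"] binary_value_nonneg[of "stl (sdrop n s)"]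
    by (cases "shd (sdrop n s)") simp_all
  then show ?thesis
    by (intro snth_ext) (simp add: id_funpow)
qed

text \<open>Distinguishes the two expansions of a dyadic point and survives any replacement of a
  prefix, so it tells which expansion of an image point is to be taken.\<close>

definition eventually_True :: "bool stream \<Rightarrow> bool" where
  "eventually_True s \<longleftrightarrow> (\<exists>n. sdrop n s = sconst True)"

lemma eventually_True_SCons [simp]: "eventually_True (b ## s) = eventually_True s"
proof
  assume "eventually_True (b ## s)"
  then obtain n where n: "sdrop n (b ## s) = sconst True" by (auto simp: eventually_True_def)
  show "eventually_True s"
  proof (cases n)
    case 0
    then have "s = stl (sconst True)" using n by (metis sdrop.simps(1) stream.sel(2))
    then have "sdrop 0 s = sconst True" by simp
    then show ?thesis unfolding eventually_True_def by blast
  next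
    case (Suc m)
    then show ?thesis using n by (auto simp: eventually_True_def)
  qed
next
  assume "eventually_True s"
  then obtain n where "sdrop n s = sconst True" by (auto simp: eventually_True_def)
  then have "sdrop (Suc n) (b ## s) = sconst True" by simp
  then show "eventually_True (b ## s)" unfolding eventually_True_def by blast
qed

lemma eventually_True_stl: "eventually_True (stl s) = eventually_True s"
  using eventually_True_SCons[of "shd s" "stl s"] by simp

lemma eventually_True_shift [simp]: "eventually_True (u @- s) = eventually_True s"
  by (induction u) auto

lemma eventually_True_sconst: "eventually_True (sconst b) \<longleftrightarrow> b"
proof
  assume "eventually_True (sconst b)"
  then obtain n where "sdrop n (sconst b) = sconst True" by (auto simp: eventually_True_def)
  then have "shd (sconst b) = shd (sconst True)" by (metis sdrop_siterate id_apply id_funpow)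
  then show b by simp
qed (auto simp: eventually_True_def intro!: exI[of _ 0])

lemma binary_value_less_1: "\<not> eventually_True s \<Longrightarrow> binary_value s < 1"
  using binary_value_eq_1[of s] binary_value_le_1[of s] eventually_True_sconst[of True] by force

lemma binary_value_pos: "eventually_True s \<Longrightarrow> 0 < binary_value s"
  using binary_value_eq_0[of s] binary_value_nonneg[of s] eventually_True_sconst[of False] by force

text \<open>A dyadic rational has exactly two binary expansions, one of them ending in ones.\<close>

lemma binary_value_inj:
  assumes "binary_value s = binary_value t" "eventually_True s = eventually_True t"
  shows "s = t"
proof -
  have *: "shd s = shd t" if "binary_value s = binary_value t" "eventually_True s = eventually_True t" for s t
  proof (rule ccontr)
    have False if "\<not> shd s" "shd t" "binary_value s = binary_value t" "eventually_True s = eventually_True t" for s t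
    proof -
      have "binary_value (stl s) / 2 = 1 / 2 + binary_value (stl t) / 2"
        using that binary_value_stl[of s] binary_value_stl[of t] by simp
      \<comment> \<open>Different first digits leave only the pair 0111... and 1000..., whose tails
        are told apart by \<open>eventually_True\<close>.\<close>
      then have "binary_value (stl s) = 1" "binary_value (stl t) = 0"
        using binary_value_le_1[of "stl s"] binary_value_nonneg[of "stl t"] by linarith+
      then have "eventually_True (stl s)" "\<not> eventually_True (stl t)"
        using binary_value_eq_1 binary_value_eq_0 eventually_True_sconst by metis+
      then show False using that(4) by (simp add: eventually_True_stl)
    qed
    moreover assume "shd s \<noteq> shd t"
    ultimately show False using that by metis
  qed
  have inv: "binary_value (sdrop n s) = binary_value (sdrop n t) \<and>
      eventually_True (sdrop n s) = eventually_True (sdrop n t)" for n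
  proof (induction n)
    case (Suc n)
    then have "shd (sdrop n s) = shd (sdrop n t)" by (intro *) blast+
    then have "of_bool (shd (sdrop n s)) = (of_bool (shd (sdrop n t)) :: real)" by (rule arg_cong)
    then have "binary_value (stl (sdrop n s)) = binary_value (stl (sdrop n t))"
      using Suc binary_value_stl[of "sdrop n s"] binary_value_stl[of "sdrop n t"] by linarith
    then show ?case
      unfolding sdrop_Suc_stl eventually_True_stl using Suc by blast
  qed (use assms in simp)
  show ?thesis
  proof (rule snth_ext)
    show "s !! n = t !! n" for n
      unfolding sdrop_simps(1)[symmetric] using inv[of n] by (intro *) blast+
  qed
qed

lemma circle_of_binary_value: "circle_of_binary s = circle_proj (binary_value s)"
  by (simp add: circle_of_binary_def binary_value_def)

text \<open>Expansions that do not end in ones have values in [0, 1), those that do have values in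
  (0, 1]. Both intervals contain each point of the circle exactly once.\<close>

lemma circle_of_binary_inj:
  assumes "circle_of_binary s = circle_of_binary t" "eventually_True s = eventually_True t"
  shows "s = t"
proof (cases "eventually_True s")
  case False
  then show ?thesis
    using assms circle_proj_eq_unit binary_value_less_1 binary_value_nonneg binary_value_inj
    by (metis circle_of_binary_value)
next
  case True
  then have pos: "0 < binary_value s" "0 < binary_value t" using assms binary_value_pos by auto
  obtain n where n: "binary_value s - binary_value t = of_int n"
    using assms(1) by (auto simp: circle_of_binary_value circle_proj_eq_iff elim: Ints_cases)
  then have "n = 0" using pos binary_value_le_1[of s] binary_value_le_1[of t] by linarith
  then show ?thesis using n assms(2) binary_value_inj by simp
qed

lemma double_or_Suc_double:
  "j = 2 * i \<or> j = 2 * i + 1 \<Longrightarrow> real_of_int j = 2 * of_int i + of_bool (odd j)"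
  by auto

lemma binary_expansion:
  assumes "0 \<le> x" "x < 1" shows "\<exists>s. binary_value s = x"
proof -
  \<comment> \<open>With these digits the partial sum of length \<open>n\<close> is \<open>x\<close>
    rounded down to a multiple of \<open>2^-n\<close>.\<close>
  let ?s = "smap (\<lambda>n. odd \<lfloor>x * 2 ^ Suc n\<rfloor>) nats"
  have partial: "(\<Sum>k<n. of_bool (?s !! k) / 2 ^ Suc k) = of_int \<lfloor>x * 2 ^ n\<rfloor> / (2 ^ n :: real)" for n
  proof (induction n)
    case 0
    have "\<lfloor>x\<rfloor> = 0" using assms by (simp add: floor_eq_iff)
    then show ?case by simp
  next
    case (Suc n)
    let ?i = "\<lfloor>x * 2 ^ n\<rfloor>" and ?j = "\<lfloor>x * 2 ^ Suc n\<rfloor>"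
    have "?j = 2 * ?i \<or> ?j = 2 * ?i + 1"
      using floor_correct[of "x * 2 ^ n"] floor_correct[of "x * 2 ^ Suc n"] by simp linarith
    then have j: "real_of_int ?j = 2 * of_int ?i + of_bool (odd ?j)"
      by (rule double_or_Suc_double)
    have "(\<Sum>k<Suc n. of_bool (?s !! k) / 2 ^ Suc k) = of_int ?i / 2 ^ n + of_bool (odd ?j) / (2 ^ Suc n :: real)"
      using Suc by simp
    also have "\<dots> = (2 * of_int ?i + of_bool (odd ?j)) / 2 ^ Suc n"
      by (simp only: add_divide_distrib power_Suc mult_divide_mult_cancel_left_if) simp
    finally show ?case unfolding j .
  qed
  have "(\<lambda>n. of_int \<lfloor>x * 2 ^ n\<rfloor> / 2 ^ n) \<longlonglongrightarrow> x"
  proof (rule tendsto_sandwich[of "\<lambda>n. x - (1 / 2) ^ n" _ _ "\<lambda>_. x"])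
    show "\<forall>\<^sub>F n in sequentially. x - (1 / 2) ^ n \<le> of_int \<lfloor>x * 2 ^ n\<rfloor> / 2 ^ n"
    proof (intro always_eventually allI)
      fix n
      have "x * 2 ^ n - 1 \<le> of_int \<lfloor>x * 2 ^ n\<rfloor>" by linarith
      then have "(x * 2 ^ n - 1) / 2 ^ n \<le> of_int \<lfloor>x * 2 ^ n\<rfloor> / 2 ^ n"
        by (intro divide_right_mono) simp_all
      moreover have "(x * 2 ^ n - 1) / 2 ^ n = x - (1 / 2) ^ n"
        by (simp add: diff_divide_distrib power_divide)
      ultimately show "x - (1 / 2) ^ n \<le> of_int \<lfloor>x * 2 ^ n\<rfloor> / 2 ^ n" by simp
    qed
    show "\<forall>\<^sub>F n in sequentially. of_int \<lfloor>x * 2 ^ n\<rfloor> / 2 ^ n \<le> x"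
      by (intro always_eventually allI) (simp add: field_simps)
    have "(\<lambda>n. x - (1 / 2) ^ n) \<longlonglongrightarrow> x - 0" by (intro tendsto_intros LIMSEQ_power_zero) auto
    then show "(\<lambda>n. x - (1 / 2) ^ n) \<longlonglongrightarrow> x" by simp
  qed simp
  then have "(\<lambda>n. of_bool (?s !! n) / 2 ^ Suc n) sums x"
    unfolding sums_def partial .
  then show ?thesis unfolding binary_value_def by (blast dest: sums_unique[symmetric])
qed

lemma circle_of_binary_surj:
  assumes "c \<in> circle" shows "\<exists>s. circle_of_binary s = c"
proof -
  obtain x where x: "c = circle_proj x" using assms by (auto simp: circle_def)
  obtain s where "binary_value s = x - of_int \<lfloor>x\<rfloor>" using binary_expansion frac_range[of x]
    by (metis atLeastLessThan_iff)
  then have "circle_of_binary s = c"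
    using x circle_proj_add_int[of "x - of_int \<lfloor>x\<rfloor>" "\<lfloor>x\<rfloor>"] by (simp add: circle_of_binary_value)
  then show ?thesis by blast
qed

section \<open>Prefix replacement by piecewise affine maps\<close>

lemma dyadics_common_denominator:
  assumes "finite A" "A \<subseteq> dyadics" shows "\<exists>N. \<forall>x\<in>A. \<forall>n\<ge>N. x * 2 ^ n \<in> \<int>"
  using assms
proof (induction rule: finite_induct)
  case (insert a A)
  then obtain N where N: "\<And>x n. x \<in> A \<Longrightarrow> n \<ge> N \<Longrightarrow> x * 2 ^ n \<in> \<int>" by auto
  obtain M where M: "a * 2 ^ M \<in> \<int>" using insert by (auto simp: dyadics_iff)
  have a: "a * 2 ^ n \<in> \<int>" if "n \<ge> M" for n
  proof -
    have "a * 2 ^ n = (a * 2 ^ M) * 2 ^ (n - M)" using that by (simp add: power_add[symmetric])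
    then show ?thesis using M by (metis Ints_mult Ints_numeral Ints_power)
  qed
  show ?case
    by (intro exI[of _ "max M N"]) (use a N in auto)
qed simp

text \<open>A point of the cylinder of \<open>u\<close> is \<open>(m + w) / 2^n\<close> for the
  number \<open>m\<close> of \<open>u\<close> and the value \<open>w\<close> of the tail. An affine
  piece \<open>2^k x + c\<close> sends it to \<open>(m + j + w) / 2^l\<close> with
  \<open>l = n - k\<close> and \<open>j = 2^l c\<close>. If \<open>j\<close> is an integer and
  \<open>l\<close> is not negative, this is again a prefix followed by the same tail, up to an
  integer.\<close>

lemma lifts_cylinders:
  assumes h: "h \<in> lifts"
  shows "\<exists>N. \<forall>u. length u = N \<longrightarrow>
    (\<exists>v. \<forall>w. circle_proj (h (binary_value (u @- w))) = circle_proj (binary_value (v @- w)))"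
proof -
  obtain B where B: "B \<subseteq> dyadics" "\<And>p q. finite (B \<inter> {p..q})"
    "\<And>a b. a < b \<Longrightarrow> {a<..<b} \<inter> B = {} \<Longrightarrow> (\<exists>(k::int) (c::real). \<forall>x\<in>{a..b}. h x = 2 powi k * x + c)"
    using lifts_pieces[OF h] by metis
  obtain N where N: "\<And>b. b \<in> B \<inter> {0..1} \<Longrightarrow> b * 2 ^ N \<in> \<int>"
    using dyadics_common_denominator[OF B(2), of 0 1] B(1) by blast
  define lo hi where "lo u = real (bits_value u) / 2 ^ N" and "hi u = (real (bits_value u) + 1) / 2 ^ N"
    for u :: "bool list"
  have lohi: "lo u < hi u" for u by (simp add: lo_def hi_def divide_strict_right_mono)
  have "\<exists>(k::int) (c::real). \<forall>x\<in>{lo u..hi u}. h x = 2 powi k * x + c" if u: "length u = N" for u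
  proof (rule B(3)[OF lohi])
    show "{lo u<..<hi u} \<inter> B = {}"
    proof (rule ccontr)
      assume "\<not> ?thesis"
      then obtain x where x: "x \<in> B" "lo u < x" "x < hi u" by auto
      then have x': "real (bits_value u) < x * 2 ^ N" "x * 2 ^ N < real (bits_value u) + 1"
        by (simp_all add: lo_def hi_def field_simps)
      have "bits_value u + 1 \<le> 2 ^ N" using horner_sum_bits_less[of u] u by simp
      then have "real (bits_value u + 1) \<le> real (2 ^ N)" by (simp only: of_nat_le_iff)
      then have "real (bits_value u) + 1 \<le> 2 ^ N" by simp
      then have "x * 2 ^ N \<le> 2 ^ N" using x'(2) by linarith
      then have "x * 2 ^ N \<le> 1 * 2 ^ N" by (simp only: mult_1)
      then have "x \<le> 1" by (rule mult_right_le_imp_le) simp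
      have "0 < x * 2 ^ N" using x'(1) of_nat_0_le_iff[of "bits_value u"] by linarith
      then have "0 \<le> x" by (simp add: zero_less_mult_iff)
      with \<open>x \<le> 1\<close> have "x \<in> B \<inter> {0..1}" using x(1) by simp
      then obtain m where "x * 2 ^ N = of_int m" using N by (auto elim: Ints_cases)
      then have "real_of_int (int (bits_value u)) < of_int m" "real_of_int m < of_int (int (bits_value u) + 1)"
        using x' by simp_all
      then show False by (simp only: of_int_less_iff)
    qed
  qed
  then obtain k :: "bool list \<Rightarrow> int" and c :: "bool list \<Rightarrow> real" where
    kc: "\<And>u x. length u = N \<Longrightarrow> x \<in> {lo u..hi u} \<Longrightarrow> h x = 2 powi (k u) * x + c u"
    by metis
  have c: "c u \<in> dyadics" if "length u = N" for u
    using affine_piece_dyadic[OF h lohi kc[OF that]] .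
  \<comment> \<open>The requirement that \<open>2^l c\<close> be an integer with
    \<open>l = n - k\<close> concerns the denominator of \<open>c 2^-k\<close>.\<close>
  let ?D = "(\<lambda>u. c u * 2 powi (- k u)) ` set (bits N)"
  have "finite ?D" "?D \<subseteq> dyadics" using c by (auto simp: set_bits intro: finite_imageI) (metis List.finite_set finite_imageI set_bits)
  then obtain M where M: "\<And>u n. length u = N \<Longrightarrow> n \<ge> M \<Longrightarrow> c u * 2 powi (- k u) * 2 ^ n \<in> \<int>"
    using dyadics_common_denominator[of ?D] by (auto simp: set_bits)
  \<comment> \<open>The three summands make the cylinders avoid the breakpoints, the shifts
    \<open>j\<close> integral, and all exponents \<open>n - k\<close> nonnegative.\<close>
  define n where "n = N + M + (\<Sum>u\<in>set (bits N). nat (k u))"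
  show ?thesis
  proof (intro exI[of _ n] allI impI)
    fix u :: "bool list" assume u: "length u = n"
    define u' where "u' = take N u"
    have u': "length u' = N" "u = u' @ drop N u" using u by (auto simp: u'_def n_def)
    then have "u' \<in> set (bits N)" by (simp add: set_bits)
    then have "nat (k u') \<le> (\<Sum>u\<in>set (bits N). nat (k u))" by (intro member_le_sum) auto
    then have "nat (k u') \<le> n" unfolding n_def by linarith
    then have kn: "k u' \<le> int n" by linarith
    define l where "l = nat (int n - k u')"
    have l: "(2::real) ^ l = 2 ^ n * 2 powi (- k u')"
    proof -
      have "(2::real) ^ l = 2 powi (int n - k u')" using kn by (simp add: l_def power_int_def)
      also have "\<dots> = 2 ^ n * 2 powi (- k u')" by (simp add: power_int_diff power_int_minus field_simps)
      finally show ?thesis .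
    qed
    have "c u' * 2 powi (- k u') * 2 ^ n \<in> \<int>" using M u'(1) by (simp add: n_def)
    then obtain j where j: "2 ^ l * c u' = of_int j" using l by (auto elim!: Ints_cases simp: mult_ac)
    \<comment> \<open>The quotient by \<open>2^l\<close> is an integer translation, invisible on the
      circle; the remainder is the number of the new prefix.\<close>
    define m where "m = nat ((int (bits_value u) + j) mod 2 ^ l)"
    have "m < 2 ^ l" by (simp add: m_def nat_less_iff)
    define v where "v = bits l ! m"
    have v: "bits_value v = m" "length v = l" using bits_value_nth[OF \<open>m < 2 ^ l\<close>] by (auto simp: v_def)
    define q where "q = (int (bits_value u) + j) div 2 ^ l"
    have "int m + 2 ^ l * q = int (bits_value u) + j"
      by (simp add: m_def q_def)
    then have "real_of_int (int m + 2 ^ l * q) = real_of_int (int (bits_value u) + j)" by simp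
    then have mq: "real m + 2 ^ l * of_int q = real (bits_value u) + of_int j" by simp
    show "\<exists>v. \<forall>w. circle_proj (h (binary_value (u @- w))) = circle_proj (binary_value (v @- w))"
    proof (intro exI[of _ v] allI)
      fix w
      let ?x = "binary_value (u @- w)"
      have "?x = (real (bits_value u') + binary_value (drop N u @- w)) / 2 ^ N"
        using u' binary_value_shift[of u' "drop N u @- w"] by (metis shift_append)
      then have "?x \<in> {lo u'..hi u'}"
        using binary_value_nonneg[of "drop N u @- w"] binary_value_le_1[of "drop N u @- w"]
        by (auto simp: lo_def hi_def divide_right_mono)
      then have "h ?x = 2 powi (k u') * ?x + c u'" using kc[OF u'(1)] by blast
      then have "2 ^ l * h ?x = 2 ^ n * ?x + 2 ^ l * c u'"
        by (simp add: l distrib_left power_int_minus)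
      also have "\<dots> = real (bits_value u) + binary_value w + of_int j"
        using j binary_value_shift[of u w] u by simp
      also have "\<dots> = 2 ^ l * binary_value (v @- w) + 2 ^ l * of_int q"
        using mq binary_value_shift[of v w] v by simp
      finally have "2 ^ l * h ?x = 2 ^ l * (binary_value (v @- w) + of_int q)" by (simp add: distrib_left)
      then have "h ?x = binary_value (v @- w) + of_int q" by simp
      then show "circle_proj (h ?x) = circle_proj (binary_value (v @- w))" by simp
    qed
  qed
qed

text \<open>An image point can have two expansions; the one with the same kind of tail as the
  argument is taken.\<close>

definition T_to_V :: "(real set \<Rightarrow> real set) \<Rightarrow> bool stream \<Rightarrow> bool stream" where
  "T_to_V f s = (THE t. circle_of_binary t = f (circle_of_binary s) \<and> eventually_True t = eventually_True s)"

lemma T_to_V_eqI: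
  "circle_of_binary t = f (circle_of_binary s) \<Longrightarrow> eventually_True t = eventually_True s \<Longrightarrow> T_to_V f s = t"
  unfolding T_to_V_def using circle_of_binary_inj by (intro the_equality) auto

text \<open>The expansion found by \<open>lifts_cylinders\<close> has the same tail as the argument,
  hence the right kind of tail, and \<open>circle_of_binary_inj\<close> makes it the only candidate.
  So the description of the value is justified together with its properties.\<close>

lemma T_to_V_cylinders:
  assumes "f \<in> carrier thompson_T"
  shows "\<exists>N. prefix_replacing N (T_to_V f)"
    and "circle_of_binary (T_to_V f s) = f (circle_of_binary s)"
    and "eventually_True (T_to_V f s) = eventually_True s"
proof -
  obtain h where h: "h \<in> lifts" "f = circle_map h" using assms unfolding carrier_T by blast
  obtain N v where v: "\<And>u w. length u = N \<Longrightarrow>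
      circle_proj (h (binary_value (u @- w))) = circle_proj (binary_value (v u @- w))"
    using lifts_cylinders[OF h(1)] by metis
  have cob: "circle_of_binary (v u @- w) = f (circle_of_binary (u @- w))" if "length u = N" for u w
    using v[OF that] h by (simp add: circle_of_binary_value)
  then have *: "T_to_V f (u @- w) = v u @- w" if "length u = N" for u w
    using that by (intro T_to_V_eqI) auto
  then show "\<exists>N. prefix_replacing N (T_to_V f)"
    unfolding prefix_replacing_def cylinder_map_def by blast
  have s: "s = stake N s @- sdrop N s" by (simp add: stake_sdrop)
  have "T_to_V f s = v (stake N s) @- sdrop N s"
    using *[of "stake N s" "sdrop N s"] s by simp
  then show "circle_of_binary (T_to_V f s) = f (circle_of_binary s)"
    "eventually_True (T_to_V f s) = eventually_True s"
    using cob[of "stake N s" "sdrop N s"] s eventually_True_shift[of "stake N s" "sdrop N s"] by auto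
qed

lemma T_apply:
  assumes "f \<in> carrier thompson_T" "g \<in> carrier thompson_T" "c \<in> circle"
  shows "(f \<otimes>\<^bsub>thompson_T\<^esub> g) c = f (g c)"
proof -
  have "f \<in> Bij circle" "g \<in> Bij circle" using assms by (auto simp: thompson_T_def)
  then show ?thesis using assms(3) by (simp add: thompson_T_def BijGroup_def compose_def)
qed

lemma circle_of_binary_in_circle [simp]: "circle_of_binary s \<in> circle"
  by (simp add: circle_of_binary_value)

lemma T_to_V_mult:
  assumes "f \<in> carrier thompson_T" "g \<in> carrier thompson_T"
  shows "T_to_V (f \<otimes>\<^bsub>thompson_T\<^esub> g) = T_to_V f \<circ> T_to_V g"
proof
  fix s
  show "T_to_V (f \<otimes>\<^bsub>thompson_T\<^esub> g) s = (T_to_V f \<circ> T_to_V g) s"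
    using assms by (intro T_to_V_eqI) (simp_all add: T_apply T_to_V_cylinders)
qed

lemma T_to_V_one: "T_to_V \<one>\<^bsub>thompson_T\<^esub> = id"
proof
  show "T_to_V \<one>\<^bsub>thompson_T\<^esub> s = id s" for s
    by (rule T_to_V_eqI) (simp_all add: thompson_T_def BijGroup_def)
qed

text \<open>Bijectivity comes from multiplicativity: the image of the inverse is a two-sided
  inverse.\<close>

lemma T_to_V_in_V:
  assumes f: "f \<in> carrier thompson_T" shows "T_to_V f \<in> carrier thompson_V"
proof -
  have "T_to_V f \<circ> T_to_V (inv\<^bsub>thompson_T\<^esub> f) = id" "T_to_V (inv\<^bsub>thompson_T\<^esub> f) \<circ> T_to_V f = id"
    using T_to_V_mult[OF f T.inv_closed[OF f]] T_to_V_mult[OF T.inv_closed[OF f] f] T_to_V_one f by simp_all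
  then have "bij (T_to_V f)" by (metis o_bij)
  then show ?thesis using T_to_V_cylinders(1)[OF f] by (simp add: carrier_V_iff)
qed

lemma T_to_V_mon: "T_to_V \<in> mon thompson_T thompson_V"
  unfolding mon_def hom_def
proof (intro CollectI conjI funcsetI ballI inj_onI)
  fix f g assume f: "f \<in> carrier thompson_T" and g: "g \<in> carrier thompson_T"
  show "T_to_V f \<in> carrier thompson_V" by (rule T_to_V_in_V[OF f])
  show "T_to_V (f \<otimes>\<^bsub>thompson_T\<^esub> g) = T_to_V f \<otimes>\<^bsub>thompson_V\<^esub> T_to_V g"
    using f g by (simp add: T_to_V_mult V_mult T_to_V_in_V)
  assume eq: "T_to_V f = T_to_V g"
  show "f = g"
  proof (rule extensionalityI)
    show "f \<in> extensional circle" "g \<in> extensional circle"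
      using f g by (auto simp: thompson_T_def Bij_def)
    fix c assume "c \<in> circle"
    then obtain s where "circle_of_binary s = c" using circle_of_binary_surj by blast
    then show "f c = g c" using T_to_V_cylinders(2)[OF f, of s] T_to_V_cylinders(2)[OF g, of s] eq by simp
  qed
qed

section \<open>Generators and the nontrivial commutators\<close>

definition F_to_V :: "(real \<Rightarrow> real) \<Rightarrow> bool stream \<Rightarrow> bool stream" where
  "F_to_V f = T_to_V (F_to_T f)"

lemma F_to_T_in_T: "f \<in> carrier thompson_F \<Longrightarrow> F_to_T f \<in> carrier thompson_T"
  using F_to_T_mon by (auto simp: mon_def hom_def)

lemma F_to_V_mon: "F_to_V \<in> mon thompson_F thompson_V"
  using mon_compose[OF F_to_T_mon T_to_V_mon] by (simp add: F_to_V_def[abs_def] comp_def)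

lemma binary_value_unit: "binary_value s \<in> {0..1}"
  using binary_value_nonneg binary_value_le_1 by simp

lemma F_to_V_eqI:
  assumes "f \<in> carrier thompson_F" "binary_value (g s) = f (binary_value s)"
    "eventually_True (g s) = eventually_True s"
  shows "F_to_V f s = g s"
  unfolding F_to_V_def
  by (rule T_to_V_eqI) (simp_all add: assms circle_of_binary_value F_to_T_proj[OF assms(1) binary_value_unit])

text \<open>Equality on the circle determines the value in [0, 1) only, since 0 and 1 are the same
  point; expansions that do not end in ones stay in this interval.\<close>

lemma F_to_V_value:
  assumes f: "f \<in> carrier thompson_F" and s: "\<not> eventually_True s"
  shows "binary_value (F_to_V f s) = f (binary_value s)"
proof (rule circle_proj_eq_unit)
  show "circle_proj (binary_value (F_to_V f s)) = circle_proj (f (binary_value s))"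
    using T_to_V_cylinders(2)[OF F_to_T_in_T[OF f], of s] F_to_T_proj[OF f binary_value_unit]
    by (simp add: F_to_V_def circle_of_binary_value)
  have "\<not> eventually_True (F_to_V f s)"
    using s T_to_V_cylinders(3)[OF F_to_T_in_T[OF f]] by (simp add: F_to_V_def)
  then show "0 \<le> binary_value (F_to_V f s)" "binary_value (F_to_V f s) < 1"
    using binary_value_nonneg binary_value_less_1 by auto
  show "0 \<le> f (binary_value s)" "f (binary_value s) < 1"
    using F_unit[OF f, of "binary_value s"] binary_value_less_1[OF s] binary_value_nonneg by auto
qed

lemma F_mono: "f \<in> carrier thompson_F \<Longrightarrow> x \<in> {0..1} \<Longrightarrow> y \<in> {0..1} \<Longrightarrow> x < y \<Longrightarrow> f x < f y"
  by (auto simp: thompson_F_def strict_mono_on_def)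

section \<open>Elements of F as tree pairs\<close>

definition cylinder_start :: "bool list \<Rightarrow> real" where
  "cylinder_start u = binary_value (u @- sconst False)"

lemma not_eventually_True_start: "\<not> eventually_True (u @- sconst False)"
  by (simp add: eventually_True_sconst)

lemma cylinder_start_unit: "0 \<le> cylinder_start u" "cylinder_start u < 1"
  using binary_value_nonneg binary_value_less_1[OF not_eventually_True_start]
  by (auto simp: cylinder_start_def)

lemma cylinder_start_Cons: "cylinder_start (b # u) = of_bool b / 2 + cylinder_start u / 2"
  by (simp add: cylinder_start_def binary_value_SCons)

lemma sorted_leaves: "sorted_wrt (<) (map cylinder_start (leaves t))"
proof (induction t)
  case (Node l r)
  have "cylinder_start u / 2 < 1 / 2 + cylinder_start v / 2" for u v
    using cylinder_start_unit[of u] cylinder_start_unit[of v] by linarith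
  with Node show ?case
    by (simp add: sorted_wrt_append sorted_wrt_map cylinder_start_Cons)
qed simp

text \<open>An increasing map sends the left endpoints of the cylinders, listed from left to right,
  to an increasing list. The leaves of the tree of the image code are also listed from left to
  right, so the two lists with the same elements coincide.\<close>

lemma F_to_V_tree_pair:
  assumes f: "f \<in> carrier thompson_F"
  obtains s t where "maps_list (F_to_V f) (leaves s) (leaves t)"
proof -
  let ?g = "F_to_V f"
  have g: "?g \<in> carrier thompson_V" using F_to_V_mon f by (auto simp: mon_def hom_def)
  then obtain N where "prefix_replacing N ?g" by (auto simp: carrier_V_iff)
  then obtain v where v: "\<And>u. length u = N \<Longrightarrow> cylinder_map ?g u (v u)"
    unfolding prefix_replacing_def by metis
  let ?vs = "map v (bits N)"
  obtain t where t: "set (leaves t) = set ?vs"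
    using complete_prefix_code_leaves prefix_replacing_code(2)[OF V_bij[OF g] v] by blast
  have start: "cylinder_start (v u) = f (cylinder_start u)" if "length u = N" for u
    using F_to_V_value[OF f not_eventually_True_start[of u]] v[OF that]
    by (simp add: cylinder_start_def cylinder_map_def)
  have "sorted_wrt (\<lambda>a b. f a < f b) (map cylinder_start (bits N))"
    using sorted_leaves[of "full_tree N"] unfolding leaves_full_tree
    by (rule sorted_wrt_mono_rel[rotated]) (auto intro!: F_mono[OF f] simp: cylinder_start_unit less_imp_le)
  then have "sorted_wrt (<) (map f (map cylinder_start (bits N)))"
    by (simp add: sorted_wrt_map)
  also have "map f (map cylinder_start (bits N)) = map cylinder_start ?vs"
    using start by (auto dest: length_in_bits)
  finally have eq: "map cylinder_start ?vs = map cylinder_start (leaves t)"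
    using strict_sorted_equal[OF sorted_leaves[of t]] t by (simp only: set_map)
  have "distinct (map cylinder_start (leaves t))"
    using sorted_leaves[of t] by (simp only: strict_sorted_iff)
  then have "inj_on cylinder_start (set (leaves t))" by (simp only: distinct_map)
  then have "?vs = leaves t"
    using eq t by (intro map_inj_on[of cylinder_start ?vs "leaves t"]) simp_all
  moreover have "maps_list ?g (leaves (full_tree N)) ?vs"
    unfolding maps_list_def leaves_full_tree
    by (simp add: list_all2_conv_all_nth v length_in_bits[OF nth_mem])
  ultimately show thesis using that by metis
qed

lemma F_memI:
  assumes g: "\<And>t. t \<in> {0..1} \<Longrightarrow> g t \<in> {0..1}" "\<And>t. t \<in> {0..1} \<Longrightarrow> g' t \<in> {0..1}"
    and inv: "\<And>t. t \<in> {0..1} \<Longrightarrow> g' (g t) = t" "\<And>t. t \<in> {0..1} \<Longrightarrow> g (g' t) = t"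
    and cont: "continuous_on {0..1} g" "continuous_on {0..1} g'"
    and mono: "\<And>s t. s \<in> {0..1} \<Longrightarrow> t \<in> {0..1} \<Longrightarrow> s < t \<Longrightarrow> g s < g t"
    and aff: "dyadic_piecewise_affine_on 0 1 g"
  shows "restrict g {0..1} \<in> carrier thompson_F"
proof -
  have bij: "bij_betw g {0..1} {0..1}"
    by (rule bij_betw_byWitness[where f' = g']) (simp_all add: g inv image_subset_iff del: atLeastAtMost_iff)
  have bij': "bij_betw g' {0..1} {0..1}"
    by (rule bij_betw_byWitness[where f' = g]) (simp_all add: g inv image_subset_iff del: atLeastAtMost_iff)
  have img: "g ` {0..1} = {0..1}" "g' ` {0..1} = {0..1}"
    using bij bij' by (simp_all only: bij_betw_def)
  have bij_restrict: "bij_betw (restrict g {0..1}) {0..1} {0..1}"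
    using bij bij_betw_cong[of "{0..1}" "restrict g {0..1}" g "{0..1}"] by simp
  have "homeomorphism {0..1} {0..1} (restrict g {0..1}) g'"
    unfolding homeomorphism_def
  proof (intro conjI ballI)
    show "continuous_on {0..1} (restrict g {0..1})"
      by (rule continuous_on_eq[OF cont(1)]) simp
    show "restrict g {0..1} ` {0..1} = {0..1}" using img(1) by simp
    show "restrict g {0..1} (g' y) = y" if "y \<in> {0..1}" for y
      using that by (simp add: g inv del: atLeastAtMost_iff)
    show "continuous_on {0..1} g'" "g' ` {0..1} = {0..1}" by (fact cont(2), fact img(2))
    show "g' (restrict g {0..1} x) = x" if "x \<in> {0..1}" for x
      using that by (simp add: inv del: atLeastAtMost_iff)
  qed
  moreover have "dyadic_piecewise_affine_on 0 1 (restrict g {0..1})"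
    using aff unfolding dyadic_piecewise_affine_on_def
    by (auto elim!: ex_forward simp: Ball_def)
  moreover have "strict_mono_on {0..1} (restrict g {0..1})"
    using mono by (simp add: strict_mono_on_def)
  ultimately show ?thesis
    using bij_restrict by (auto simp: thompson_F_def Bij_def)
qed

text \<open>The slopes 1/2, 1, 2 increase, so this convex function is the maximum of its affine
  pieces. In this form continuity is immediate.\<close>

definition x0_fun :: "real \<Rightarrow> real" where
  "x0_fun t = max (t / 2) (max (t - 1 / 4) (2 * t - 1))"

text \<open>The copy of \<open>x0_fun\<close> on [1/2, 1], continued by the identity below 1/2; the
  inner maximum exceeds \<open>t\<close> exactly on the left half, where the outer minimum removes
  it.\<close>

definition x1_fun :: "real \<Rightarrow> real" where
  "x1_fun t = min t (max (t / 2 + 1 / 4) (max (t - 1 / 8) (2 * t - 1)))"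

definition x0 :: "real \<Rightarrow> real" where "x0 = restrict x0_fun {0..1}"

definition x1 :: "real \<Rightarrow> real" where "x1 = restrict x1_fun {0..1}"

lemma x0_eq:
  "0 \<le> t \<Longrightarrow> t \<le> 1 / 2 \<Longrightarrow> x0 t = t / 2"
  "1 / 2 \<le> t \<Longrightarrow> t \<le> 3 / 4 \<Longrightarrow> x0 t = t - 1 / 4"
  "3 / 4 \<le> t \<Longrightarrow> t \<le> 1 \<Longrightarrow> x0 t = 2 * t - 1"
  by (auto simp: x0_def x0_fun_def max_def)

lemma x1_eq:
  "0 \<le> t \<Longrightarrow> t \<le> 1 / 2 \<Longrightarrow> x1 t = t"
  "1 / 2 \<le> t \<Longrightarrow> t \<le> 3 / 4 \<Longrightarrow> x1 t = t / 2 + 1 / 4"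
  "3 / 4 \<le> t \<Longrightarrow> t \<le> 7 / 8 \<Longrightarrow> x1 t = t - 1 / 8"
  "7 / 8 \<le> t \<Longrightarrow> t \<le> 1 \<Longrightarrow> x1 t = 2 * t - 1"
  by (auto simp: x1_def x1_fun_def max_def min_def)

lemma dyadics_divide_power: "of_int m / 2 ^ n \<in> dyadics"
  unfolding dyadics_def by blast

lemma x0_in_F: "x0 \<in> carrier thompson_F"
  unfolding x0_def
\<comment> \<open>The inverse of an increasing convex function is concave, hence the minimum of the
  inverses of the pieces.\<close>
proof (rule F_memI[where g' = "\<lambda>t. min (2 * t) (min (t + 1 / 4) ((t + 1) / 2))"])
  show "continuous_on {0..1} x0_fun" "continuous_on {0..1} (\<lambda>t::real. min (2 * t) (min (t + 1 / 4) ((t + 1) / 2)))"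
    unfolding x0_fun_def by (intro continuous_intros; simp)+
  show "dyadic_piecewise_affine_on 0 1 x0_fun"
    unfolding dyadic_piecewise_affine_on_def
  proof (intro exI[of _ "{1 / 2, 3 / 4}"] conjI allI impI)
    show "{1 / 2, 3 / 4} \<subseteq> dyadics"
      using dyadics_divide_power[of 1 1] dyadics_divide_power[of 3 2] by simp
    fix a b :: real
    assume ab: "0 \<le> a \<and> a < b \<and> b \<le> 1 \<and> {a<..<b} \<inter> {1 / 2, 3 / 4} = {}"
    then consider "b \<le> 1 / 2" | "1 / 2 \<le> a" "b \<le> 3 / 4" | "3 / 4 \<le> a" by force
    then show "\<exists>(k::int) (c::real). \<forall>x\<in>{a..b}. x0_fun x = 2 powi k * x + c"
    proof cases
      case 1
      then show ?thesis by (intro exI[of _ "-1::int"] exI[of _ "0::real"]) (auto simp: x0_fun_def max_def)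
    next
      case 2
      then show ?thesis by (intro exI[of _ "0::int"] exI[of _ "-1/4::real"]) (auto simp: x0_fun_def max_def)
    next
      case 3
      then show ?thesis using ab by (intro exI[of _ "1::int"] exI[of _ "-1::real"]) (auto simp: x0_fun_def max_def)
    qed
  qed simp
  show "x0_fun (min (2 * t) (min (t + 1 / 4) ((t + 1) / 2))) = t" if "t \<in> {0..1}" for t
    using that by (auto simp: x0_fun_def max_def min_def field_simps)
qed (auto simp: x0_fun_def max_def min_def)

lemma x1_in_F: "x1 \<in> carrier thompson_F"
  unfolding x1_def
proof (rule F_memI[where g' = "\<lambda>t. max t (min (2 * t - 1 / 2) (min (t + 1 / 8) ((t + 1) / 2)))"])
  show "continuous_on {0..1} x1_fun"
    "continuous_on {0..1} (\<lambda>t::real. max t (min (2 * t - 1 / 2) (min (t + 1 / 8) ((t + 1) / 2))))"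
    unfolding x1_fun_def by (intro continuous_intros; simp)+
  show "dyadic_piecewise_affine_on 0 1 x1_fun"
    unfolding dyadic_piecewise_affine_on_def
  proof (intro exI[of _ "{1 / 2, 3 / 4, 7 / 8}"] conjI allI impI)
    show "{1 / 2, 3 / 4, 7 / 8} \<subseteq> dyadics"
      using dyadics_divide_power[of 1 1] dyadics_divide_power[of 3 2] dyadics_divide_power[of 7 3] by simp
    fix a b :: real
    assume ab: "0 \<le> a \<and> a < b \<and> b \<le> 1 \<and> {a<..<b} \<inter> {1 / 2, 3 / 4, 7 / 8} = {}"
    then consider "b \<le> 1 / 2" | "1 / 2 \<le> a" "b \<le> 3 / 4" | "3 / 4 \<le> a" "b \<le> 7 / 8" | "7 / 8 \<le> a" by force
    then show "\<exists>(k::int) (c::real). \<forall>x\<in>{a..b}. x1_fun x = 2 powi k * x + c"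
    proof cases
      case 1
      then show ?thesis by (intro exI[of _ "0::int"] exI[of _ "0::real"]) (auto simp: x1_fun_def max_def min_def)
    next
      case 2
      then show ?thesis by (intro exI[of _ "-1::int"] exI[of _ "1/4::real"]) (auto simp: x1_fun_def max_def min_def)
    next
      case 3
      then show ?thesis by (intro exI[of _ "0::int"] exI[of _ "-1/8::real"]) (auto simp: x1_fun_def max_def min_def)
    next
      case 4
      then show ?thesis using ab by (intro exI[of _ "1::int"] exI[of _ "-1::real"]) (auto simp: x1_fun_def max_def min_def)
    qed
  qed simp
qed (auto simp: x1_fun_def max_def min_def field_simps)

lemma binary_value_contract: "binary_value (contract s) = x0 (binary_value s)"
proof (cases s rule: stream_cases2)
  case (1 a b w)
  have w: "0 \<le> binary_value w" "binary_value w \<le> 1" using binary_value_nonneg binary_value_le_1 by auto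
  have s: "binary_value s = of_bool a / 2 + of_bool b / 4 + binary_value w / 4"
    by (simp add: 1 binary_value_SCons)
  show ?thesis
  proof (cases a)
    case False
    then have "x0 (binary_value s) = binary_value s / 2"
      using s w by (intro x0_eq(1)) (cases b; simp)+
    then show ?thesis using False s by (simp add: 1 contract_def binary_value_SCons)
  next
    case a: True
    show ?thesis
    proof (cases b)
      case False
      then have "x0 (binary_value s) = binary_value s - 1 / 4"
        using s w a by (intro x0_eq(2)) simp_all
      then show ?thesis using False a s by (simp add: 1 contract_def binary_value_SCons)
    next
      case True
      then have "x0 (binary_value s) = 2 * binary_value s - 1"
        using s w a by (intro x0_eq(3)) simp_all
      then show ?thesis using True a s by (simp add: 1 contract_def binary_value_SCons)
    qed
  qed
qed

lemma eventually_True_contract [simp]: "eventually_True (contract s) = eventually_True s"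
  by (cases s rule: stream_cases2) (simp add: contract_def)

text \<open>Prefixing the digit 1 to an expansion of \<open>t\<close> gives the value
  \<open>1/2 + t/2\<close>, so this is the counterpart on numbers of \<open>on_True\<close>.\<close>

lemma x1_half: 
  assumes "0 \<le> t" "t \<le> 1" shows "x1 (1 / 2 + t / 2) = 1 / 2 + x0 t / 2"
proof -
  consider "t \<le> 1 / 2" | "1 / 2 \<le> t" "t \<le> 3 / 4" | "3 / 4 \<le> t" by linarith
  then show ?thesis
    using assms by cases (simp_all add: x0_eq x1_eq, simp_all add: field_simps)
qed

lemma F_to_V_x0: "F_to_V x0 = contract"
  by (rule ext, rule F_to_V_eqI[OF x0_in_F]) (simp_all add: binary_value_contract)

lemma F_to_V_x1: "F_to_V x1 = on_True contract"
proof (rule ext, rule F_to_V_eqI[OF x1_in_F])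
  fix s
  have t: "0 \<le> binary_value (stl s)" "binary_value (stl s) \<le> 1"
    using binary_value_nonneg binary_value_le_1 by auto
  show "binary_value (on_True contract s) = x1 (binary_value s)"
    using t binary_value_stl[of s] x1_half[OF t]
    by (auto simp: on_True_def binary_value_SCons binary_value_contract x1_eq)
  show "eventually_True (on_True contract s) = eventually_True s"
    by (simp add: on_True_def eventually_True_stl)
qed

text \<open>The embedding in V turns an element of F into an order-preserving tree pair, which the
  images of \<open>x0\<close> and \<open>x1\<close> generate; injectivity brings the resulting
  product back to F.\<close>

theorem generate_F: "generate thompson_F {x0, x1} = carrier thompson_F"
proof (intro equalityI subsetI)
  have sub: "{x0, x1} \<subseteq> carrier thompson_F" using x0_in_F x1_in_F by simp
  show "f \<in> carrier thompson_F" if "f \<in> generate thompson_F {x0, x1}" for f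
    using F.generate_in_carrier[OF sub that] .
  fix f assume f: "f \<in> carrier thompson_F"
  interpret hom: group_hom thompson_F thompson_V F_to_V
    using F_to_V_mon by unfold_locales (simp add: mon_def)
  obtain s t where "maps_list (F_to_V f) (leaves s) (leaves t)" using F_to_V_tree_pair[OF f] .
  then have "F_to_V f \<in> F_generated"
    using tree_pair_in_generate f by simp
  also have "F_gens = F_to_V ` {x0, x1}" by (simp add: F_gens_def F_to_V_x0 F_to_V_x1)
  also have "generate thompson_V (F_to_V ` {x0, x1}) = F_to_V ` generate thompson_F {x0, x1}"
    by (rule hom.generate_img[OF sub])
  finally obtain g where g: "g \<in> generate thompson_F {x0, x1}" "F_to_V f = F_to_V g" by blast
  then have "g \<in> carrier thompson_F" using F.generate_in_carrier[OF sub] by blast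
  then have "f = g" using g(2) f F_to_V_mon by (auto simp: mon_def inj_on_def)
  then show "f \<in> generate thompson_F {x0, x1}" using g by simp
qed

lemma F_apply:
  assumes "f \<in> carrier thompson_F" "g \<in> carrier thompson_F" "t \<in> {0..1}"
  shows "(f \<otimes>\<^bsub>thompson_F\<^esub> g) t = f (g t)"
  using assms by (simp add: thompson_F_def BijGroup_def compose_def)

lemma F_closed: "f \<in> carrier thompson_F \<Longrightarrow> t \<in> {0..1} \<Longrightarrow> f t \<in> {0..1}"
  unfolding thompson_F_def using bij_betwE by (fastforce simp: Bij_def)

lemma F_inv_apply:
  assumes "f \<in> carrier thompson_F" "t \<in> {0..1}"
  shows "(inv\<^bsub>thompson_F\<^esub> f) (f t) = t"
proof -
  have "(inv\<^bsub>thompson_F\<^esub> f \<otimes>\<^bsub>thompson_F\<^esub> f) t = t"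
    using assms F.l_inv[OF assms(1)] by (simp add: F_one)
  then show ?thesis using F_apply[OF F.inv_closed[OF assms(1)] assms] by simp
qed

text \<open>Membership in the orbit of 1/2 under F. That this orbit contains all interior dyadic
  points is what is needed for generating T.\<close>

abbreviation reachable :: "real \<Rightarrow> bool" where
  "reachable y \<equiv> (\<exists>g \<in> carrier thompson_F. g y = 1 / 2)"

lemma reachable_apply:
  assumes "g \<in> carrier thompson_F" "y \<in> {0..1}" "reachable (g y)" shows "reachable y"
proof -
  obtain f where "f \<in> carrier thompson_F" "f (g y) = 1 / 2" using assms(3) by blast
  then show ?thesis
    using F_apply[of f g y] assms by (intro bexI[of _ "f \<otimes>\<^bsub>thompson_F\<^esub> g"]) auto
qed

lemma reachable_unapply:
  assumes "g \<in> carrier thompson_F" "z \<in> {0..1}" "reachable z" shows "reachable (g z)"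
  using reachable_apply[of "inv\<^bsub>thompson_F\<^esub> g" "g z"] F_inv_apply[OF assms(1,2)] F_closed[OF assms(1,2)] assms
  by auto

text \<open>One or two of the generators or their inverses halve the denominator.\<close>

lemma dyadic_reachable:
  assumes "y \<in> dyadics" "0 < y" "y < 1" shows "reachable y"
proof -
  obtain n where n: "y * 2 ^ n \<in> \<int>" using assms(1) by (auto simp: dyadics_iff)
  then show ?thesis
    using assms(2,3)
  proof (induction n arbitrary: y)
    case 0
    then obtain m where "y = of_int m" by (auto elim: Ints_cases)
    then show ?case using 0 by auto
  next
    case (Suc n)
    show ?case
    proof (cases n)
      case 0
      then obtain m where m: "y * 2 = of_int m" using Suc.prems(1) by (auto elim: Ints_cases)
      then have "m = 1" using Suc.prems(2,3) by linarith
      then have "y = 1 / 2" using m by simp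
      then have "\<one>\<^bsub>thompson_F\<^esub> y = 1 / 2" by (simp add: F_one)
      then show ?thesis using F.one_closed by blast
    next
      case n: (Suc k)
      \<comment> \<open>\<open>x0\<close> doubles distances from 3/4 on, and the inverse of
        \<open>x1\<close> does so on [1/2, 5/8]. A point in between is first moved right by 1/8 with
        the inverse of \<open>x1\<close>, and then \<open>x0\<close> applies.\<close>
      have upper: "reachable z" if z: "z * 2 ^ Suc n \<in> \<int>" "1 / 2 \<le> z" "z < 1" for z
      proof -
        consider "3 / 4 \<le> z" | "z \<le> 5 / 8" | "5 / 8 < z" "z < 3 / 4" by linarith
        then show ?thesis
        proof cases
          case 1
          have "(2 * z - 1) * 2 ^ n = z * 2 ^ Suc n - 2 ^ n" by (simp add: algebra_simps)
          also have "\<dots> \<in> \<int>" using z(1) by (metis Ints_diff Ints_numeral Ints_power)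
          finally have "reachable (2 * z - 1)" using 1 z by (intro Suc.IH) auto
          then show ?thesis
            using reachable_apply[OF x0_in_F, of z] 1 z by (simp add: x0_eq)
        next
          case 2
          have "(2 * z - 1 / 2) * 2 ^ n = z * 2 ^ Suc n - 2 ^ k" by (simp add: n algebra_simps)
          also have "\<dots> \<in> \<int>" using z(1) by (metis Ints_diff Ints_numeral Ints_power)
          finally have "reachable (2 * z - 1 / 2)" using 2 z by (intro Suc.IH) auto
          then have "reachable (x1 (2 * z - 1 / 2))"
            using 2 z by (intro reachable_unapply[OF x1_in_F]) auto
          moreover have "x1 (2 * z - 1 / 2) = z"
            using 2 z by (subst x1_eq(2)) (simp_all add: field_simps)
          ultimately show ?thesis by simp
        next
          case 3
          obtain m where m: "z * 2 ^ Suc n = of_int m" using z(1) by (auto elim: Ints_cases)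
          \<comment> \<open>The translation by 1/8 respects the denominator only if \<open>n\<close>
            is at least 2. This is the case because no multiple of 1/4 lies strictly between 5/8 and
            3/4.\<close>
          obtain l where l: "k = Suc l"
          proof (cases k)
            case 0
            then have "z * 4 = of_int m" using m n by simp
            then have "2 < m" "m < 3" using 3 by linarith+
            then show thesis by simp
          qed
          have "(2 * (z + 1 / 8) - 1) * 2 ^ n = z * 2 ^ Suc n - 3 * 2 ^ l"
            by (simp add: n l algebra_simps)
          also have "\<dots> \<in> \<int>" using z(1) by (metis Ints_diff Ints_mult Ints_numeral Ints_power)
          finally have "reachable (2 * (z + 1 / 8) - 1)" using 3 by (intro Suc.IH) auto
          then have "reachable (z + 1 / 8)"
            using reachable_apply[OF x0_in_F, of "z + 1 / 8"] 3 by (simp add: x0_eq)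
          then have "reachable (x1 (z + 1 / 8))"
            using 3 by (intro reachable_unapply[OF x1_in_F]) auto
          then show ?thesis using 3 by (simp add: x1_eq)
        qed
      qed
      consider "1 / 2 \<le> y" | "y \<le> 1 / 4" | "1 / 4 < y" "y < 1 / 2" by linarith
      then show ?thesis
      proof cases
        case 1
        then show ?thesis using upper Suc.prems by blast
      next
        case 2
        have "(2 * y) * 2 ^ n \<in> \<int>" using Suc.prems(1) by (simp add: mult_ac)
        then have "reachable (2 * y)" using 2 Suc.prems by (intro Suc.IH) auto
        then have "reachable (x0 (2 * y))"
          using 2 Suc.prems by (intro reachable_unapply[OF x0_in_F]) auto
        then show ?thesis using 2 Suc.prems by (simp add: x0_eq)
      next
        case 3
        \<comment> \<open>Moving the point to the upper half keeps its denominator, which is why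
          \<open>upper\<close> speaks of the exponent \<open>Suc n\<close> rather than that of the
          induction hypothesis.\<close>
        have "(y + 1 / 4) * 2 ^ Suc n = y * 2 ^ Suc n + 2 ^ k" by (simp add: n algebra_simps)
        also have "\<dots> \<in> \<int>" using Suc.prems(1) by (metis Ints_add Ints_numeral Ints_power)
        finally have "reachable (y + 1 / 4)" using 3 by (intro upper) auto
        then have "reachable (x0 (y + 1 / 4))"
          using 3 by (intro reachable_unapply[OF x0_in_F]) auto
        then show ?thesis using 3 by (simp add: x0_eq)
      qed
    qed
  qed
qed

section \<open>Generators of T\<close>

definition half_turn :: "real set \<Rightarrow> real set" where
  "half_turn = circle_map (\<lambda>x. x + 1 / 2)"

lemma half_turn_lift: "(\<lambda>x. x + 1 / 2) \<in> lifts"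
  using translation_lifts[of "1 / 2"] dyadics_divide_power[of 1 1] by simp

lemma half_turn_in_T: "half_turn \<in> carrier thompson_T"
  unfolding half_turn_def by (rule circle_map_in_T[OF half_turn_lift])

lemma half_turn_proj: "half_turn (circle_proj x) = circle_proj (x + 1 / 2)"
  by (simp add: half_turn_def half_turn_lift)

text \<open>F is the stabiliser of the point 0 in T: a lift sends 0 to an integer \<open>n\<close>,
  and composing with the translation by \<open>-n\<close> yields a lift that fixes 0.\<close>

lemma T_fixing_zero:
  assumes f: "f \<in> carrier thompson_T" "f (circle_proj 0) = circle_proj 0"
  shows "f \<in> F_to_T ` carrier thompson_F"
proof -
  obtain h where h: "h \<in> lifts" "f = circle_map h" using f(1) by (auto simp: carrier_T)
  then have "circle_proj (h 0) = circle_proj 0" using f(2) by simp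
  then obtain n where n: "h 0 = of_int n" by (auto simp: circle_proj_eq_iff elim: Ints_cases)
  define h' where "h' x = h (x + of_int (- n))" for x
  have h': "h' x = h x - of_int n" for x
    unfolding h'_def using lifts_of_int[OF h(1), of x "- n"] by simp
  have "(\<lambda>x. x + of_int (- n)) \<in> lifts" by (intro translation_lifts dyadics_of_int)
  then have "h \<circ> (\<lambda>x. x + of_int (- n)) \<in> lifts" using lifts_comp[OF h(1)] by blast
  then have l: "h' \<in> lifts" by (simp add: h'_def[abs_def] comp_def)
  then have fix0: "h' \<in> fixing_lifts" using h' n by (simp add: fixing_lifts_def)
  have "f = circle_map h'"
  proof (rule circle_map_eqI[OF _ l])
    show "f \<in> extensional circle" using f(1) by (simp add: thompson_T_def Bij_def)
    show "f (circle_proj x) = circle_proj (h' x)" for x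
      using circle_proj_add_int[of "h' x" n] h h' by simp
  qed
  then show ?thesis
    using F_to_T_restrict[OF fix0] restrict_in_F[OF fix0] by (metis image_eqI)
qed

lemma T_group_hom: "group_hom thompson_F thompson_T F_to_T"
  using F_to_T_mon by unfold_locales (simp add: mon_def)

text \<open>If \<open>f\<close> moves the point 0, its image is an interior dyadic point, which some
  element of F takes to 1/2 and the half turn then back to 0. The product fixes 0 and so belongs to
  F.\<close>

theorem generate_T: "generate thompson_T {F_to_T x0, F_to_T x1, half_turn} = carrier thompson_T"
proof (intro equalityI subsetI)
  let ?A = "{F_to_T x0, F_to_T x1, half_turn}"
  have sub: "?A \<subseteq> carrier thompson_T"
    using x0_in_F x1_in_F half_turn_in_T F_to_T_in_T by simp
  show "f \<in> carrier thompson_T" if "f \<in> generate thompson_T ?A" for f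
    using T.generate_in_carrier[OF sub that] .
  fix f assume f: "f \<in> carrier thompson_T"
  interpret hom: group_hom thompson_F thompson_T F_to_T by (rule T_group_hom)
  have "F_to_T ` carrier thompson_F = generate thompson_T (F_to_T ` {x0, x1})"
    using hom.generate_img[of "{x0, x1}"] x0_in_F x1_in_F generate_F by simp
  also have "\<dots> \<subseteq> generate thompson_T ?A" by (rule T.mono_generate) auto
  finally have F: "F_to_T ` carrier thompson_F \<subseteq> generate thompson_T ?A" .
  obtain h where h: "h \<in> lifts" "f = circle_map h" using f by (auto simp: carrier_T)
  define y where "y = h 0 - of_int \<lfloor>h 0\<rfloor>"
  have f0: "f (circle_proj 0) = circle_proj y"
    using h circle_proj_add_int[of y "\<lfloor>h 0\<rfloor>"] by (simp add: y_def)
  have y: "y \<in> dyadics" "0 \<le> y" "y < 1"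
    using lifts_dyadic_iff[OF h(1), of 0] frac_range[of "h 0"] by (auto simp: y_def)
  show "f \<in> generate thompson_T ?A"
  proof (cases "y = 0")
    case True
    then show ?thesis using T_fixing_zero[OF f] f0 F by blast
  next
    case False
    then have "reachable y" using y by (intro dyadic_reachable) auto
    then obtain g where g: "g \<in> carrier thompson_F" "g y = 1 / 2" by blast
    let ?k = "half_turn \<otimes>\<^bsub>thompson_T\<^esub> F_to_T g"
    have gT: "F_to_T g \<in> carrier thompson_T" using F_to_T_in_T g by blast
    have kT: "?k \<in> carrier thompson_T" using half_turn_in_T gT by simp
    have kA: "?k \<in> generate thompson_T ?A"
    proof (rule generate.eng)
      show "half_turn \<in> generate thompson_T ?A" by (rule generate.incl) simp
      show "F_to_T g \<in> generate thompson_T ?A" using F g(1) by blast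
    qed
    have "(?k \<otimes>\<^bsub>thompson_T\<^esub> f) (circle_proj 0) = half_turn (F_to_T g (circle_proj y))"
      using T_apply[OF kT f] T_apply[OF half_turn_in_T gT] f0 by simp
    also have "\<dots> = circle_proj 1"
      using F_to_T_proj[OF g(1), of y] y g(2) by (simp add: half_turn_proj)
    also have "\<dots> = circle_proj 0" by (simp add: circle_proj_eq_iff)
    finally have "?k \<otimes>\<^bsub>thompson_T\<^esub> f \<in> generate thompson_T ?A"
      using T_fixing_zero[OF T.m_closed[OF kT f]] F by blast
    then have "inv\<^bsub>thompson_T\<^esub> ?k \<otimes>\<^bsub>thompson_T\<^esub> (?k \<otimes>\<^bsub>thompson_T\<^esub> f) \<in> generate thompson_T ?A"
      by (rule generate.eng[OF T.generate_m_inv_closed[OF sub kA]])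
    moreover have "inv\<^bsub>thompson_T\<^esub> ?k \<otimes>\<^bsub>thompson_T\<^esub> (?k \<otimes>\<^bsub>thompson_T\<^esub> f) = f"
      using T.m_assoc[OF T.inv_closed[OF kT] kT f] T.l_inv[OF kT] T.l_one[OF f] by simp
    ultimately show ?thesis by simp
  qed
qed

lemma finitely_generatedI:
  assumes "group G" "finite A" "A \<subseteq> carrier G" "generate G A = carrier G"
  shows "finitely_generated_group G"
proof -
  obtain \<phi> and n :: nat where "A = \<phi> ` {i. i < n}"
    using finite_imp_nat_seg_image_inj_on[OF assms(2)] by blast
  then have "standard_generators G {i. i < n} \<phi>"
    using assms by (simp add: standard_generators_def)
  then show ?thesis using assms(1) unfolding finitely_generated_group_def by blast
qed

lemma comm_seq_hom:
  assumes "group_hom G H h" "a \<in> carrier G" "c \<in> carrier G"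
  shows "group.comm_seq H (h a) (h c) n = h (group.comm_seq G a c n)"
proof -
  interpret group_hom G H h by fact
  show ?thesis
    using assms(2,3) by (induction n) (simp_all add: G.comm_def H.comm_def G.conj_def H.conj_def)
qed

text \<open>Products apply their right factor first, so the new element is
  \<open>h^-1 y^-1 h y\<close> with \<open>h = x0 y x0^-1\<close>. From [0, 7/8] the map
  \<open>y\<close> leads to [0, 3/4], \<open>x0^-1\<close> back to [0, 7/8], \<open>y\<close> again
  to [0, 3/4], and \<open>x0\<close> to [0, 1/2]. There \<open>y\<close> is the identity, so
  \<open>y^-1\<close> drops out and \<open>h^-1\<close> cancels \<open>h\<close>.\<close>

lemma comm_seq_x1:
  "t \<in> {0..7/8} \<Longrightarrow> F.comm_seq x1 (inv\<^bsub>thompson_F\<^esub> x0) n t = x1 t"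
proof (induction n arbitrary: t)
  case (Suc n)
  let ?c = "inv\<^bsub>thompson_F\<^esub> x0"
  let ?y = "F.comm_seq x1 ?c n"
  let ?h = "F.conj ?c ?y"
  have c: "?c \<in> carrier thompson_F" using x0_in_F by simp
  have y: "?y \<in> carrier thompson_F" using x1_in_F c by simp
  have h: "?h \<in> carrier thompson_F" using y c by simp
  have yt: "?y s = x1 s" if "s \<in> {0..7/8}" for s using Suc.IH[OF that] .
  have mono: "f s \<le> f t" if "f \<in> carrier thompson_F" "s \<in> {0..1}" "t \<in> {0..1}" "s \<le> t" for f s t
    using F_mono[OF that(1-3)] that(4) by (cases "s = t") auto
  have t1: "?y t \<in> {0..3/4}"
    using yt[OF Suc.prems] mono[OF x1_in_F, of t "7/8"] F_closed[OF x1_in_F, of t] Suc.prems x1_eq(3)[of "7/8"] by auto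
  have cr: "?c (?y t) \<in> {0..7/8}"
  proof -
    have "?c (3/4) = 7/8" using F_inv_apply[OF x0_in_F, of "7/8"] x0_eq(3)[of "7/8"] by simp
    then show ?thesis using mono[OF c, of "?y t" "3/4"] F_closed[OF c, of "?y t"] t1 by auto
  qed
  have ycr: "?y (?c (?y t)) \<in> {0..3/4}"
    using yt[OF cr] mono[OF x1_in_F, of "?c (?y t)" "7/8"] F_closed[OF x1_in_F, of "?c (?y t)"] cr x1_eq(3)[of "7/8"] by auto
  have "?h (?y t) = x0 (?y (?c (?y t)))"
    using F_apply[of "inv\<^bsub>thompson_F\<^esub> ?c \<otimes>\<^bsub>thompson_F\<^esub> ?y" ?c "?y t"] F_apply[of "inv\<^bsub>thompson_F\<^esub> ?c" ?y "?c (?y t)"]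
      c y x0_in_F t1 cr by (simp add: F.conj_def)
  then have hy: "?h (?y t) \<in> {0..1/2}"
    using mono[OF x0_in_F, of "?y (?c (?y t))" "3/4"] F_closed[OF x0_in_F, of "?y (?c (?y t))"] ycr x0_eq(2)[of "3/4"] by auto
  then have "?y (?h (?y t)) = ?h (?y t)" using yt[of "?h (?y t)"] x1_eq(1)[of "?h (?y t)"] by auto
  then have iy: "(inv\<^bsub>thompson_F\<^esub> ?y) (?h (?y t)) = ?h (?y t)"
    using F_inv_apply[OF y, of "?h (?y t)"] hy by auto
  have "F.comm_seq x1 ?c (Suc n) t = (inv\<^bsub>thompson_F\<^esub> ?h) ((inv\<^bsub>thompson_F\<^esub> ?y) (?h (?y t)))"
    using h y Suc.prems t1 hy F_closed[OF y, of t] F_closed[OF F.inv_closed[OF y]]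
    by (simp add: F.comm_def F_apply)
  also have "\<dots> = ?y t" using iy F_inv_apply[OF h, of "?y t"] t1 by simp
  finally show ?case using yt[OF Suc.prems] by simp
qed simp

lemma comm_seq_nontrivial: "F.comm_seq x1 (inv\<^bsub>thompson_F\<^esub> x0) n \<noteq> \<one>\<^bsub>thompson_F\<^esub>"
proof
  assume "F.comm_seq x1 (inv\<^bsub>thompson_F\<^esub> x0) n = \<one>\<^bsub>thompson_F\<^esub>"
  then have "x1 (7/8) = 7/8" using comm_seq_x1[of "7/8" n] by (simp add: F_one)
  then show False using x1_eq(3)[of "7/8"] by simp
qed

text \<open>Nontriviality of the commutators passes to every group that contains a copy of F. Finite
  generation does not, and has to be supplied for each group.\<close>

lemma uniformly_SENS_over_F:
  assumes fg: "finitely_generated_group G" and h: "h \<in> mon thompson_F G"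
  shows "uniformly_SENS G"
proof -
  have "group G" using fg by (simp add: finitely_generated_group_def)
  then have hom: "group_hom thompson_F G h"
    using h F.group_axioms by (simp add: group_hom_def group_hom_axioms_def mon_def)
  interpret group_hom thompson_F G h by (rule hom)
  have c: "inv\<^bsub>thompson_F\<^esub> x0 \<in> carrier thompson_F" using x0_in_F by simp
  show ?thesis
  proof (rule H.uniformly_SENS_of_comm_seq[OF fg])
    show "h x1 \<in> carrier G" "h (inv\<^bsub>thompson_F\<^esub> x0) \<in> carrier G" using x1_in_F c by auto
    fix n
    have "h (F.comm_seq x1 (inv\<^bsub>thompson_F\<^esub> x0) n) \<noteq> h \<one>\<^bsub>thompson_F\<^esub>"
      using h comm_seq_nontrivial[of n] F.comm_seq_closed[OF x1_in_F c, of n]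
      unfolding mon_def inj_on_def by blast
    then show "H.comm_seq (h x1) (h (inv\<^bsub>thompson_F\<^esub> x0)) n \<noteq> \<one>\<^bsub>G\<^esub>"
      using comm_seq_hom[OF hom x1_in_F c] by simp
  qed
qed

lemma half_turn_not_in_F: "half_turn \<notin> F_to_T ` carrier thompson_F"
proof
  assume "half_turn \<in> F_to_T ` carrier thompson_F"
  then obtain f where "f \<in> carrier thompson_F" "half_turn = F_to_T f" by blast
  then have "circle_proj (0 + 1 / 2) = circle_proj 0"
    using half_turn_proj[of 0] F_to_T_proj[of f 0] F_endpoints(1)[of f] by simp
  then show False using circle_proj_eq_unit[of "1 / 2" 0] by simp
qed

lemma binary_value_sconst: "binary_value (sconst b) = of_bool b"
  using binary_value_stl[of "sconst b"] by simp

text \<open>This map separates the two binary expansions of \<open>1 / 2\<close>.\<close>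

lemma on_True_flip_not_in_T: "on_True flip \<notin> T_to_V ` carrier thompson_T"
proof
  assume "on_True flip \<in> T_to_V ` carrier thompson_T"
  then obtain f where f: "f \<in> carrier thompson_T" "on_True flip = T_to_V f" by blast
  let ?s = "False ## sconst True" and ?t = "True ## sconst False"
  have "circle_of_binary ?s = circle_of_binary ?t"
    by (simp add: circle_of_binary_value binary_value_SCons binary_value_sconst)
  then have "circle_of_binary (on_True flip ?s) = circle_of_binary (on_True flip ?t)"
    using T_to_V_cylinders(2)[OF f(1)] f(2) by simp
  then have "circle_proj (1 / 2) = circle_proj (3 / 4)"
    by (simp add: circle_of_binary_value on_True_def flip_def binary_value_SCons binary_value_sconst)
  then show False using circle_proj_eq_unit[of "1 / 2" "3 / 4"] by simp
qed

theorem corollary30: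
  shows "(\<exists>\<iota> \<in> mon thompson_F thompson_T.
            \<iota> ` carrier thompson_F \<subset> carrier thompson_T \<and>
            (\<forall>f \<in> carrier thompson_F. \<forall>x \<in> {0..1}. \<iota> f (circle_proj x) = circle_proj (f x)))
       \<and> (\<exists>\<kappa> \<in> mon thompson_T thompson_V.
            \<kappa> ` carrier thompson_T \<subset> carrier thompson_V \<and>
            (\<forall>f \<in> carrier thompson_T. \<forall>s. circle_of_binary (\<kappa> f s) = f (circle_of_binary s)))
       \<and> uniformly_SENS thompson_F \<and> uniformly_SENS thompson_T \<and> uniformly_SENS thompson_V"
proof (intro conjI bexI[of _ F_to_T] bexI[of _ T_to_V])
  show "F_to_T ` carrier thompson_F \<subset> carrier thompson_T"
    using F_to_T_in_T half_turn_in_T half_turn_not_in_F by blast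
  show "\<forall>f \<in> carrier thompson_F. \<forall>x \<in> {0..1}. F_to_T f (circle_proj x) = circle_proj (f x)"
    using F_to_T_proj by blast
  show "T_to_V ` carrier thompson_T \<subset> carrier thompson_V"
    using T_to_V_in_V on_True_in_V[OF generators_in_V(2)] on_True_flip_not_in_T by blast
  show "\<forall>f \<in> carrier thompson_T. \<forall>s. circle_of_binary (T_to_V f s) = f (circle_of_binary s)"
    using T_to_V_cylinders(2) by blast
  have "finitely_generated_group thompson_F"
    by (rule finitely_generatedI[OF F.group_axioms _ _ generate_F]) (use x0_in_F x1_in_F in auto)
  moreover have "(\<lambda>x. x) \<in> mon thompson_F thompson_F" by (simp add: mon_def hom_def)
  ultimately show "uniformly_SENS thompson_F" by (rule uniformly_SENS_over_F)
  have "finitely_generated_group thompson_T"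
    by (rule finitely_generatedI[OF T.group_axioms _ _ generate_T])
      (use x0_in_F x1_in_F half_turn_in_T F_to_T_in_T in auto)
  then show "uniformly_SENS thompson_T" by (rule uniformly_SENS_over_F[OF _ F_to_T_mon])
  have "finitely_generated_group thompson_V"
    by (rule finitely_generatedI[OF V.group_axioms _ gens_subset(2) generate_V]) (simp add: V_gens_def)
  then show "uniformly_SENS thompson_V" by (rule uniformly_SENS_over_F[OF _ F_to_V_mon])
qed (fact F_to_T_mon T_to_V_mon)+

end
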